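(* Let $\alpha>0$, fix $0<x_0<1$ and $0<M'<M$, and set $c_n=d_n n^{-1/(1+2\alpha)}$ with $d_n\ge 0$. Let $B_n\to\infty$ and $\frac{n}{\log B_n}\to\infty$, and suppose that $f_0\in F(\alpha,M')$. Let $$\Delta(f_0)=\Big\{\hat f_n:\ \limsup_{n\to\infty} n^{2\alpha/(1+2\alpha)}B_n R(\hat f_n,f_0;x_0,c_n)<\infty\Big\}.$$ (i) If $\limsup_{n\to\infty} d_n(\log B_n)^{-1/(1+2\alpha)}=0$, then for any $\hat f_n\in\Delta(f_0)$, $$\liminf_{n\to\infty}\Big(\frac{n}{\log B_n}\Big)^{2\alpha/(1+2\alpha)}\sup_{f\in F(\alpha,M)}R(\hat f_n,f;x_0,c_n)>0,$$ and there exists some $\hat f_n\in\Delta(f_0)$ satisfying $$\limsup_{n\to\infty}\Big(\frac{n}{\log B_n}\Big)^{2\alpha/(1+2\alpha)}\sup_{f\in F(\alpha,M)}R(\hat f_n,f;x_0,c_n)<\infty.$$ (ii) If $\liminf_{n\to\infty} d_n(\log B_n)^{-1/(1+2\alpha)}>0$ and $\limsup_{n\to\infty} d_n(\log B_n)^{-1}=0$, then for any $\hat f_n\in\Delta(f_0)$, $$\liminf_{n\to\infty} n^{2\alpha/(1+2\alpha)}\cdot\frac{d_n}{\log B_n}\sup_{f\in F(\alpha,M)}R(\hat f_n,f;x_0,c_n)>0,$$ and there exists some $\hat f_n\in\Delta(f_0)$ satisfying $$\limsup_{n\to\infty} n^{2\alpha/(1+2\alpha)}\frac{d_n}{\log B_n}\sup_{f\in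 F(\alpha,M)}R(\hat f_n,f;x_0,c_n)<\infty.$$ (iii) If $\liminf_{n\to\infty}\frac{d_n}{\log B_n}>0$, then there exists an estimator $\hat f_n\in\Delta(f_0)$ satisfying $$\limsup_{n\to\infty} n^{2\alpha/(1+2\alpha)}\sup_{f\in F(\alpha,M)}R(\hat f_n,f;x_0,c_n)<\infty.$$
   Context: Observation model: for each $n$ one observes the Gaussian process $Z_n^*(t)=\int_0^t f(x)\,dx+\frac{1}{\sqrt n}B^*(t)$, $0\le t\le 1$, where $B^*$ is a standard Brownian motion and $f:[0,1]\to\mathbb{R}$ is unknown. An estimator $\hat f_n$ (really a sequence indexed by $n$) is a measurable function of the observation $Z_n^*$; $E_f$ denotes expectation when the true function is $f$. Hölder class: $F(\alpha,M)=\{f:|f^{(k)}(x)-f^{(k)}(y)|\le M|x-y|^{\alpha-k},\ 0\le x<y\le 1\}$, where $k$ is the greatest integer strictly less than $\alpha$. Risk: $R(\hat f_n,f;x_0,c_n)=\frac{1}{2c_n}E_f\int_{x_0-c_n}^{x_0+c_n}(\hat f_n(x)-f(x))^2\,dx$ when $c_n>0$; the case $c_n=0$ is interpreted as the pointwise risk $E_f(\hat f_n(x_0)-f(x_0))^2$. The neighborhoods satisfy $[x_0-c_n,x_0+c_n]\subset[0,1]$. *)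

theory Defs
  imports "HOL-Probability.Probability"
begin

definition holder_order :: "real \<Rightarrow> nat" where
  "holder_order \<alpha> = (GREATEST k. real k < \<alpha>)"

lemma holder_order_eq:
  assumes "\<alpha> > 0"
  shows "holder_order \<alpha> = nat (\<lceil>\<alpha>\<rceil> - 1)"
  unfolding holder_order_def
proof (rule Greatest_equality)
  show "real (nat (\<lceil>\<alpha>\<rceil> - 1)) < \<alpha>"
    using assms by linarith
  show "k \<le> nat (\<lceil>\<alpha>\<rceil> - 1)" if "real k < \<alpha>" for k
    using that by linarith
qed

(* Derivatives are taken within [0,1], hence one-sided at the endpoints; the values of f
   outside [0,1] play no role. *)
primrec nderiv01 :: "nat \<Rightarrow> (real \<Rightarrow> real) \<Rightarrow> real \<Rightarrow> real" where
  "nderiv01 0 f = f"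
| "nderiv01 (Suc j) f = (\<lambda>x. vector_derivative (nderiv01 j f) (at x within {0..1}))"

definition holder_class :: "real \<Rightarrow> real \<Rightarrow> (real \<Rightarrow> real) set" where
  "holder_class \<alpha> M = {f.
     (\<forall>j<holder_order \<alpha>. \<forall>x\<in>{0..1}. nderiv01 j f differentiable (at x within {0..1})) \<and>
     (\<forall>x y. 0 \<le> x \<and> x < y \<and> y \<le> 1 \<longrightarrow>
        \<bar>nderiv01 (holder_order \<alpha>) f x - nderiv01 (holder_order \<alpha>) f y\<bar>
          \<le> M * \<bar>x - y\<bar> powr (\<alpha> - real (holder_order \<alpha>)))}"

locale std_brownian_motion = prob_space P
  for P :: "'w measure" and W :: "real \<Rightarrow> 'w \<Rightarrow> real" +
  assumes measurable_W: "\<And>t. t \<in> {0..1} \<Longrightarrow> W t \<in> borel_measurable P"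
    and start_zero: "AE \<omega> in P. W 0 \<omega> = 0"
    and indep_increments:
      "\<And>(t :: nat \<Rightarrow> real) m. mono_on {..m} t \<Longrightarrow> 0 \<le> t 0 \<Longrightarrow> t m \<le> 1 \<Longrightarrow>
         indep_vars (\<lambda>_. borel) (\<lambda>i \<omega>. W (t (Suc i)) \<omega> - W (t i) \<omega>) {..<m}"
    and normal_increments:
      "\<And>s t. 0 \<le> s \<Longrightarrow> s < t \<Longrightarrow> t \<le> 1 \<Longrightarrow>
         distributed P lborel (\<lambda>\<omega>. W t \<omega> - W s \<omega>) (normal_density 0 (sqrt (t - s)))"
    and continuous_paths: "AE \<omega> in P. continuous_on {0..1} (\<lambda>t. W t \<omega>)"

abbreviation path_space :: "(real \<Rightarrow> real) measure" where
  "path_space \<equiv> PiM {0..1} (\<lambda>_. borel)"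

definition observation ::
  "(real \<Rightarrow> 'w \<Rightarrow> real) \<Rightarrow> nat \<Rightarrow> (real \<Rightarrow> real) \<Rightarrow> 'w \<Rightarrow> real \<Rightarrow> real" where
  "observation W n f \<omega> = (\<lambda>t\<in>{0..1}. (LBINT x:{0..t}. f x) + 1 / sqrt (real n) * W t \<omega>)"

lemma (in std_brownian_motion) measurable_observation:
  "observation W n f \<in> measurable P path_space"
  unfolding observation_def using measurable_W by (intro measurable_restrict) auto

(* An estimator maps an observed path z and a point x to a real number. Joint measurability
   in (z, x) is what makes the integrated risk well defined. *)
definition estimators :: "((real \<Rightarrow> real) \<Rightarrow> real \<Rightarrow> real) set" where
  "estimators = {fh. (\<lambda>(z, x). fh z x) \<in> borel_measurable (path_space \<Otimes>\<^sub>M borel)}"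

definition risk ::
  "'w measure \<Rightarrow> (real \<Rightarrow> 'w \<Rightarrow> real) \<Rightarrow> nat \<Rightarrow> ((real \<Rightarrow> real) \<Rightarrow> real \<Rightarrow> real) \<Rightarrow>
     (real \<Rightarrow> real) \<Rightarrow> real \<Rightarrow> real \<Rightarrow> ennreal" where
  "risk P W n fh f x0 c =
     (if c = 0 then
        \<integral>\<^sup>+ \<omega>. ennreal ((fh (observation W n f \<omega>) x0 - f x0)\<^sup>2) \<partial>P
      else
        ennreal (1 / (2 * c)) *
        (\<integral>\<^sup>+ \<omega>. (\<integral>\<^sup>+ x \<in> {x0 - c .. x0 + c}.
            ennreal ((fh (observation W n f \<omega>) x - f x)\<^sup>2) \<partial>lborel) \<partial>P))"

definition max_risk ::
  "'w measure \<Rightarrow> (real \<Rightarrow> 'w \<Rightarrow> real) \<Rightarrow> nat \<Rightarrow> ((real \<Rightarrow> real) \<Rightarrow> real \<Rightarrow> real) \<Rightarrow>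
     real \<Rightarrow> real \<Rightarrow> real \<Rightarrow> real \<Rightarrow> ennreal" where
  "max_risk P W n fh \<alpha> M x0 c = (SUP f \<in> holder_class \<alpha> M. risk P W n fh f x0 c)"

(* The set Delta(f0) of estimator sequences that are superefficient at f0. *)
definition superefficient ::
  "'w measure \<Rightarrow> (real \<Rightarrow> 'w \<Rightarrow> real) \<Rightarrow> real \<Rightarrow> real \<Rightarrow> (nat \<Rightarrow> real) \<Rightarrow> (nat \<Rightarrow> real) \<Rightarrow>
     (real \<Rightarrow> real) \<Rightarrow> (nat \<Rightarrow> (real \<Rightarrow> real) \<Rightarrow> real \<Rightarrow> real) set" where
  "superefficient P W \<alpha> x0 c B f0 = {fh.
     (\<forall>n. fh n \<in> estimators) \<and>
     limsup (\<lambda>n. ennreal (real n powr (2 * \<alpha> / (1 + 2 * \<alpha>)) * B n) *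
                 risk P W n (fh n) f0 x0 (c n)) < \<infinity>}"

end

theory Submission
  imports Defs
begin

text \<open>
Why superefficiency has a price. Changing the drift from \<open>f0\<close> to \<open>f1\<close> changes the law of
the observation by a likelihood ratio whose second moment is
\<open>exp (n * integral of (f1 - f0)^2)\<close>. By the Cauchy-Schwarz inequality, an event that has
probability \<open>q\<close> under \<open>f0\<close> has probability at most \<open>sqrt (exp (...) * q)\<close> under \<open>f1\<close>
(\<open>law_shift_inequality\<close>). An estimator whose risk at \<open>f0\<close> carries the extra factor \<open>1 / B\<close>
is far from \<open>f0\<close> only on an event of probability of order \<open>1 / B\<close>; as long as the energy
\<open>integral of (f1 - f0)^2\<close> is at most \<open>ln B / (2 n)\<close>, instead of the usual \<open>1 / n\<close>, it
still stays close to \<open>f0\<close> with probability at least one half when \<open>f1\<close> is the truth, and pays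
the squared distance between the two functions (\<open>two_point_lower_bound\<close>). A bump of width
\<open>h\<close> and height of order \<open>h powr \<alpha>\<close> can be added to \<open>f0\<close> inside the larger Hoelder class
(\<open>holder_class_add_bump\<close>) and has energy of order \<open>h powr (2 \<alpha> + 1)\<close>, so the admissible width
is \<open>(ln B / n) powr (1 / (1 + 2 \<alpha>))\<close>. Averaged over the window, its square is of order
\<open>h powr (2 \<alpha>)\<close> if the window is narrower than the bump, and of order \<open>h powr (2 \<alpha> + 1) / c\<close>
if it is wider. These are the two lower bounds.

Why the price is attained. Compute a kernel estimate and compare it, in mean square over the
window, with its own expectation under \<open>f0\<close>. If the discrepancy is below a threshold, report
\<open>f0\<close>; otherwise report the kernel estimate (\<open>two_stage\<close>). At \<open>f0\<close> an error is made only
when a quadratic functional of the Gaussian noise exceeds the threshold, and an exponential moment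
of that functional makes this rare. At any other \<open>f\<close> of the class, accepting \<open>f0\<close> wrongly
costs at most a multiple of threshold, squared bias and squared noise (\<open>two_stage_risk\<close>). For narrow windows the
bandwidth has the order of the width of the bump above, and Jensen's inequality reduces the
exponential moment to that of a single increment (\<open>slope_sq_mean_exp_moment\<close>). For wide windows the bandwidth is
the usual \<open>n powr (- 1 / (1 + 2 \<alpha>))\<close>; the window then consists of about \<open>d\<close> blocks of that
length with independent noise, the exponential moment is exponential in \<open>d\<close>
(\<open>slope_sq_window_exp_moment\<close>), and the threshold is of order \<open>(ln B + d) / (n c)\<close>. The
second regime is the one where \<open>ln B\<close> dominates this sum, the third the one where \<open>d\<close> does.

Two technical points shape the development. Stochastic integrals are avoided: the change of drift
is carried out for events that depend on finitely many times, where it is a shift of a product of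
normal laws, and extended by approximation; the kernels are piecewise constant, so that kernel
estimates are finite combinations of path increments. And evaluating a path at a variable time is
not jointly measurable for the product sigma-algebra; estimators read the path through limits
along dyadic times (\<open>path_eval\<close>), which is the same thing for continuous paths.
\<close>

section \<open>Hoelder classes and the vanishing-moment kernel\<close>

text \<open>
Members of a Hoelder class are unrestricted outside the unit interval. Composing them with this
retraction gives continuous functions on the whole line with the same values on the interval.
\<close>

definition clip01 :: "real \<Rightarrow> real" where "clip01 x = max 0 (min 1 x)"

lemma clip01_in [simp]: "clip01 x \<in> {0..1}" and clip01_id [simp]: "x \<in> {0..1} \<Longrightarrow> clip01 x = x"
  by (auto simp: clip01_def)

lemma continuous_clip01: "continuous_on S clip01"
  unfolding clip01_def by (intro continuous_intros)

text \<open>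
The constant continuation beyond the end points makes the primitive a continuous function on the
line.
\<close>

definition primitive :: "(real \<Rightarrow> real) \<Rightarrow> real \<Rightarrow> real" where
  "primitive f t = (LBINT x:{0..clip01 t}. f x)"

text \<open>
With these weights the difference quotients with steps \<open>h, 2 h, ..., (k + 1) h\<close> combine to a
one-sided kernel of order \<open>k\<close>: up to sign they are the coefficients of the finite difference of
order \<open>k + 1\<close>, which annihilates polynomials of degree at most \<open>k\<close>.
\<close>

definition kernel_weight :: "nat \<Rightarrow> nat \<Rightarrow> real" where
  "kernel_weight k j = (-1) ^ (j+1) * of_nat ((k+1) choose j)"

lemma abs_kernel_weight: "\<bar>kernel_weight k j\<bar> = of_nat ((k+1) choose j)"
  by (simp add: kernel_weight_def abs_mult power_abs)

text \<open>
A kernel estimate of the derivative of \<open>y\<close> at \<open>x\<close> with a piecewise constant kernel. A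
negative bandwidth makes the kernel look to the left of \<open>x\<close>.
\<close>

definition kernel_est :: "nat \<Rightarrow> real \<Rightarrow> (real \<Rightarrow> real) \<Rightarrow> real \<Rightarrow> real" where
  "kernel_est k h y x = (\<Sum>j=1..k+1. kernel_weight k j * ((y (x + real j * h) - y x) / (real j * h)))"

text \<open>
Pascal's rule moves one difference from the binomial coefficients to the power, and a difference
lowers the degree of a polynomial.
\<close>

lemma alternating_binomial_power_sum:
  "i < n \<Longrightarrow> (\<Sum>j\<le>n. (-1) ^ j * of_nat (n choose j) * (real j) ^ i) = 0"
proof (induction n arbitrary: i)
  case (Suc n)
  define D where "D m g = (\<Sum>j\<le>m. (-1) ^ j * of_nat (m choose j) * g j)" for m and g :: "nat \<Rightarrow> real"
  have pascal: "D (Suc n) g = D n (\<lambda>j. g j - g (Suc j))" for g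
  proof -
    have "D (Suc n) g = g 0 + (\<Sum>j\<le>n. (-1) ^ Suc j * of_nat (Suc n choose Suc j) * g (Suc j))"
      unfolding D_def by (subst sum.atMost_Suc_shift) simp
    also have "\<dots> = g 0 + (\<Sum>j\<le>n. (-1) ^ Suc j * of_nat (n choose Suc j) * g (Suc j)) + (\<Sum>j\<le>n. (-1) ^ Suc j * of_nat (n choose j) * g (Suc j))"
      by (simp add: sum.distrib[symmetric] algebra_simps)
    also have "g 0 + (\<Sum>j\<le>n. (-1) ^ Suc j * of_nat (n choose Suc j) * g (Suc j)) = (\<Sum>j\<le>Suc n. (-1) ^ j * of_nat (n choose j) * g j)"
      by (subst sum.atMost_Suc_shift) simp
    also have "\<dots> = D n g" by (simp add: D_def)
    finally show ?thesis by (simp add: D_def right_diff_distrib sum_subtractf sum_negf)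
  qed
  have "real j ^ i - real (Suc j) ^ i = - (\<Sum>l<i. of_nat (i choose l) * real j ^ l)" for j
  proof -
    have "real (Suc j) ^ i = (\<Sum>l\<le>i. of_nat (i choose l) * real j ^ l)"
      using binomial_ring[of "real j" 1 i] by (simp add: add.commute)
    then show ?thesis by (simp add: lessThan_Suc_atMost[symmetric])
  qed
  then have "D n (\<lambda>j. real j ^ i - real (Suc j) ^ i) = - (\<Sum>j\<le>n. \<Sum>l<i. of_nat (i choose l) * ((-1) ^ j * of_nat (n choose j) * real j ^ l))"
    unfolding D_def by (simp add: sum_distrib_left sum_negf ac_simps)
  also have "\<dots> = - (\<Sum>l<i. of_nat (i choose l) * (\<Sum>j\<le>n. (-1) ^ j * of_nat (n choose j) * real j ^ l))"
    by (subst sum.swap) (simp add: sum_distrib_left)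
  also have "\<dots> = 0"
    using Suc by (auto intro!: sum.neutral)
  finally show ?case using pascal[of "\<lambda>j. real j ^ i"] by (simp add: D_def)
qed simp

lemma kernel_weight_moments:
  assumes "i \<le> k"
  shows "(\<Sum>j=1..k+1. kernel_weight k j * real j ^ i) = (if i = 0 then 1 else 0)"
proof -
  have "0 = (\<Sum>j\<le>k+1. (-1) ^ j * of_nat ((k+1) choose j) * (real j) ^ i)"
    using alternating_binomial_power_sum[of i "k+1"] assms by simp
  also have "{..k+1} = insert 0 {1..k+1}" by auto
  also have "(\<Sum>j\<in>insert 0 {1..k+1}. (-1) ^ j * of_nat ((k+1) choose j) * (real j) ^ i)
      = 0 ^ i - (\<Sum>j=1..k+1. (-1) ^ (j+1) * of_nat ((k+1) choose j) * real j ^ i)"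
    by (subst sum.insert) (auto simp: sum_negf)
  finally show ?thesis unfolding kernel_weight_def by (cases i) (simp_all only: power_0 power_Suc mult_zero_left, auto)
qed

text \<open>
Integrating a remainder raises its order by one and does not increase its constant. This one step
gives Taylor's formula and its counterpart for primitives.
\<close>

lemma remainder_bound_from_derivative:
  assumes x: "x \<in> {0..1}" and y: "y \<in> {0..1}"
    and d: "\<And>z. z \<in> {0..1} \<Longrightarrow> (R has_vector_derivative r z) (at z within {0..1})"
    and R0: "R x = (0::real)" and r: "\<And>z. z \<in> {0..1} \<Longrightarrow> \<bar>r z\<bar> \<le> M * \<bar>z - x\<bar> powr g" and g: "g \<ge> 0" and M: "M \<ge> 0"
  shows "\<bar>R y\<bar> \<le> M * \<bar>y - x\<bar> powr (g + 1)"
proof -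
  let ?S = "{min x y..max x y}"
  have sub: "?S \<subseteq> {0..1}" using x y by auto
  have "norm (R y - R x) \<le> (M * \<bar>y - x\<bar> powr g) * norm (y - x)"
  proof (rule field_differentiable_bound)
    fix z assume z: "z \<in> ?S"
    show "(R has_field_derivative r z) (at z within ?S)"
      unfolding has_real_derivative_iff_has_vector_derivative
      by (rule has_vector_derivative_within_subset[OF d sub]) (use z sub in blast)
    have "\<bar>r z\<bar> \<le> M * \<bar>z - x\<bar> powr g" using r z sub by blast
    also have "\<dots> \<le> M * \<bar>y - x\<bar> powr g"
      using z g M by (intro mult_left_mono powr_mono2) auto
    finally show "norm (r z) \<le> M * \<bar>y - x\<bar> powr g" by simp
  qed auto
  then show ?thesis using R0 by (cases "x = y") (auto simp: powr_add)
qed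

lemma nderiv01_Suc_shift: "nderiv01 (Suc j) f = nderiv01 j (nderiv01 1 f)"
  by (induction j) auto

text \<open>
Taylor's formula with the exact constant \<open>M\<close> and unnamed coefficients: expand the derivative,
integrate the expansion term by term, and bound the remainder by the previous lemma.
\<close>

lemma Taylor01:
  assumes "\<And>j x. j < k \<Longrightarrow> x \<in> {0..1} \<Longrightarrow> nderiv01 j f differentiable (at x within {0..1})"
    and "\<And>x y. x \<in> {0..1} \<Longrightarrow> y \<in> {0..1} \<Longrightarrow> \<bar>nderiv01 k f x - nderiv01 k f y\<bar> \<le> M * \<bar>x - y\<bar> powr \<beta>"
    and "\<beta> \<ge> 0" "M \<ge> 0" "x \<in> {0..1}"
  shows "\<exists>a. a 0 = f x \<and> (\<forall>y\<in>{0..1}. \<bar>f y - (\<Sum>i\<le>k. a i * (y - x) ^ i)\<bar> \<le> M * \<bar>y - x\<bar> powr (\<beta> + real k))"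
  using assms(1,2)
proof (induction k arbitrary: f)
  case 0
  then show ?case using assms(5) by (intro exI[of _ "\<lambda>_. f x"]) auto
next
  case (Suc k)
  let ?f' = "nderiv01 1 f"
  have "\<exists>a. a 0 = ?f' x \<and> (\<forall>y\<in>{0..1}. \<bar>?f' y - (\<Sum>i\<le>k. a i * (y - x) ^ i)\<bar> \<le> M * \<bar>y - x\<bar> powr (\<beta> + real k))"
  proof (rule Suc.IH)
    fix j z assume "j < k" "z \<in> {0..(1::real)}"
    then show "nderiv01 j ?f' differentiable at z within {0..1}"
      using Suc.prems(1)[of "Suc j" z] by (simp only: nderiv01_Suc_shift[symmetric])
  next
    fix z y assume "z \<in> {0..(1::real)}" "y \<in> {0..(1::real)}"
    then show "\<bar>nderiv01 k ?f' z - nderiv01 k ?f' y\<bar> \<le> M * \<bar>z - y\<bar> powr \<beta>"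
      using Suc.prems(2)[of z y] by (simp only: nderiv01_Suc_shift[symmetric])
  qed
  then obtain a where a: "\<forall>y\<in>{0..1}. \<bar>?f' y - (\<Sum>i\<le>k. a i * (y - x) ^ i)\<bar> \<le> M * \<bar>y - x\<bar> powr (\<beta> + real k)" by blast
  define b where "b i = (if i = 0 then f x else a (i - 1) / real i)" for i
  define R where "R y = f y - (\<Sum>i\<le>Suc k. b i * (y - x) ^ i)" for y
  have R: "R y = f y - f x - (\<Sum>i\<le>k. a i / real (Suc i) * (y - x) ^ (Suc i))" for y
    unfolding R_def by (subst sum.atMost_Suc_shift) (simp add: b_def)
  have "\<bar>R y\<bar> \<le> M * \<bar>y - x\<bar> powr ((\<beta> + real k) + 1)" if "y \<in> {0..1}" for y
  proof (rule remainder_bound_from_derivative[where R=R and r="\<lambda>y. ?f' y - (\<Sum>i\<le>k. a i * (y - x) ^ i)"])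
    fix z assume z: "z \<in> {0..(1::real)}"
    have "f differentiable (at z within {0..1})" using Suc.prems(1)[of 0 z] z by simp
    then have "(f has_vector_derivative ?f' z) (at z within {0..1})"
      by (simp add: vector_derivative_works)
    then show "(R has_vector_derivative ?f' z - (\<Sum>i\<le>k. a i * (z - x) ^ i)) (at z within {0..1})"
      unfolding R[abs_def] has_real_derivative_iff_has_vector_derivative[symmetric]
      by (auto intro!: derivative_eq_intros sum.cong simp del: of_nat_Suc power_Suc)
  qed (use a that assms R in auto)
  then have "b 0 = f x \<and> (\<forall>y\<in>{0..1}. \<bar>f y - (\<Sum>i\<le>Suc k. b i * (y - x) ^ i)\<bar> \<le> M * \<bar>y - x\<bar> powr (\<beta> + real (Suc k)))"
    by (simp add: R_def b_def[of 0] add.assoc add.commute[of 1] del: sum.atMost_Suc)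
  then show ?case by blast
qed

lemma holder_order_bounds:
  assumes "\<alpha> > 0" shows "real (holder_order \<alpha>) < \<alpha>" "\<alpha> \<le> real (holder_order \<alpha>) + 1"
  unfolding holder_order_eq[OF assms] using assms by linarith+

lemma holder_class_Taylor:
  assumes f: "f \<in> holder_class \<alpha> M" and "\<alpha> > 0" "M \<ge> 0" "x \<in> {0..1}"
  shows "\<exists>a. a 0 = f x \<and> (\<forall>y\<in>{0..1}. \<bar>f y - (\<Sum>i\<le>holder_order \<alpha>. a i * (y - x) ^ i)\<bar> \<le> M * \<bar>y - x\<bar> powr \<alpha>)"
proof -
  let ?k = "holder_order \<alpha>"
  have "\<exists>a. a 0 = f x \<and> (\<forall>y\<in>{0..1}. \<bar>f y - (\<Sum>i\<le>?k. a i * (y - x) ^ i)\<bar> \<le> M * \<bar>y - x\<bar> powr (\<alpha> - ?k + real ?k))"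
  proof (rule Taylor01)
    fix u v :: real assume "u \<in> {0..1}" "v \<in> {0..1}"
    then show "\<bar>nderiv01 ?k f u - nderiv01 ?k f v\<bar> \<le> M * \<bar>u - v\<bar> powr (\<alpha> - ?k)"
      using f by (cases u v rule: linorder_cases) (fastforce simp: holder_class_def abs_minus_commute)+
  qed (use f assms holder_order_bounds in \<open>auto simp: holder_class_def less_imp_le\<close>)
  then show ?thesis by simp
qed

lemma holder_class_continuous:
  assumes f: "f \<in> holder_class \<alpha> M" and a: "\<alpha> > 0" and M: "M \<ge> 0"
  shows "continuous_on {0..1} f"
unfolding continuous_on_sequentially comp_def
proof (intro allI ballI impI, elim conjE)
  fix u :: "nat \<Rightarrow> real" and x :: real assume x: "x \<in> {0..1}" and u: "\<forall>n. u n \<in> {0..1}" and lim: "u \<longlonglongrightarrow> x"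
  obtain c where c: "c 0 = f x" "\<forall>y\<in>{0..1}. \<bar>f y - (\<Sum>i\<le>holder_order \<alpha>. c i * (y - x) ^ i)\<bar> \<le> M * \<bar>y - x\<bar> powr \<alpha>"
    using holder_class_Taylor[OF f a M x] by blast
  have l0: "(\<lambda>n. u n - x) \<longlonglongrightarrow> 0" using lim LIM_zero_iff by blast
  have "(\<lambda>n. \<bar>u n - x\<bar> powr \<alpha>) \<longlonglongrightarrow> 0 powr \<alpha>"
    using a tendsto_rabs_zero[OF l0] by (intro tendsto_powr' tendsto_const) auto
  then have "(\<lambda>n. M * \<bar>u n - x\<bar> powr \<alpha>) \<longlonglongrightarrow> 0" using tendsto_mult_right_zero by simp
  then have 1: "(\<lambda>n. f (u n) - (\<Sum>i\<le>holder_order \<alpha>. c i * (u n - x) ^ i)) \<longlonglongrightarrow> 0"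
    by (rule Lim_null_comparison[OF always_eventually, rotated]) (use c(2) u in \<open>simp only: real_norm_def, blast\<close>)
  have "(\<lambda>n. \<Sum>i\<le>holder_order \<alpha>. c i * (u n - x) ^ i) \<longlonglongrightarrow> (\<Sum>i\<le>holder_order \<alpha>. c i * 0 ^ i)"
    by (intro tendsto_intros l0)
  also have "(\<Sum>i\<le>holder_order \<alpha>. c i * 0 ^ i) = c 0"
    by simp
  finally have "(\<lambda>n. (f (u n) - (\<Sum>i\<le>holder_order \<alpha>. c i * (u n - x) ^ i)) + (\<Sum>i\<le>holder_order \<alpha>. c i * (u n - x) ^ i)) \<longlonglongrightarrow> 0 + c 0"
    by (rule tendsto_add[OF 1])
  then show "(\<lambda>n. f (u n)) \<longlonglongrightarrow> f x" by (simp only: diff_add_cancel add_0_left c(1))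
qed

lemma primitive_has_derivative:
  assumes f: "continuous_on {0..1} f" and x: "x \<in> {0..1}"
  shows "(primitive f has_vector_derivative f x) (at x within {0..1})"
proof -
  have eq: "primitive f t = integral {0..t} f" if "t \<in> {0..1}" for t
  proof -
    have "continuous_on {0..t} f" using f that by (auto intro: continuous_on_subset)
    then show ?thesis
      using that unfolding primitive_def
      by (simp add: set_borel_integral_eq_integral borel_integrable_atLeastAtMost')
  qed
  show ?thesis
    by (rule has_vector_derivative_transform[OF x _ integral_has_vector_derivative[OF f x]]) (simp add: eq)
qed

text \<open>
The expansion of \<open>f\<close> at \<open>x\<close> integrates to an expansion of its primitive with a remainder of
order \<open>\<alpha> + 1\<close>. After division by the step only the constant term survives the vanishing
moments, and the remainder is of order \<open>\<alpha>\<close>.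
\<close>

lemma kernel_est_bias:
  assumes f: "f \<in> holder_class \<alpha> M" and a: "\<alpha> > 0" and M: "M \<ge> 0" and x: "x \<in> {0..1}" and h: "h \<noteq> 0"
    and xh: "x + (real k + 1) * h \<in> {0..1}" and k: "k = holder_order \<alpha>"
  shows "\<bar>kernel_est k h (primitive f) x - f x\<bar> \<le> (\<Sum>j=1..k+1. of_nat ((k+1) choose j) * real j powr \<alpha>) * M * \<bar>h\<bar> powr \<alpha>"
proof -
  obtain c where c: "c 0 = f x" "\<forall>y\<in>{0..1}. \<bar>f y - (\<Sum>i\<le>k. c i * (y - x) ^ i)\<bar> \<le> M * \<bar>y - x\<bar> powr \<alpha>"
    using holder_class_Taylor[OF f a M x] k by blast
  define R where "R y = primitive f y - primitive f x - (\<Sum>i\<le>k. c i / real (Suc i) * (y - x) ^ (Suc i))" for y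
  have R: "\<bar>R y\<bar> \<le> M * \<bar>y - x\<bar> powr (\<alpha> + 1)" if "y \<in> {0..1}" for y
  proof (rule remainder_bound_from_derivative[where R=R and r="\<lambda>y. f y - (\<Sum>i\<le>k. c i * (y - x) ^ i)"])
    fix z assume z: "z \<in> {0..(1::real)}"
    have "(primitive f has_vector_derivative f z) (at z within {0..1})"
      by (intro primitive_has_derivative holder_class_continuous[OF f a M] z)
    then show "(R has_vector_derivative f z - (\<Sum>i\<le>k. c i * (z - x) ^ i)) (at z within {0..1})"
      unfolding R_def[abs_def] has_real_derivative_iff_has_vector_derivative[symmetric]
      by (auto intro!: derivative_eq_intros sum.cong simp del: of_nat_Suc power_Suc)
  qed (use c that assms in \<open>auto simp: R_def\<close>)
  let ?w = "kernel_weight k"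
  let ?t = "\<lambda>j::nat. real j * h"
  have inI: "x + ?t j \<in> {0..1}" if "j \<in> {1..k+1}" for j
  proof (cases "h > 0")
    case True
    then have "?t j \<le> (real k + 1) * h" "0 \<le> ?t j" using that by (auto intro!: mult_right_mono)
    then show ?thesis using x xh by simp
  next
    case False
    then have "?t j \<ge> (real k + 1) * h" "0 \<ge> ?t j" using that by (auto intro!: mult_right_mono_neg simp: mult_nonneg_nonpos)
    then show ?thesis using x xh by simp
  qed
  have "kernel_est k h (primitive f) x = (\<Sum>j=1..k+1. ?w j * ((\<Sum>i\<le>k. c i / real (Suc i) * h ^ i * real j ^ i) + R (x + ?t j) / ?t j))"
    unfolding kernel_est_def
  proof (rule sum.cong[OF refl], rule arg_cong[where f="\<lambda>z. ?w _ * z"])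
    fix j assume j: "j \<in> {1..k+1}"
    have "primitive f (x + ?t j) - primitive f x = (\<Sum>i\<le>k. c i / real (Suc i) * (?t j) ^ (Suc i)) + R (x + ?t j)"
      by (simp add: R_def)
    then have "(primitive f (x + ?t j) - primitive f x) / ?t j = (\<Sum>i\<le>k. c i / real (Suc i) * (?t j) ^ (Suc i)) / ?t j + R (x + ?t j) / ?t j"
      by (simp only: add_divide_distrib)
    also have "(\<Sum>i\<le>k. c i / real (Suc i) * (?t j) ^ (Suc i)) / ?t j = (\<Sum>i\<le>k. c i / real (Suc i) * h ^ i * real j ^ i)"
      unfolding sum_divide_distrib using h j by (intro sum.cong) (auto simp: power_mult_distrib mult.assoc simp del: of_nat_Suc)
    finally show "(primitive f (x + ?t j) - primitive f x) / ?t j = (\<Sum>i\<le>k. c i / real (Suc i) * h ^ i * real j ^ i) + R (x + ?t j) / ?t j" .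
  qed
  also have "\<dots> = (\<Sum>j=1..k+1. \<Sum>i\<le>k. c i / real (Suc i) * h ^ i * (?w j * real j ^ i)) + (\<Sum>j=1..k+1. ?w j * (R (x + ?t j) / ?t j))"
    by (simp only: distrib_left sum.distrib sum_distrib_left mult.assoc mult.left_commute)
  also have "(\<Sum>j=1..k+1. \<Sum>i\<le>k. c i / real (Suc i) * h ^ i * (?w j * real j ^ i)) = (\<Sum>i\<le>k. c i / real (Suc i) * h ^ i * (\<Sum>j=1..k+1. ?w j * real j ^ i))"
    by (subst sum.swap) (simp only: sum_distrib_left)
  also have "\<dots> = (\<Sum>i\<le>k. c i / real (Suc i) * h ^ i * (if i = 0 then 1 else 0))"
    by (intro sum.cong refl) (simp only: kernel_weight_moments atMost_iff)
  also have "\<dots> = f x" using c(1) by (simp add: if_distrib cong: if_cong)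
  finally have "\<bar>kernel_est k h (primitive f) x - f x\<bar> = \<bar>\<Sum>j=1..k+1. ?w j * (R (x + ?t j) / ?t j)\<bar>" by simp
  also have "\<dots> \<le> (\<Sum>j=1..k+1. \<bar>?w j * (R (x + ?t j) / ?t j)\<bar>)" by (rule sum_abs)
  also have "\<dots> \<le> (\<Sum>j=1..k+1. of_nat ((k+1) choose j) * real j powr \<alpha> * M * \<bar>h\<bar> powr \<alpha>)"
  proof (rule sum_mono)
    fix j assume j: "j \<in> {1..k+1}"
    have pos: "\<bar>?t j\<bar> > 0" using j h by simp
    have "\<bar>R (x + ?t j)\<bar> \<le> M * \<bar>?t j\<bar> powr (\<alpha> + 1)" using R[OF inI[OF j]] by simp
    also have "\<dots> = M * \<bar>?t j\<bar> powr \<alpha> * \<bar>?t j\<bar>" using pos by (simp add: powr_add)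
    finally have "\<bar>R (x + ?t j)\<bar> / \<bar>?t j\<bar> \<le> M * \<bar>?t j\<bar> powr \<alpha>" using pos by (simp add: divide_le_eq)
    also have "\<dots> = real j powr \<alpha> * M * \<bar>h\<bar> powr \<alpha>" by (simp add: abs_mult powr_mult)
    finally have "of_nat ((k+1) choose j) * (\<bar>R (x + ?t j)\<bar> / \<bar>?t j\<bar>) \<le> of_nat ((k+1) choose j) * (real j powr \<alpha> * M * \<bar>h\<bar> powr \<alpha>)"
      by (intro mult_left_mono) auto
    then show "\<bar>?w j * (R (x + ?t j) / ?t j)\<bar> \<le> of_nat ((k+1) choose j) * real j powr \<alpha> * M * \<bar>h\<bar> powr \<alpha>"
      by (simp only: abs_mult abs_kernel_weight abs_divide mult.assoc)
  qed
  finally show ?thesis by (simp only: sum_distrib_right)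
qed

section \<open>Shifts of Gaussian product measures and approximation by cylinder sets\<close>

text \<open>
The factor is the second moment of the likelihood ratio of two normal laws whose means differ by
\<open>b\<close>. The square of the shifted density divided by the centred one is again a normal density, with
mean \<open>2 b\<close>, times that factor.
\<close>

lemma normal_shift_Cauchy_Schwarz:
  fixes \<phi> :: "real \<Rightarrow> ennreal"
  assumes [measurable]: "\<phi> \<in> borel_measurable borel" and s: "\<sigma> > 0"
  defines "\<gamma> \<equiv> density lborel (\<lambda>x. ennreal (normal_density 0 \<sigma> x))"
  shows "(\<integral>\<^sup>+x. \<phi> (x + b) \<partial>\<gamma>)\<^sup>2 \<le> ennreal (exp (b\<^sup>2 / \<sigma>\<^sup>2)) * (\<integral>\<^sup>+x. (\<phi> x)\<^sup>2 \<partial>\<gamma>)"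
proof -
  define L where "L x = exp ((2 * x * b - b\<^sup>2) / (2 * \<sigma>\<^sup>2))" for x :: real
  have [measurable]: "L \<in> borel_measurable borel"
    unfolding L_def by measurable
  have L0: "L x \<ge> 0" for x by (simp add: L_def)
  have L1: "normal_density 0 \<sigma> x * L x = normal_density 0 \<sigma> (x - b)" for x
    using s by (simp add: normal_density_def L_def mult_exp_exp add_divide_distrib[symmetric] power2_eq_square algebra_simps)
  have "exp (-(x\<^sup>2 / (2*\<sigma>\<^sup>2))) * exp ((2 * x * b - b\<^sup>2) / (2 * \<sigma>\<^sup>2)) ^ 2 = exp (b\<^sup>2/\<sigma>\<^sup>2) * exp (-((x - 2*b)\<^sup>2 / (2*\<sigma>\<^sup>2)))" for x
  proof -
    have "-(x\<^sup>2 / (2*\<sigma>\<^sup>2)) + 2 * ((2 * x * b - b\<^sup>2) / (2 * \<sigma>\<^sup>2)) = b\<^sup>2/\<sigma>\<^sup>2 + -((x - 2*b)\<^sup>2 / (2*\<sigma>\<^sup>2))"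
      using s by (simp add: field_simps) (simp add: power2_eq_square algebra_simps)
    then show ?thesis by (simp add: mult_exp_exp exp_of_nat_mult[symmetric] exp_double[symmetric])
  qed
  note e = this
  have L2: "normal_density 0 \<sigma> x * (L x)\<^sup>2 = exp (b\<^sup>2 / \<sigma>\<^sup>2) * normal_density (2*b) \<sigma> x" for x
  proof -
    let ?c = "1 / sqrt (2 * pi * \<sigma>\<^sup>2)"
    have "normal_density 0 \<sigma> x * (L x)\<^sup>2 = ?c * (exp (-(x\<^sup>2 / (2*\<sigma>\<^sup>2))) * exp ((2 * x * b - b\<^sup>2) / (2 * \<sigma>\<^sup>2)) ^ 2)"
      by (simp add: normal_density_def L_def)
    also have "\<dots> = ?c * (exp (b\<^sup>2/\<sigma>\<^sup>2) * exp (-((x - 2*b)\<^sup>2 / (2*\<sigma>\<^sup>2))))"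
      by (simp only: e)
    also have "\<dots> = exp (b\<^sup>2 / \<sigma>\<^sup>2) * normal_density (2*b) \<sigma> x"
      by (simp add: normal_density_def)
    finally show ?thesis .
  qed
  have "(\<integral>\<^sup>+x. \<phi> (x + b) \<partial>\<gamma>) = (\<integral>\<^sup>+x. ennreal (normal_density 0 \<sigma> x) * \<phi> (x + b) \<partial>lborel)"
    unfolding \<gamma>_def by (subst nn_integral_density) auto
  also have "\<dots> = (\<integral>\<^sup>+x. ennreal (normal_density 0 \<sigma> (x - b)) * \<phi> x \<partial>lborel)"
    by (subst (2) nn_integral_real_affine[where c=1 and t=b]) (auto simp: add.commute)
  also have "\<dots> = (\<integral>\<^sup>+x. \<phi> x * ennreal (L x) \<partial>\<gamma>)"
    unfolding \<gamma>_def
    by (subst nn_integral_density)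
       (auto intro!: nn_integral_cong simp: L1[symmetric] ennreal_mult L_def ac_simps)
  finally have "(\<integral>\<^sup>+x. \<phi> (x + b) \<partial>\<gamma>)\<^sup>2 \<le> (\<integral>\<^sup>+x. (\<phi> x)\<^sup>2 \<partial>\<gamma>) * (\<integral>\<^sup>+x. (ennreal (L x))\<^sup>2 \<partial>\<gamma>)"
    using Cauchy_Schwarz_nn_integral[of \<phi> \<gamma> "\<lambda>x. ennreal (L x)"] by (simp add: \<gamma>_def)
  also have "(\<integral>\<^sup>+x. (ennreal (L x))\<^sup>2 \<partial>\<gamma>) = (\<integral>\<^sup>+x. ennreal (exp (b\<^sup>2 / \<sigma>\<^sup>2)) * ennreal (normal_density (2*b) \<sigma> x) \<partial>lborel)"
    unfolding \<gamma>_def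
    by (subst nn_integral_density)
       (auto intro!: nn_integral_cong simp: L2 L0 ennreal_power ennreal_mult[symmetric])
  also have "\<dots> = ennreal (exp (b\<^sup>2 / \<sigma>\<^sup>2))"
    using s prob_space.emeasure_space_1[OF prob_space_normal_density[OF s, of "2*b"]]
    by (simp add: nn_integral_cmult emeasure_density)
  finally show ?thesis by (simp add: mult.commute)
qed

text \<open>
The one-dimensional inequality tensorises: apply it to one coordinate inside the integral over the
others, and the factors multiply.
\<close>

lemma PiM_normal_shift_Cauchy_Schwarz:
  fixes s b :: "'i \<Rightarrow> real" and \<phi> :: "('i \<Rightarrow> real) \<Rightarrow> ennreal"
  assumes "finite I" and s: "\<And>i. s i > 0"
    and "\<phi> \<in> borel_measurable (PiM I (\<lambda>_. borel))"
  defines "\<gamma> \<equiv> (\<lambda>i. density lborel (\<lambda>x. ennreal (normal_density 0 (s i) x)))"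
  shows "(\<integral>\<^sup>+x. \<phi> (\<lambda>i\<in>I. x i + b i) \<partial>PiM I \<gamma>)\<^sup>2
           \<le> ennreal (exp (\<Sum>i\<in>I. (b i)\<^sup>2 / (s i)\<^sup>2)) * (\<integral>\<^sup>+x. (\<phi> x)\<^sup>2 \<partial>PiM I \<gamma>)"
  using assms(1,3)
proof (induction I arbitrary: \<phi> rule: finite_induct)
  case empty
  have "PiM {} \<gamma> = count_space {\<lambda>_. undefined}" by (simp add: PiM_empty)
  then show ?case by (simp add: nn_integral_count_space_finite restrict_def)
next
  case (insert i I)
  have pg: "prob_space (\<gamma> i)" for i unfolding \<gamma>_def by (rule prob_space_normal_density[OF s])
  then have sg: "sigma_finite_measure (\<gamma> i)" for i
    using prob_space_imp_sigma_finite by blast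
  interpret product_sigma_finite \<gamma> by (rule product_sigma_finite.intro) (rule sg)
  interpret gi: sigma_finite_measure "\<gamma> i" by (rule sg)
  have sets: "sets (PiM J \<gamma>) = sets (PiM J (\<lambda>_. borel))" for J
    by (intro sets_PiM_cong) (auto simp: \<gamma>_def)
  have [measurable_cong]: "sets (\<gamma> i) = sets borel" for i by (simp add: \<gamma>_def)
  note insert.prems[measurable]
  have phi: "\<phi> \<in> borel_measurable (PiM (insert i I) \<gamma>)"
    using insert.prems measurable_cong_sets[OF sets refl] by blast
  note phi[measurable]
  have sh[measurable]: "(\<lambda>x. \<lambda>j\<in>J. x j + b j) \<in> measurable (PiM J \<gamma>) (PiM J \<gamma>)" for J
    by (rule measurable_restrict) (auto simp: \<gamma>_def intro!: borel_measurable_add)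
  define H where "H x = (\<integral>\<^sup>+y. \<phi> (x(i := y + b i)) \<partial>\<gamma> i)" for x
  have m1: "(\<lambda>(x, y). \<phi> (x(i := y + b i))) \<in> borel_measurable (PiM I \<gamma> \<Otimes>\<^sub>M \<gamma> i)"
    by measurable
  have H: "H \<in> borel_measurable (PiM I (\<lambda>_. borel))"
    unfolding H_def using sigma_finite_measure.borel_measurable_nn_integral[OF sg m1] measurable_cong_sets[OF sets refl, of I] by auto
  have "(\<integral>\<^sup>+x. \<phi> (\<lambda>j\<in>insert i I. x j + b j) \<partial>PiM (insert i I) \<gamma>)
        = (\<integral>\<^sup>+x. \<integral>\<^sup>+y. \<phi> (\<lambda>j\<in>insert i I. (x(i := y)) j + b j) \<partial>\<gamma> i \<partial>PiM I \<gamma>)"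
    by (rule product_nn_integral_insert) (use insert in \<open>auto\<close>)
  also have "\<dots> = (\<integral>\<^sup>+x. H (\<lambda>j\<in>I. x j + b j) \<partial>PiM I \<gamma>)"
    unfolding H_def using insert
    by (intro nn_integral_cong arg_cong[where f=\<phi>]) (auto simp: fun_eq_iff)
  finally have "(\<integral>\<^sup>+x. \<phi> (\<lambda>j\<in>insert i I. x j + b j) \<partial>PiM (insert i I) \<gamma>)\<^sup>2
      \<le> ennreal (exp (\<Sum>i\<in>I. (b i)\<^sup>2 / (s i)\<^sup>2)) * (\<integral>\<^sup>+x. (H x)\<^sup>2 \<partial>PiM I \<gamma>)"
    using insert.IH[OF H] by (simp only:)
  note le1 = this
  have "(\<integral>\<^sup>+x. (H x)\<^sup>2 \<partial>PiM I \<gamma>) \<le> (\<integral>\<^sup>+x. ennreal (exp ((b i)\<^sup>2 / (s i)\<^sup>2)) * (\<integral>\<^sup>+y. (\<phi> (x(i := y)))\<^sup>2 \<partial>\<gamma> i) \<partial>PiM I \<gamma>)"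
  proof (rule nn_integral_mono)
    fix x assume x: "x \<in> space (PiM I \<gamma>)"
    have "(\<lambda>y. \<phi> (x(i := y))) \<in> borel_measurable (\<gamma> i)"
      using x insert by measurable
    then have "(\<lambda>y. \<phi> (x(i := y))) \<in> borel_measurable borel" by (simp add: \<gamma>_def)
    from normal_shift_Cauchy_Schwarz[OF this s[of i], of "b i"]
    show "(H x)\<^sup>2 \<le> ennreal (exp ((b i)\<^sup>2 / (s i)\<^sup>2)) * (\<integral>\<^sup>+y. (\<phi> (x(i := y)))\<^sup>2 \<partial>\<gamma> i)"
      by (simp add: H_def \<gamma>_def)
  qed
  also have "\<dots> = ennreal (exp ((b i)\<^sup>2 / (s i)\<^sup>2)) * (\<integral>\<^sup>+x. (\<phi> x)\<^sup>2 \<partial>PiM (insert i I) \<gamma>)"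
    using insert by (subst product_nn_integral_insert) (auto intro!: nn_integral_cmult)
  finally have le2: "(\<integral>\<^sup>+x. (H x)\<^sup>2 \<partial>PiM I \<gamma>) \<le> ennreal (exp ((b i)\<^sup>2 / (s i)\<^sup>2)) * (\<integral>\<^sup>+x. (\<phi> x)\<^sup>2 \<partial>PiM (insert i I) \<gamma>)" .
  show ?case
    using order.trans[OF le1 mult_left_mono[OF le2 zero_le]]
    unfolding sum.insert[OF insert(1,2)] exp_add ennreal_mult[OF exp_ge_zero exp_ge_zero]
    by (simp only: mult.assoc mult.left_commute)
qed

text \<open>
The sets that can be approximated in measure by members of an algebra form a sigma-algebra.
\<close>

lemma approximate_by_algebra:
  assumes alg: "algebra (space M) G" and gen: "sets M = sigma_sets (space M) G"
    and fin: "finite_measure M" and A: "A \<in> sets M" and e: "e > 0"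
  shows "\<exists>C\<in>G. measure M (A - C) + measure M (C - A) < e"
proof -
  interpret finite_measure M by fact
  interpret G: algebra "space M" G by fact
  have Gs: "C \<in> G \<Longrightarrow> C \<in> sets M" for C using gen by auto
  have "A \<in> sigma_sets (space M) G" using A gen by simp
  then have "A \<in> sets M \<and> (\<forall>e>0. \<exists>C\<in>G. measure M (A - C) + measure M (C - A) < e)"
  proof induction
    case (Basic a) then show ?case using Gs by (auto intro!: bexI[of _ a])
  next
    case Empty show ?case by (auto intro!: bexI[of _ "{}"])
  next
    case (Compl a)
    show ?case
    proof (intro conjI allI impI)
      fix e :: real assume "e > 0"
      then obtain C where C: "C \<in> G" "measure M (a - C) + measure M (C - a) < e" using Compl by blast
      have "(space M - a) - (space M - C) = C - a" "(space M - C) - (space M - a) = a - C"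
        using C(1) Gs[THEN sets.sets_into_space] Compl.IH[THEN conjunct1, THEN sets.sets_into_space] by auto
      then show "\<exists>C\<in>G. measure M (space M - a - C) + measure M (C - (space M - a)) < e"
        using C by (intro bexI[of _ "space M - C"]) auto
    qed (use Compl in auto)
  next
    case (Union a)
    then have as[measurable]: "\<And>i. a i \<in> sets M" by auto
    show ?case
    proof (intro conjI allI impI)
      show "\<Union> (range a) \<in> sets M" by measurable
      fix e :: real assume e: "e > 0"
      have "(\<lambda>n. measure M (\<Union>i<n. a i)) \<longlonglongrightarrow> measure M (\<Union>n. \<Union>i<n. a i)"
        by (rule finite_Lim_measure_incseq) (auto simp: incseq_def intro: order.strict_trans2)
      moreover have "(\<Union>n. \<Union>i<n. a i) = \<Union> (range a)" by auto
      ultimately have "eventually (\<lambda>n. measure M (\<Union> (range a)) - e/2 < measure M (\<Union>i<n. a i)) sequentially"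
        using e by (intro order_tendstoD(1)) auto
      then obtain n where n: "measure M (\<Union> (range a)) - e/2 < measure M (\<Union>i<n. a i)"
        by (auto simp: eventually_sequentially)
      have "\<forall>i. \<exists>C\<in>G. measure M (a i - C) + measure M (C - a i) < e / (2 * (n + 1))"
        using Union e by simp
      then obtain C where C: "\<And>i. C i \<in> G" "\<And>i. measure M (a i - C i) + measure M (C i - a i) < e / (2 * (n + 1))"
        by metis
      note [measurable] = Gs[OF C(1)]
      have sub: "measure M (\<Union>i<n. f i) \<le> (\<Sum>i<n. measure M (f i))" if "\<And>i. f i \<in> sets M" for f :: "nat \<Rightarrow> _"
        using that by (intro finite_measure_subadditive_finite) auto
      have "measure M (\<Union> (range a) - (\<Union>i<n. C i)) \<le> measure M ((\<Union> (range a) - (\<Union>i<n. a i)) \<union> (\<Union>i<n. a i - C i))"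
        by (rule finite_measure_mono) auto
      also have "\<dots> \<le> measure M (\<Union> (range a) - (\<Union>i<n. a i)) + measure M (\<Union>i<n. a i - C i)"
        by (rule measure_subadditive) (auto simp: fmeasurable_def less_top[symmetric])
      also have "\<dots> \<le> measure M (\<Union> (range a) - (\<Union>i<n. a i)) + (\<Sum>i<n. measure M (a i - C i))"
        using sub[of "\<lambda>i. a i - C i"] by simp
      also have "measure M (\<Union> (range a) - (\<Union>i<n. a i)) = measure M (\<Union> (range a)) - measure M (\<Union>i<n. a i)"
        by (rule finite_measure_Diff) auto
      finally have 1: "measure M (\<Union> (range a) - (\<Union>i<n. C i)) < e/2 + (\<Sum>i<n. measure M (a i - C i))"
        using n by simp
      have "measure M ((\<Union>i<n. C i) - \<Union> (range a)) \<le> measure M (\<Union>i<n. C i - a i)"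
        by (rule finite_measure_mono) auto
      also have "\<dots> \<le> (\<Sum>i<n. measure M (C i - a i))" by (rule sub) auto
      finally have 2: "measure M ((\<Union>i<n. C i) - \<Union> (range a)) \<le> (\<Sum>i<n. measure M (C i - a i))" .
      have "(\<Sum>i<n. measure M (a i - C i)) + (\<Sum>i<n. measure M (C i - a i)) \<le> (\<Sum>i<n. e / (2 * (n + 1)))"
        unfolding sum.distrib[symmetric] using C(2) by (intro sum_mono less_imp_le) 
      also have "\<dots> \<le> e/2" using e by (simp add: field_simps)
      finally have "measure M (\<Union> (range a) - (\<Union>i<n. C i)) + measure M ((\<Union>i<n. C i) - \<Union> (range a)) < e"
        using 1 2 by linarith
      moreover have "(\<Union>i<n. C i) \<in> G" using C by auto
      ultimately show "\<exists>C\<in>G. measure M (\<Union> (range a) - C) + measure M (C - \<Union> (range a)) < e" by blast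
    qed
  qed
  then show ?thesis using e by blast
qed

text \<open>
Every projective family has the cylinder sets as a generating algebra; a family of point masses is
chosen here because it exists on every index set.
\<close>

lemma algebra_cylinder_sets:
  fixes I :: "'i set"
  defines "G \<equiv> {prod_emb I (\<lambda>_. borel :: real measure) J X | J X. finite J \<and> J \<subseteq> I \<and> X \<in> sets (PiM J (\<lambda>_. borel))}"
  shows "algebra (space (PiM I (\<lambda>_. borel :: real measure))) G"
    and "sets (PiM I (\<lambda>_. borel)) = sigma_sets (space (PiM I (\<lambda>_. borel :: real measure))) G"
proof -
  interpret projective_family I "\<lambda>J. return (PiM J (\<lambda>_. borel :: real measure)) (\<lambda>_\<in>J. 0)" "\<lambda>_. borel"
  proof (rule projective_family.intro)
    fix J H :: "'i set" assume JH: "J \<subseteq> H" "finite H" "H \<subseteq> I"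
    then have "(\<lambda>f. restrict f J) \<in> measurable (PiM H (\<lambda>_. borel :: real measure)) (PiM J (\<lambda>_. borel))"
      by (intro measurable_restrict_subset)
    then show "return (PiM J (\<lambda>_. borel :: real measure)) (\<lambda>_\<in>J. 0) =
       distr (return (PiM H (\<lambda>_. borel)) (\<lambda>_\<in>H. 0)) (PiM J (\<lambda>_. borel)) (\<lambda>f. restrict f J)"
      using JH by (subst distr_return) (auto simp: space_PiM Int_absorb1 PiE_iff extensional_def fun_eq_iff restrict_def intro!: arg_cong[where f="return _"])
  next
    fix J :: "'i set"
    show "prob_space (return (PiM J (\<lambda>_. borel :: real measure)) (\<lambda>_\<in>J. 0))"
      by (rule prob_space_return) (auto simp: space_PiM)
  qed
  have "generator = G"
    unfolding G_def by (subst set_eq_iff) (simp only: generator.simps mem_Collect_eq, blast)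
  then show "algebra (space (PiM I (\<lambda>_. borel :: real measure))) G"
    and "sets (PiM I (\<lambda>_. borel)) = sigma_sets (space (PiM I (\<lambda>_. borel :: real measure))) G"
    using algebra_generator sets_PiM_generator by auto
qed

section \<open>Change of drift in the observation model\<close>

lemma observation_eq: "t \<in> {0..1} \<Longrightarrow> observation W n f \<omega> t = primitive f t + W t \<omega> / sqrt (real n)"
  by (simp add: observation_def primitive_def)

lemma primitive_0: "primitive f 0 = 0"
proof -
  have "(LBINT x:{0..0}. f x) = (\<integral>x. f 0 * indicator {0::real} x \<partial>lborel)"
    unfolding set_lebesgue_integral_def by (rule arg_cong[where f="integral\<^sup>L lborel"]) (auto simp: indicator_def fun_eq_iff)
  also have "\<dots> = 0" by simp
  finally show ?thesis by (simp add: primitive_def)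
qed

lemma primitive_increment:
  assumes f: "continuous_on {0..1} f" and st: "0 \<le> s" "s \<le> t" "t \<le> 1"
  shows "primitive f t - primitive f s = integral {s..t} f"
proof -
  have "(f has_integral primitive f t - primitive f s) {s..t}"
  proof (rule fundamental_theorem_of_calculus[OF st(2)])
    fix x assume "x \<in> {s..t}"
    then show "(primitive f has_vector_derivative f x) (at x within {s..t})"
      using st by (intro has_vector_derivative_within_subset[OF primitive_has_derivative[OF f]]) auto
  qed
  then show ?thesis by (simp add: integral_unique)
qed

text \<open>
The integral of the squared deviation of \<open>g\<close> from its mean is nonnegative.
\<close>

lemma square_integral_le:
  fixes g :: "real \<Rightarrow> real"
  assumes g: "continuous_on {s..t} g" and st: "s < t"
  shows "(integral {s..t} g)\<^sup>2 / (t - s) \<le> integral {s..t} (\<lambda>x. (g x)\<^sup>2)"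
proof -
  define c where "c = integral {s..t} g / (t - s)"
  have i: "g integrable_on {s..t}" "(\<lambda>x. (g x)\<^sup>2) integrable_on {s..t}"
    by (intro integrable_continuous_interval continuous_intros g)+
  have "0 \<le> integral {s..t} (\<lambda>x. (g x - c)\<^sup>2)"
    by (intro integral_nonneg integrable_continuous_interval continuous_intros g) auto
  also have "(\<lambda>x. (g x - c)\<^sup>2) = (\<lambda>x. ((g x)\<^sup>2 - 2 * c * g x) + c\<^sup>2)"
    by (auto simp: power2_eq_square algebra_simps)
  also have "integral {s..t} \<dots> = integral {s..t} (\<lambda>x. (g x)\<^sup>2) - 2 * c * integral {s..t} g + c\<^sup>2 * (t - s)"
    using has_integral_const_real[of "c\<^sup>2" s t] st
    by (intro integral_unique has_integral_add has_integral_diff has_integral_mult_right integrable_integral i)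
       (simp add: mult.commute)
  also have "2 * c * integral {s..t} g = 2 * ((integral {s..t} g)\<^sup>2 / (t - s))" by (simp add: c_def power2_eq_square)
  also have "c\<^sup>2 * (t - s) = (integral {s..t} g)\<^sup>2 / (t - s)" using st by (simp add: c_def power2_eq_square)
  finally show ?thesis by simp
qed

lemma stepwise_increasing_le:
  fixes t :: "nat \<Rightarrow> real"
  assumes t: "\<And>l. l < m \<Longrightarrow> t l < t (Suc l)" and ab: "a \<le> b" "b \<le> m"
  shows "t a \<le> t b"
  using ab
proof (induction b rule: dec_induct)
  case (step k)
  then show ?case using t[of k] by auto
qed simp

text \<open>
The energy seen by the observations at finitely many times is at most the energy of the drift.
\<close>

lemma sum_increments_le_energy:
  fixes g :: "real \<Rightarrow> real" and t :: "nat \<Rightarrow> real"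
  assumes g: "continuous_on {0..1} g" and t: "\<And>l. l < m \<Longrightarrow> t l < t (Suc l)" "t 0 = 0" "t m \<le> 1"
  shows "(\<Sum>l<m. (integral {t l..t (Suc l)} g)\<^sup>2 / (t (Suc l) - t l)) \<le> integral {0..t m} (\<lambda>x. (g x)\<^sup>2)"
  using t
proof (induction m)
  case (Suc m)
  have tm: "0 \<le> t m" using stepwise_increasing_le[of "Suc m" t 0 m] Suc.prems by auto
  have lt: "t m < t (Suc m)" using Suc.prems by auto
  have c: "continuous_on {t m..t (Suc m)} g" "continuous_on {0..t (Suc m)} g"
    by (rule continuous_on_subset[OF g]; use tm lt Suc.prems in auto)+
  have "integral {0..t m} (\<lambda>x. (g x)\<^sup>2) + integral {t m..t (Suc m)} (\<lambda>x. (g x)\<^sup>2) = integral {0..t (Suc m)} (\<lambda>x. (g x)\<^sup>2)"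
    using tm lt by (intro Henstock_Kurzweil_Integration.integral_combine integrable_continuous_interval continuous_intros c) auto
  moreover have "(\<Sum>l<m. (integral {t l..t (Suc l)} g)\<^sup>2 / (t (Suc l) - t l)) \<le> integral {0..t m} (\<lambda>x. (g x)\<^sup>2)"
    using Suc lt by auto
  ultimately show ?case using square_integral_le[OF c(1) lt] by simp
qed simp

context std_brownian_motion begin

lemma distr_increments:
  assumes t: "\<And>l. l < m \<Longrightarrow> t l < t (Suc l)" "0 \<le> t 0" "t m \<le> 1" and m: "m > 0"
  shows "distr P (PiM {..<m} (\<lambda>_. borel)) (\<lambda>\<omega>. \<lambda>l\<in>{..<m}. W (t (Suc l)) \<omega> - W (t l) \<omega>)
    = PiM {..<m} (\<lambda>l. density lborel (\<lambda>x. ennreal (normal_density 0 (if l < m then sqrt (t (Suc l) - t l) else 1) x)))"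
proof -
  have mono: "mono_on {..m} t"
    by (rule mono_onI) (rule stepwise_increasing_le[where m=m], use t(1) in auto)
  then have rng: "l \<le> m \<Longrightarrow> t l \<in> {0..1}" for l
    using t mono_onD[OF mono, of 0 l] mono_onD[OF mono, of l m] by auto
  have rv: "l < m \<Longrightarrow> random_variable borel (\<lambda>\<omega>. W (t (Suc l)) \<omega> - W (t l) \<omega>)" for l
    using measurable_W rng by (intro borel_measurable_diff) auto
  have "distr P (PiM {..<m} (\<lambda>_. borel)) (\<lambda>\<omega>. \<lambda>l\<in>{..<m}. W (t (Suc l)) \<omega> - W (t l) \<omega>)
     = PiM {..<m} (\<lambda>l. distr P borel (\<lambda>\<omega>. W (t (Suc l)) \<omega> - W (t l) \<omega>))"
    using indep_vars_iff_distr_eq_PiM'[where I="{..<m}" and M'="\<lambda>_. borel" and X="\<lambda>l \<omega>. W (t (Suc l)) \<omega> - W (t l) \<omega>"]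
      indep_increments[OF mono t(2,3)] rv m by auto
  also have "\<dots> = PiM {..<m} (\<lambda>l. density lborel (\<lambda>x. ennreal (normal_density 0 (if l < m then sqrt (t (Suc l) - t l) else 1) x)))"
  proof (rule PiM_cong[OF refl])
    fix l assume l: "l \<in> {..<m}"
    have "distributed P lborel (\<lambda>\<omega>. W (t (Suc l)) \<omega> - W (t l) \<omega>) (normal_density 0 (sqrt (t (Suc l) - t l)))"
      using l t rng[of l] rng[of "Suc l"] by (intro normal_increments) auto
    from distributed_distr_eq_density[OF this] l
    show "distr P borel (\<lambda>\<omega>. W (t (Suc l)) \<omega> - W (t l) \<omega>) = density lborel (\<lambda>x. ennreal (normal_density 0 (if l < m then sqrt (t (Suc l) - t l) else 1) x))"
      by (simp cong: distr_cong)
  qed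
  finally show ?thesis .
qed

text \<open>
An event that depends on the path at finitely many times is an event about the independent
increments between these times, and a change of drift shifts their means.
\<close>

lemma cylinder_shift_inequality:
  fixes f0 f1 :: "real \<Rightarrow> real"
  assumes c0: "continuous_on {0..1} f0" and c1: "continuous_on {0..1} f1" and n: "n > 0"
    and J: "finite J" "J \<subseteq> {0..1}" and X[measurable]: "X \<in> sets (PiM J (\<lambda>_. borel))"
  defines "A \<equiv> prod_emb {0..1} (\<lambda>_. borel) J X"
  shows "(emeasure (distr P path_space (observation W n f1)) A)\<^sup>2
    \<le> ennreal (exp (real n * integral {0..1} (\<lambda>x. (f1 x - f0 x)\<^sup>2))) * emeasure (distr P path_space (observation W n f0)) A"
proof -
  let ?g = "\<lambda>x. f1 x - f0 x"
  have cg: "continuous_on {0..1} ?g" by (intro continuous_intros c0 c1)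
  define ts where "ts = sorted_list_of_set (insert 0 (insert 1 J))"
  define m where "m = length ts - 1"
  define t where "t l = ts ! l" for l
  have fin: "finite (insert 0 (insert 1 J))" using J by simp
  have ts: "set ts = insert 0 (insert 1 J)" "sorted_wrt (<) ts"
    unfolding ts_def by (rule set_sorted_list_of_set[OF fin] strict_sorted_list_of_set)+
  have len: "length ts = Suc m"
    using ts(1) by (cases ts) (auto simp: m_def)
  have tl: "t l < t (Suc l)" if "l < m" for l
    using that ts(2) len by (auto simp: t_def sorted_wrt_iff_nth_less)
  have rng: "t l \<in> {0..1}" if "l \<le> m" for l
    using nth_mem[of l ts] that len ts(1) J by (auto simp: t_def)
  have inset: "\<exists>l\<le>m. t l = s" if "s \<in> insert 0 (insert 1 J)" for s
    using that ts(1) len by (metis in_set_conv_nth less_Suc_eq_le t_def)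
  have mono: "t a \<le> t b" if "a \<le> b" "b \<le> m" for a b
    using that ts(2) len by (cases "a = b") (auto simp: t_def sorted_wrt_iff_nth_less intro!: less_imp_le)
  have t0: "t 0 = 0" using inset[of 0] rng[of 0] mono[of 0] by force
  have tm: "t m = 1" using inset[of 1] rng[of m] mono[of _ m] by force
  have m: "m > 0" using t0 tm by (cases m) auto
  \<comment> \<open>every time of interest is a partial sum of increments because the path starts at 0 almost surely\<close>
  define idx where "idx s = (SOME l. l \<le> m \<and> t l = s)" for s
  have idx: "idx s \<le> m" "t (idx s) = s" if "s \<in> J" for s
    using someI_ex[of "\<lambda>l. l \<le> m \<and> t l = s"] inset[of s] that by (auto simp: idx_def)
  define \<gamma> where "\<gamma> = (\<lambda>l. density lborel (\<lambda>x. ennreal (normal_density 0 (if l < m then sqrt (t (Suc l) - t l) else 1) x)))"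
  define \<Phi> where "\<Phi> f x = (\<lambda>s\<in>J. primitive f s + (\<Sum>l<idx s. x l) / sqrt n)" for f and x :: "nat \<Rightarrow> real"
  define D where "D \<omega> = (\<lambda>l\<in>{..<m}. W (t (Suc l)) \<omega> - W (t l) \<omega>)" for \<omega>
  define b where "b l = sqrt n * integral {t l..t (Suc l)} ?g" for l
  have \<Phi>m[measurable]: "\<Phi> f \<in> measurable (PiM {..<m} (\<lambda>_. borel)) (PiM J (\<lambda>_. borel))" for f
    unfolding \<Phi>_def using idx(1)
    by (intro measurable_restrict borel_measurable_add borel_measurable_divide borel_measurable_sum borel_measurable_const measurable_component_singleton) force+
  have Dm[measurable]: "D \<in> measurable P (PiM {..<m} (\<lambda>_. borel))"
    unfolding D_def using rng measurable_W by (intro measurable_restrict borel_measurable_diff) auto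
  have distrD: "distr P (PiM {..<m} (\<lambda>_. borel)) D = PiM {..<m} \<gamma>"
    unfolding D_def \<gamma>_def using t0 tm m tl by (intro distr_increments) auto
  have AE_obs: "AE \<omega> in P. observation W n f \<omega> \<in> A \<longleftrightarrow> \<Phi> f (D \<omega>) \<in> X" for f
    using start_zero
  proof eventually_elim
    fix \<omega> assume W0: "W 0 \<omega> = 0"
    have "restrict (observation W n f \<omega>) J = \<Phi> f (D \<omega>)"
    proof (rule ext)
      fix s show "restrict (observation W n f \<omega>) J s = \<Phi> f (D \<omega>) s"
      proof (cases "s \<in> J")
        case True
        have "(\<Sum>l<idx s. D \<omega> l) = (\<Sum>l<idx s. W (t (Suc l)) \<omega> - W (t l) \<omega>)"
          using idx(1)[OF True] by (intro sum.cong) (auto simp: D_def)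
        also have "\<dots> = W (t (idx s)) \<omega> - W (t 0) \<omega>" by (rule sum_lessThan_telescope)
        finally have "(\<Sum>l<idx s. D \<omega> l) = W s \<omega>" using idx[OF True] t0 W0 by simp
        then show ?thesis using True J by (auto simp: \<Phi>_def observation_eq subset_iff)
      qed (simp add: \<Phi>_def)
    qed
    then show "observation W n f \<omega> \<in> A \<longleftrightarrow> \<Phi> f (D \<omega>) \<in> X"
      unfolding A_def prod_emb_def by (auto simp: observation_def)
  qed
  have Am[measurable]: "A \<in> sets path_space"
    unfolding A_def using J by (intro measurable_prod_emb) auto
  have em: "emeasure (distr P path_space (observation W n f)) A = (\<integral>\<^sup>+x. indicator X (\<Phi> f x) \<partial>PiM {..<m} \<gamma>)" for f
  proof -
    note measurable_observation[measurable]
    have "emeasure (distr P path_space (observation W n f)) A = (\<integral>\<^sup>+z. indicator A z \<partial>distr P path_space (observation W n f))"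
      by simp
    also have "\<dots> = (\<integral>\<^sup>+\<omega>. indicator A (observation W n f \<omega>) \<partial>P)"
      by (rule nn_integral_distr) measurable
    also have "\<dots> = (\<integral>\<^sup>+\<omega>. indicator X (\<Phi> f (D \<omega>)) \<partial>P)"
      by (rule nn_integral_cong_AE) (use AE_obs[of f] in \<open>eventually_elim, auto simp: indicator_def\<close>)
    also have "\<dots> = (\<integral>\<^sup>+x. indicator X (\<Phi> f x) \<partial>distr P (PiM {..<m} (\<lambda>_. borel)) D)"
      by (rule nn_integral_distr[symmetric]) measurable
    finally show ?thesis by (simp add: distrD)
  qed
  have shift: "\<Phi> f0 (\<lambda>l\<in>{..<m}. x l + b l) = \<Phi> f1 x" for x
  proof (rule ext)
    fix s show "\<Phi> f0 (\<lambda>l\<in>{..<m}. x l + b l) s = \<Phi> f1 x s"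
    proof (cases "s \<in> J")
      case True
      have "(\<Sum>l<idx s. (\<lambda>l\<in>{..<m}. x l + b l) l) = (\<Sum>l<idx s. x l + b l)"
        using idx(1)[OF True] by (intro sum.cong) auto
      also have "\<dots> = (\<Sum>l<idx s. x l) + (\<Sum>l<idx s. b l)" by (rule sum.distrib)
      also have "(\<Sum>l<idx s. b l) = (\<Sum>l<idx s. sqrt n * ((primitive f1 (t (Suc l)) - primitive f0 (t (Suc l))) - (primitive f1 (t l) - primitive f0 (t l))))"
      proof (rule sum.cong[OF refl])
        fix l assume "l \<in> {..<idx s}"
        then have l: "l < m" using idx(1)[OF True] by auto
        then have st: "0 \<le> t l" "t l \<le> t (Suc l)" "t (Suc l) \<le> 1" using rng[of l] rng[of "Suc l"] tl[OF l] by auto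
        have "continuous_on {t l..t (Suc l)} f0" "continuous_on {t l..t (Suc l)} f1"
          using st by (auto intro!: continuous_on_subset[OF c0] continuous_on_subset[OF c1])
        then have "integral {t l..t (Suc l)} ?g = integral {t l..t (Suc l)} f1 - integral {t l..t (Suc l)} f0"
          by (intro integral_diff integrable_continuous_interval)
        then show "b l = sqrt n * ((primitive f1 (t (Suc l)) - primitive f0 (t (Suc l))) - (primitive f1 (t l) - primitive f0 (t l)))"
          unfolding b_def primitive_increment[OF c0 st, symmetric] primitive_increment[OF c1 st, symmetric] by simp
      qed
      also have "\<dots> = sqrt n * (\<Sum>l<idx s. (primitive f1 (t (Suc l)) - primitive f0 (t (Suc l))) - (primitive f1 (t l) - primitive f0 (t l)))"
        by (rule sum_distrib_left[symmetric])
      also have "\<dots> = sqrt n * (primitive f1 s - primitive f0 s)"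
        by (subst sum_lessThan_telescope) (simp add: idx[OF True] t0 primitive_0)
      finally show ?thesis using True n by (simp add: \<Phi>_def add_divide_distrib)
    qed (simp add: \<Phi>_def)
  qed
  have "(\<integral>\<^sup>+x. indicator X (\<Phi> f1 x) \<partial>PiM {..<m} \<gamma>)\<^sup>2
     = (\<integral>\<^sup>+x. indicator X (\<Phi> f0 (\<lambda>l\<in>{..<m}. x l + b l)) \<partial>PiM {..<m} \<gamma>)\<^sup>2"
    by (simp only: shift)
  also have "\<dots> \<le> ennreal (exp (\<Sum>l<m. (b l)\<^sup>2 / (if l < m then sqrt (t (Suc l) - t l) else 1)\<^sup>2)) * (\<integral>\<^sup>+x. (indicator X (\<Phi> f0 x))\<^sup>2 \<partial>PiM {..<m} \<gamma>)"
    unfolding \<gamma>_def using tl by (intro PiM_normal_shift_Cauchy_Schwarz) auto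
  also have "(\<Sum>l<m. (b l)\<^sup>2 / (if l < m then sqrt (t (Suc l) - t l) else 1)\<^sup>2) = real n * (\<Sum>l<m. (integral {t l..t (Suc l)} ?g)\<^sup>2 / (t (Suc l) - t l))"
    unfolding sum_distrib_left using tl by (intro sum.cong) (auto simp: b_def power_mult_distrib less_imp_le)
  also have "(\<integral>\<^sup>+x. (indicator X (\<Phi> f0 x))\<^sup>2 \<partial>PiM {..<m} \<gamma>) = (\<integral>\<^sup>+x. indicator X (\<Phi> f0 x) \<partial>PiM {..<m} \<gamma>)"
    by (intro nn_integral_cong) (auto simp: indicator_def)
  also have "ennreal (exp (real n * (\<Sum>l<m. (integral {t l..t (Suc l)} ?g)\<^sup>2 / (t (Suc l) - t l)))) * (\<integral>\<^sup>+x. indicator X (\<Phi> f0 x) \<partial>PiM {..<m} \<gamma>)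
    \<le> ennreal (exp (real n * integral {0..1} (\<lambda>x. (?g x)\<^sup>2))) * (\<integral>\<^sup>+x. indicator X (\<Phi> f0 x) \<partial>PiM {..<m} \<gamma>)"
    using sum_increments_le_energy[OF cg tl t0, of m] tm by (intro mult_right_mono ennreal_leI) (auto intro!: mult_left_mono)
  finally show ?thesis by (simp only: em)
qed

text \<open>
Both sides are continuous along cylinder sets that approximate the event in a measure dominating
both laws.
\<close>

lemma law_shift_inequality:
  fixes f0 f1 :: "real \<Rightarrow> real"
  assumes c0: "continuous_on {0..1} f0" and c1: "continuous_on {0..1} f1" and n: "n > 0"
    and A: "A \<in> sets path_space"
  shows "(measure (distr P path_space (observation W n f1)) A)\<^sup>2
    \<le> exp (real n * integral {0..1} (\<lambda>x. (f1 x - f0 x)\<^sup>2)) * measure (distr P path_space (observation W n f0)) A"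
    (is "(measure ?N1 A)\<^sup>2 \<le> ?E * measure ?N0 A")
proof -
  interpret N1: prob_space ?N1 by (rule prob_space_distr[OF measurable_observation])
  interpret N0: prob_space ?N0 by (rule prob_space_distr[OF measurable_observation])
  let ?Sup = "sup_measure' ?N0 ?N1"
  have sN: "sets ?Sup = sets path_space" "space ?Sup = space path_space" by auto
  have "emeasure ?Sup X \<le> 2" if "X \<in> sets path_space" for X
  proof -
    have "emeasure ?Sup X = (SUP Y\<in>sets ?N0. emeasure ?N0 (X \<inter> Y) + emeasure ?N1 (X \<inter> - Y))"
      using that by (intro emeasure_sup_measure') auto
    also have "\<dots> \<le> 1 + 1"
      by (intro SUP_least add_mono N0.measure_le_1 N1.measure_le_1)
    finally show ?thesis by simp
  qed
  from this[of "space path_space"] have "emeasure ?Sup (space ?Sup) \<noteq> \<infinity>" unfolding sN by (auto simp: top_unique)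
  then have fin: "finite_measure ?Sup" by (rule finite_measureI)
  interpret N: finite_measure ?Sup by fact
  have le0: "measure ?N0 X \<le> measure ?Sup X" and le1: "measure ?N1 X \<le> measure ?Sup X" if "X \<in> sets path_space" for X
    using le_emeasure_sup_measure'1[of ?N1 ?N0 X] le_emeasure_sup_measure'2[of ?N1 ?N0 X] that
    by (auto simp: N.emeasure_eq_measure N0.emeasure_eq_measure N1.emeasure_eq_measure)
  define G where "G = {prod_emb {0..1} (\<lambda>_. borel :: real measure) J X | J X. finite J \<and> J \<subseteq> {0..1::real} \<and> X \<in> sets (PiM J (\<lambda>_. borel))}"
  have alg: "algebra (space ?Sup) G" "sets ?Sup = sigma_sets (space ?Sup) G"
    using algebra_cylinder_sets[of "{0..1::real}"] unfolding sN G_def by auto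
  have G: "(measure ?N1 C)\<^sup>2 \<le> ?E * measure ?N0 C" if "C \<in> G" for C
  proof -
    from that obtain J X where "C = prod_emb {0..1} (\<lambda>_. borel) J X" "finite J" "J \<subseteq> {0..1}" "X \<in> sets (PiM J (\<lambda>_. borel))"
      unfolding G_def by auto
    then have "(emeasure ?N1 C)\<^sup>2 \<le> ennreal ?E * emeasure ?N0 C"
      using cylinder_shift_inequality[OF c0 c1 n] by simp
    then show ?thesis
      by (simp add: N0.emeasure_eq_measure N1.emeasure_eq_measure ennreal_mult[symmetric] ennreal_power)
  qed
  have Gs: "C \<in> G \<Longrightarrow> C \<in> sets path_space" for C using alg(2) sN(1) by auto
  have appr: "\<exists>C\<in>G. measure ?Sup (A - C) + measure ?Sup (C - A) < e" if "e > 0" for e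
    using approximate_by_algebra[OF alg fin _ that, of A] A by (simp add: sN)
  have "\<exists>C. (\<forall>i::nat. C i \<in> G \<and> measure ?Sup (A - C i) + measure ?Sup (C i - A) < 1 / real (Suc i))"
    using appr[of "1 / real (Suc _)"] by (intro choice allI) fastforce
  then obtain C where C: "\<And>i::nat. C i \<in> G" "\<And>i. measure ?Sup (A - C i) + measure ?Sup (C i - A) < 1 / real (Suc i)" by blast
  have lim: "(\<lambda>i. measure Q (C i)) \<longlonglongrightarrow> measure Q A"
    if Q: "finite_measure Q" "sets Q = sets path_space" "\<And>X. X \<in> sets path_space \<Longrightarrow> measure Q X \<le> measure ?Sup X" for Q
  proof -
    interpret Q: finite_measure Q by fact
    have "\<bar>measure Q (C i) - measure Q A\<bar> \<le> 1 / real (Suc i)" for i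
    proof -
      have [measurable]: "C i \<in> sets Q" "A \<in> sets Q" using Gs[OF C(1)] A Q by auto
      have "measure Q (C i) = measure Q (C i \<inter> A) + measure Q (C i - A)"
        using Q.finite_measure_Diff'[of "C i" A] by simp
      moreover have "measure Q A = measure Q (C i \<inter> A) + measure Q (A - C i)"
        using Q.finite_measure_Diff'[of A "C i"] by (simp add: Int_commute)
      moreover have "measure Q (C i - A) \<le> measure ?Sup (C i - A)" "measure Q (A - C i) \<le> measure ?Sup (A - C i)"
        using Q(3) Gs[OF C(1)] A by auto
      ultimately show ?thesis using C(2)[of i] measure_nonneg[of Q "C i - A"] measure_nonneg[of Q "A - C i"] by linarith
    qed
    then have "(\<lambda>i. measure Q (C i) - measure Q A) \<longlonglongrightarrow> 0"
      by (intro Lim_null_comparison[OF always_eventually LIMSEQ_inverse_real_of_nat[unfolded inverse_eq_divide]]) simp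
    then show ?thesis using LIM_zero_iff by blast
  qed
  have "(\<lambda>i. (measure ?N1 (C i))\<^sup>2) \<longlonglongrightarrow> (measure ?N1 A)\<^sup>2"
    by (intro tendsto_power lim le1) (auto intro: N1.finite_measure_axioms)
  moreover have "(\<lambda>i. ?E * measure ?N0 (C i)) \<longlonglongrightarrow> ?E * measure ?N0 A"
    by (intro tendsto_mult_left lim le0) (auto intro: N0.finite_measure_axioms)
  ultimately show ?thesis by (rule LIMSEQ_le) (use G[OF C(1)] in blast)
qed

end

section \<open>Local loss and the two-point lower bound\<close>

text \<open>
The point mass for \<open>c = 0\<close> turns the pointwise risk into the same kind of integral as the
averaged one.
\<close>

definition window_measure :: "real \<Rightarrow> real \<Rightarrow> real measure" where
  "window_measure x0 c = (if c = 0 then return borel x0 else uniform_measure lborel {x0 - c..x0 + c})"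

lemma sets_window_measure [simp, measurable_cong]: "sets (window_measure x0 c) = sets borel"
  and space_window_measure [simp]: "space (window_measure x0 c) = UNIV"
  by (auto simp: window_measure_def)

lemma prob_space_window_measure: "c \<ge> 0 \<Longrightarrow> prob_space (window_measure x0 c)"
  unfolding window_measure_def by (auto intro!: prob_space_return prob_space_uniform_measure)

lemma emeasure_centred_interval: "c \<ge> 0 \<Longrightarrow> emeasure lborel {x0 - c..x0 + c} = ennreal (2 * c)"
  by (subst emeasure_lborel_Icc) (auto intro!: arg_cong[where f=ennreal])

lemma nn_integral_window_measure:
  assumes [measurable]: "g \<in> borel_measurable borel" and c: "c > 0"
  shows "(\<integral>\<^sup>+x. g x \<partial>window_measure x0 c) = ennreal (1 / (2 * c)) * (\<integral>\<^sup>+x\<in>{x0 - c..x0 + c}. g x \<partial>lborel)"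
proof -
  have "(\<integral>\<^sup>+x. g x \<partial>window_measure x0 c) = (\<integral>\<^sup>+x\<in>{x0 - c..x0 + c}. g x \<partial>lborel) / ennreal (2 * c)"
    using c unfolding window_measure_def by (simp add: nn_integral_uniform_measure emeasure_centred_interval)
  also have "\<dots> = ennreal (1 / (2 * c)) * (\<integral>\<^sup>+x\<in>{x0 - c..x0 + c}. g x \<partial>lborel)"
    using c by (simp add: divide_ennreal_def inverse_ennreal mult.commute[of "ennreal _"] divide_inverse del: inverse_mult_distrib)
  finally show ?thesis .
qed

lemma AE_window_measure:
  assumes "c \<ge> 0"
  shows "AE x in window_measure x0 c. x \<in> {x0 - c..x0 + c}"
proof (cases "c = 0")
  case False
  have "AE x in uniform_measure lborel {x0 - c..x0 + c}. x \<in> {x0 - c..x0 + c}"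
    by (rule AE_uniform_measureI) auto
  then show ?thesis
    unfolding window_measure_def using False by (simp only: if_False)
next
  case True
  have "AE x in return borel x0. x \<in> {x0..x0}"
    by (subst AE_return) auto
  then show ?thesis unfolding window_measure_def if_P[OF True] by (simp add: True)
qed

lemma window_measure_mass:
  assumes c: "c \<ge> 0" and h: "h > 0"
  shows "emeasure (window_measure x0 c) {x0 - h..x0 + h} \<ge> ennreal (if c \<le> h then 1 else h / c)"
proof (cases "c \<le> h")
  case True
  interpret prob_space "window_measure x0 c" by (rule prob_space_window_measure[OF c])
  have "AE x in window_measure x0 c. x \<in> {x0 - h..x0 + h}"
    using AE_window_measure[OF c, of x0] by eventually_elim (use True in auto)
  then have "emeasure (window_measure x0 c) {x0 - h..x0 + h} = 1"
    by (intro emeasure_eq_1_AE) auto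
  then show ?thesis using True by simp
next
  case False
  then have c0: "c > 0" "{x0 - c..x0 + c} \<inter> {x0 - h..x0 + h} = {x0 - h..x0 + h}" using h by auto
  have "emeasure (window_measure x0 c) {x0 - h..x0 + h} = ennreal (2 * h) / ennreal (2 * c)"
    unfolding window_measure_def using c0 h by (simp add: emeasure_uniform_measure emeasure_centred_interval)
  also have "\<dots> = ennreal (h / c)" using c0 h by (simp add: divide_ennreal)
  finally show ?thesis using False by simp
qed

lemma continuous_comp_clip01:
  assumes "continuous_on {0..1} f" shows "continuous_on UNIV (\<lambda>x. f (clip01 x))"
  by (rule continuous_on_compose2[OF assms continuous_clip01]) (use clip01_in in blast)

lemma measurable_comp_clip01:
  "continuous_on {0..1} f \<Longrightarrow> (\<lambda>x. f (clip01 x)) \<in> borel_measurable borel"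
  by (intro borel_measurable_continuous_onI continuous_comp_clip01)

text \<open>
Reading \<open>f\<close> through the retraction makes the loss a measurable function of the path for every
member of a Hoelder class.
\<close>

definition loss :: "((real \<Rightarrow> real) \<Rightarrow> real \<Rightarrow> real) \<Rightarrow> (real \<Rightarrow> real) \<Rightarrow> real measure \<Rightarrow> (real \<Rightarrow> real) \<Rightarrow> ennreal" where
  "loss fh f \<mu> z = (\<integral>\<^sup>+x. ennreal ((fh z x - f (clip01 x))\<^sup>2) \<partial>\<mu>)"

lemma estimators_section: "fh \<in> estimators \<Longrightarrow> z \<in> space path_space \<Longrightarrow> fh z \<in> borel_measurable borel"
  using measurable_compose_Pair1[of z path_space "\<lambda>(z, x). fh z x" borel borel] by (simp add: estimators_def)

lemma measurable_loss:
  assumes fh: "fh \<in> estimators" and f: "continuous_on {0..1} f" and c: "c \<ge> 0"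
  shows "loss fh f (window_measure x0 c) \<in> borel_measurable path_space"
proof -
  interpret prob_space "window_measure x0 c" by (rule prob_space_window_measure[OF c])
  note measurable_comp_clip01[OF f, measurable]
  have [measurable]: "(\<lambda>(z, x). fh z x) \<in> borel_measurable (path_space \<Otimes>\<^sub>M window_measure x0 c)"
    using fh unfolding estimators_def by (simp cong: measurable_cong_sets sets_pair_measure_cong)
  show ?thesis
    unfolding loss_def by measurable
qed

lemma ennreal_times_2: "a \<ge> 0 \<Longrightarrow> 2 * ennreal a = ennreal (2 * a)"
  by (simp add: ennreal_mult)

context std_brownian_motion begin

lemma observation_in_space: "observation W n f \<omega> \<in> space path_space"
  by (auto simp: observation_def space_PiM)

lemma risk_eq_nn_integral_loss:
  assumes fh: "fh \<in> estimators" and f: "continuous_on {0..1} f" and c: "c \<ge> 0" and w: "{x0 - c..x0 + c} \<subseteq> {0..1}"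
  shows "risk P W n fh f x0 c = (\<integral>\<^sup>+\<omega>. loss fh f (window_measure x0 c) (observation W n f \<omega>) \<partial>P)"
proof (cases "c = 0")
  case True
  have "loss fh f (window_measure x0 c) (observation W n f \<omega>) = ennreal ((fh (observation W n f \<omega>) x0 - f x0)\<^sup>2)" for \<omega>
  proof -
    note measurable_comp_clip01[OF f, measurable] estimators_section[OF fh observation_in_space, measurable]
    show ?thesis
      unfolding loss_def window_measure_def using True w by (simp add: nn_integral_return)
  qed
  then show ?thesis using True by (simp add: risk_def)
next
  case False
  then have c: "c > 0" using c by simp
  have "loss fh f (window_measure x0 c) (observation W n f \<omega>) = ennreal (1 / (2 * c)) * (\<integral>\<^sup>+x\<in>{x0 - c..x0 + c}. ennreal ((fh (observation W n f \<omega>) x - f x)\<^sup>2) \<partial>lborel)" for \<omega>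
  proof -
    note measurable_comp_clip01[OF f, measurable] estimators_section[OF fh observation_in_space, measurable]
    have "loss fh f (window_measure x0 c) (observation W n f \<omega>) = ennreal (1 / (2 * c)) * (\<integral>\<^sup>+x\<in>{x0 - c..x0 + c}. ennreal ((fh (observation W n f \<omega>) x - f (clip01 x))\<^sup>2) \<partial>lborel)"
      unfolding loss_def using c by (intro nn_integral_window_measure) measurable
    also have "(\<integral>\<^sup>+x\<in>{x0 - c..x0 + c}. ennreal ((fh (observation W n f \<omega>) x - f (clip01 x))\<^sup>2) \<partial>lborel)
        = (\<integral>\<^sup>+x\<in>{x0 - c..x0 + c}. ennreal ((fh (observation W n f \<omega>) x - f x)\<^sup>2) \<partial>lborel)"
    proof (rule nn_integral_cong)
      fix x
      show "ennreal ((fh (observation W n f \<omega>) x - f (clip01 x))\<^sup>2) * indicator {x0 - c..x0 + c} x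
        = ennreal ((fh (observation W n f \<omega>) x - f x)\<^sup>2) * indicator {x0 - c..x0 + c} x"
      proof (cases "x \<in> {x0 - c..x0 + c}")
        case True
        then have "clip01 x = x" using w by (intro clip01_id) blast
        then show ?thesis by simp
      qed simp
    qed
    finally show ?thesis .
  qed
  note eq = this
  have "(\<lambda>\<omega>. loss fh f (window_measure x0 c) (observation W n f \<omega>)) \<in> borel_measurable P"
    using measurable_compose[OF measurable_observation measurable_loss[OF fh f]] c by simp
  then have m: "(\<lambda>\<omega>. ennreal (2 * c) * (ennreal (1 / (2 * c)) * (\<integral>\<^sup>+x\<in>{x0 - c..x0 + c}. ennreal ((fh (observation W n f \<omega>) x - f x)\<^sup>2) \<partial>lborel))) \<in> borel_measurable P"
    unfolding eq by measurable
  have "(\<lambda>\<omega>. \<integral>\<^sup>+x\<in>{x0 - c..x0 + c}. ennreal ((fh (observation W n f \<omega>) x - f x)\<^sup>2) \<partial>lborel) \<in> borel_measurable P"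
    using m c by (simp add: mult.assoc[symmetric] ennreal_mult[symmetric])
  then show ?thesis unfolding risk_def eq using c by (simp add: nn_integral_cmult)
qed

text \<open>
If the estimate is far from \<open>f0\<close> with small probability under \<open>f0\<close>, it is far from \<open>f0\<close>
with probability at most one half under \<open>f1\<close>. Whenever it is close to \<open>f0\<close>, its squared
distance from \<open>f1\<close> is at least a quarter of \<open>\<Delta>\<close>.
\<close>

lemma two_point_lower_bound:
  fixes f0 f1 :: "real \<Rightarrow> real"
  assumes fh: "fh \<in> estimators" and c0: "continuous_on {0..1} f0" and c1: "continuous_on {0..1} f1" and n: "n > 0"
    and c: "c \<ge> 0" and w: "{x0 - c..x0 + c} \<subseteq> {0..1}"
    and r0: "risk P W n fh f0 x0 c \<le> ennreal r" "r \<ge> 0"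
    and \<Delta>: "\<Delta> > 0" "ennreal \<Delta> \<le> (\<integral>\<^sup>+x. ennreal ((f1 (clip01 x) - f0 (clip01 x))\<^sup>2) \<partial>window_measure x0 c)"
    and small: "16 * exp (real n * integral {0..1} (\<lambda>x. (f1 x - f0 x)\<^sup>2)) * r \<le> \<Delta>"
  shows "ennreal (\<Delta> / 8) \<le> risk P W n fh f1 x0 c"
proof -
  let ?\<mu> = "window_measure x0 c"
  define L where "L f = loss fh f ?\<mu>" for f
  define Q where "Q f = distr P path_space (observation W n f)" for f
  have prob: "prob_space (Q f)" for f unfolding Q_def by (rule prob_space_distr[OF measurable_observation])
  have sQ[simp, measurable_cong]: "sets (Q f) = sets path_space" for f by (simp add: Q_def)
  have spQ[simp]: "space (Q f) = space path_space" for f by (simp add: Q_def)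
  have Lm[measurable]: "L f0 \<in> borel_measurable path_space" "L f1 \<in> borel_measurable path_space"
    unfolding L_def by (rule measurable_loss[OF fh c0 c] measurable_loss[OF fh c1 c])+
  have risk: "risk P W n fh f x0 c = (\<integral>\<^sup>+z. L f z \<partial>Q f)" if "continuous_on {0..1} f" "L f \<in> borel_measurable path_space" for f
    unfolding risk_eq_nn_integral_loss[OF fh that(1) c w] Q_def L_def[symmetric]
    by (rule nn_integral_distr[symmetric, OF measurable_observation]) (use that in simp)
  define A where "A = {z\<in>space path_space. ennreal (\<Delta> / 4) \<le> L f0 z}"
  have A[measurable]: "A \<in> sets path_space" unfolding A_def by measurable
  interpret Q0: prob_space "Q f0" by (rule prob)
  interpret Q1: prob_space "Q f1" by (rule prob)
  have "ennreal (\<Delta> / 4) * emeasure (Q f0) A = (\<integral>\<^sup>+z. ennreal (\<Delta> / 4) * indicator A z \<partial>Q f0)"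
    by (simp add: nn_integral_cmult_indicator)
  also have "\<dots> \<le> (\<integral>\<^sup>+z. L f0 z \<partial>Q f0)"
    by (intro nn_integral_mono) (auto simp: A_def indicator_def)
  also have "\<dots> \<le> ennreal r" using r0 risk[OF c0] by simp
  finally have "\<Delta> / 4 * measure (Q f0) A \<le> r"
    using \<Delta> r0 by (simp add: Q0.emeasure_eq_measure ennreal_mult[symmetric])
  then have m0: "measure (Q f0) A \<le> 4 * r / \<Delta>" using \<Delta> by (simp add: field_simps)
  let ?E = "exp (real n * integral {0..1} (\<lambda>x. (f1 x - f0 x)\<^sup>2))"
  have "(measure (Q f1) A)\<^sup>2 \<le> ?E * measure (Q f0) A"
    unfolding Q_def by (rule law_shift_inequality[OF c0 c1 n A])
  also have "\<dots> \<le> ?E * (4 * r / \<Delta>)" using m0 by (intro mult_left_mono) auto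
  also have "\<dots> \<le> (1 / 2)\<^sup>2" using small \<Delta> by (simp add: field_simps power2_eq_square)
  finally have m1: "measure (Q f1) A \<le> 1 / 2" by (rule power2_le_imp_le) simp
  have far: "ennreal (\<Delta> / 4) \<le> L f1 z" if z: "z \<in> space path_space" "z \<notin> A" for z
  proof -
    note measurable_comp_clip01[OF c0, measurable] measurable_comp_clip01[OF c1, measurable] estimators_section[OF fh z(1), measurable]
    have "ennreal \<Delta> \<le> (\<integral>\<^sup>+x. ennreal ((f1 (clip01 x) - f0 (clip01 x))\<^sup>2) \<partial>?\<mu>)" by (rule \<Delta>)
    also have "\<dots> \<le> (\<integral>\<^sup>+x. 2 * ennreal ((fh z x - f0 (clip01 x))\<^sup>2) + 2 * ennreal ((fh z x - f1 (clip01 x))\<^sup>2) \<partial>?\<mu>)"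
    proof (rule nn_integral_mono)
      fix x
      have "(f1 (clip01 x) - f0 (clip01 x))\<^sup>2 \<le> 2 * (fh z x - f0 (clip01 x))\<^sup>2 + 2 * (fh z x - f1 (clip01 x))\<^sup>2"
        using zero_le_power2[of "(fh z x - f0 (clip01 x)) + (fh z x - f1 (clip01 x))"]
        by (simp add: power2_eq_square algebra_simps)
      then have "ennreal ((f1 (clip01 x) - f0 (clip01 x))\<^sup>2) \<le> ennreal (2 * (fh z x - f0 (clip01 x))\<^sup>2 + 2 * (fh z x - f1 (clip01 x))\<^sup>2)"
        by (rule ennreal_leI)
      then show "ennreal ((f1 (clip01 x) - f0 (clip01 x))\<^sup>2) \<le> 2 * ennreal ((fh z x - f0 (clip01 x))\<^sup>2) + 2 * ennreal ((fh z x - f1 (clip01 x))\<^sup>2)"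
        by (simp add: ennreal_times_2)
    qed
    also have "\<dots> = 2 * L f0 z + 2 * L f1 z"
      unfolding L_def loss_def by (subst nn_integral_add) (simp_all add: nn_integral_cmult)
    also have "\<dots> \<le> 2 * ennreal (\<Delta> / 4) + 2 * L f1 z"
      using z by (intro add_right_mono mult_left_mono) (auto simp: A_def)
    finally have 1: "ennreal \<Delta> \<le> ennreal (\<Delta> / 2) + 2 * L f1 z"
      using \<Delta> by (simp add: ennreal_times_2)
    show ?thesis
    proof (cases "L f1 z")
      case (real l)
      have "ennreal \<Delta> \<le> ennreal (\<Delta> / 2 + 2 * l)"
        using 1 real \<Delta> by (simp add: ennreal_times_2)
      then have "\<Delta> \<le> \<Delta> / 2 + 2 * l"
        using real \<Delta> by (subst (asm) ennreal_le_iff) auto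
      then show ?thesis using real by (simp add: ennreal_leI)
    qed simp
  qed
  have "ennreal (\<Delta> / 8) \<le> ennreal (\<Delta> / 4 * (1 - measure (Q f1) A))"
    using m1 \<Delta> by (intro ennreal_leI) (simp add: field_simps)
  also have "1 - measure (Q f1) A = measure (Q f1) (space path_space - A)"
    using Q1.prob_compl[of A] by simp
  also have "ennreal (\<Delta> / 4 * measure (Q f1) (space path_space - A)) = (\<integral>\<^sup>+z. ennreal (\<Delta> / 4) * indicator (space path_space - A) z \<partial>Q f1)"
    using \<Delta> by (simp add: nn_integral_cmult_indicator Q1.emeasure_eq_measure ennreal_mult[symmetric])
  also have "\<dots> \<le> (\<integral>\<^sup>+z. L f1 z \<partial>Q f1)"
    using far by (intro nn_integral_mono) (auto simp: indicator_def)
  also have "\<dots> = risk P W n fh f1 x0 c" using risk[OF c1] by simp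
  finally show ?thesis .
qed

end

section \<open>A perturbation that stays in the Hoelder class\<close>

text \<open>
The \<open>j\<close>-th derivative of the curve \<open>1 / (1 + u^2) = Re (1 / (1 - \<i> u))\<close>, the witch of Agnesi.
The complex form shows that it is bounded by \<open>j!\<close>.
\<close>

definition witch :: "nat \<Rightarrow> real \<Rightarrow> real" where
  "witch j u = Re (\<i> ^ j * of_nat (fact j) * inverse ((1 - \<i> * of_real u) ^ Suc j))"

lemma witch_0: "witch 0 u = 1 / (1 + u\<^sup>2)"
  by (simp add: witch_def power2_eq_square Re_divide inverse_eq_divide)

lemma one_minus_i_times_nonzero: "1 - \<i> * of_real u \<noteq> (0 :: complex)"
  by (simp add: complex_eq_iff)

lemma witch_has_derivative: "(witch j has_real_derivative witch (Suc j) u) (at u)"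
proof -
  define c :: complex where "c = \<i> ^ j * of_nat (fact j)"
  have "((\<lambda>z. c * inverse ((1 - \<i> * z) ^ Suc j)) has_field_derivative \<i> ^ Suc j * of_nat (fact (Suc j)) * inverse ((1 - \<i> * of_real u) ^ Suc (Suc j))) (at (of_real u))"
  proof -
    define w :: complex where "w = 1 - \<i> * of_real u"
    have w: "w \<noteq> 0" using one_minus_i_times_nonzero[of u] by (simp add: w_def)
    have "((\<lambda>z. (1 - \<i> * z) ^ Suc j) has_field_derivative of_nat (Suc j) * (w ^ j * - \<i>)) (at (of_real u))"
      unfolding w_def by (rule derivative_eq_intros refl)+ simp
    from DERIV_cmult[OF DERIV_inverse_fun[OF this], of c]
    have "((\<lambda>z. c * inverse ((1 - \<i> * z) ^ Suc j)) has_field_derivative c * - (inverse (w ^ Suc j) * (of_nat (Suc j) * (w ^ j * - \<i>)) * inverse (w ^ Suc j))) (at (of_real u))"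
      using w by (simp add: w_def ac_simps)
    also have "c * - (inverse (w ^ Suc j) * (of_nat (Suc j) * (w ^ j * - \<i>)) * inverse (w ^ Suc j)) = \<i> ^ Suc j * of_nat (fact (Suc j)) * inverse (w ^ Suc (Suc j))"
      unfolding c_def using w by (simp add: divide_inverse[symmetric] power_add[symmetric] field_simps)
    finally show ?thesis by (simp add: w_def)
  qed
  then have "((\<lambda>x. c * inverse ((1 - \<i> * of_real x) ^ Suc j)) has_vector_derivative \<i> ^ Suc j * of_nat (fact (Suc j)) * inverse ((1 - \<i> * of_real u) ^ Suc (Suc j))) (at u)"
    by (rule has_vector_derivative_real_field)
  from bounded_linear.has_vector_derivative[OF bounded_linear_Re this]
  show ?thesis
    unfolding has_real_derivative_iff_has_vector_derivative witch_def[abs_def] c_def .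
qed

lemma witch_bound: "\<bar>witch j u\<bar> \<le> fact j"
proof -
  have "1 \<le> cmod (1 - \<i> * of_real u)"
    using abs_Re_le_cmod[of "1 - \<i> * of_real u"] by simp
  then have "inverse (cmod (1 - \<i> * of_real u) ^ Suc j) \<le> 1"
    by (intro inverse_le_1_iff[THEN iffD2] disjI2 one_le_power)
  then have "fact j * inverse (cmod (1 - \<i> * of_real u) ^ Suc j) \<le> fact j * (1::real)"
    by (intro mult_left_mono) auto
  moreover have "\<bar>witch j u\<bar> \<le> cmod (\<i> ^ j * of_nat (fact j) * inverse ((1 - \<i> * of_real u) ^ Suc j))"
    unfolding witch_def by (rule abs_Re_le_cmod)
  moreover have "\<dots> = fact j * inverse (cmod (1 - \<i> * of_real u) ^ Suc j)"
    by (simp add: norm_mult norm_inverse norm_power del: power_Suc)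
  ultimately show ?thesis by linarith
qed

text \<open>
At distances below one the Lipschitz bound is the stronger one, beyond that the uniform bound.
\<close>

lemma witch_Holder:
  assumes s: "0 < s" "s \<le> 1"
  shows "\<bar>witch j u - witch j v\<bar> \<le> 2 * fact (Suc j) * \<bar>u - v\<bar> powr s"
proof (cases "\<bar>u - v\<bar> \<le> 1")
  case True
  have "norm (witch j u - witch j v) \<le> fact (Suc j) * norm (u - v)"
    by (rule field_differentiable_bound[of UNIV _ "witch (Suc j)"])
       (auto intro: witch_has_derivative DERIV_subset witch_bound simp del: fact_Suc)
  also have "\<dots> = fact (Suc j) * \<bar>u - v\<bar> powr 1" by simp
  also have "\<dots> \<le> fact (Suc j) * \<bar>u - v\<bar> powr s"
    using True s powr_mono'[of s 1 "\<bar>u - v\<bar>"] by (intro mult_left_mono) auto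
  also have "\<dots> \<le> 2 * fact (Suc j) * \<bar>u - v\<bar> powr s" by (intro mult_right_mono) auto
  finally show ?thesis by simp
next
  case False
  have "\<bar>witch j u - witch j v\<bar> \<le> 2 * fact j"
    using witch_bound[of j u] witch_bound[of j v] by linarith
  also have "\<dots> \<le> 2 * fact (Suc j)" using fact_mono[of j "Suc j"] by (simp del: fact_Suc)
  also have "\<dots> \<le> 2 * fact (Suc j) * \<bar>u - v\<bar> powr s"
    using mult_left_mono[of 1 "\<bar>u - v\<bar> powr s" "2 * fact (Suc j)"] False s ge_one_powr_ge_zero[of "\<bar>u - v\<bar>" s] by simp
  finally show ?thesis .
qed

text \<open>
Height \<open>h powr \<alpha>\<close> and width \<open>h\<close> are balanced so that the Hoelder constant of order \<open>\<alpha>\<close> depends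
on the factor \<open>a\<close> alone.
\<close>

definition bump :: "real \<Rightarrow> real \<Rightarrow> real \<Rightarrow> real \<Rightarrow> real \<Rightarrow> real" where
  "bump \<alpha> a h x0 x = a * h powr \<alpha> * witch 0 ((x - x0) / h)"

lemma nderiv01_add_bump:
  assumes f: "\<And>i x. i < k \<Longrightarrow> x \<in> {0..1} \<Longrightarrow> nderiv01 i f differentiable (at x within {0..1})" and h: "h > 0"
  shows "j \<le> k \<Longrightarrow> x \<in> {0..1} \<Longrightarrow> nderiv01 j (\<lambda>x. f x + bump \<alpha> a h x0 x) x = nderiv01 j f x + a * h powr \<alpha> / h ^ j * witch j ((x - x0) / h)"
    and "j < k \<Longrightarrow> x \<in> {0..1} \<Longrightarrow> nderiv01 j (\<lambda>x. f x + bump \<alpha> a h x0 x) differentiable (at x within {0..1})"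
proof -
  have step: "(nderiv01 j (\<lambda>x. f x + bump \<alpha> a h x0 x) has_vector_derivative nderiv01 (Suc j) f x + a * h powr \<alpha> / h ^ Suc j * witch (Suc j) ((x - x0) / h)) (at x within {0..1})"
    if eq: "\<And>x. x \<in> {0..1} \<Longrightarrow> nderiv01 j (\<lambda>x. f x + bump \<alpha> a h x0 x) x = nderiv01 j f x + a * h powr \<alpha> / h ^ j * witch j ((x - x0) / h)"
      and j: "j < k" and x: "x \<in> {0..1}" for j x
  proof (rule has_vector_derivative_transform[OF x eq])
    have 1: "(nderiv01 j f has_vector_derivative nderiv01 (Suc j) f x) (at x within {0..1})"
      using f[OF j x] by (simp add: vector_derivative_works)
    have "((\<lambda>x. witch j ((x - x0) / h)) has_real_derivative witch (Suc j) ((x - x0) / h) * (1 / h)) (at x within {0..1})"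
      using h by (intro DERIV_chain2[OF witch_has_derivative]) (auto intro!: derivative_eq_intros)
    then have "((\<lambda>x. a * h powr \<alpha> / h ^ j * witch j ((x - x0) / h)) has_real_derivative a * h powr \<alpha> / h ^ j * (witch (Suc j) ((x - x0) / h) * (1 / h))) (at x within {0..1})"
      by (rule DERIV_cmult)
    also have "a * h powr \<alpha> / h ^ j * (witch (Suc j) ((x - x0) / h) * (1 / h)) = a * h powr \<alpha> / h ^ Suc j * witch (Suc j) ((x - x0) / h)"
      by simp
    finally show "((\<lambda>x. nderiv01 j f x + a * h powr \<alpha> / h ^ j * witch j ((x - x0) / h)) has_vector_derivative nderiv01 (Suc j) f x + a * h powr \<alpha> / h ^ Suc j * witch (Suc j) ((x - x0) / h)) (at x within {0..1})"
      unfolding has_real_derivative_iff_has_vector_derivative by (rule has_vector_derivative_add[OF 1])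
  qed
  have main: "nderiv01 j (\<lambda>x. f x + bump \<alpha> a h x0 x) x = nderiv01 j f x + a * h powr \<alpha> / h ^ j * witch j ((x - x0) / h)"
    if "j \<le> k" "x \<in> {0..1}" for j x
    using that
  proof (induction j arbitrary: x)
    case (Suc j)
    have "vector_derivative (nderiv01 j (\<lambda>x. f x + bump \<alpha> a h x0 x)) (at x within {0..1}) = nderiv01 (Suc j) f x + a * h powr \<alpha> / h ^ Suc j * witch (Suc j) ((x - x0) / h)"
      using Suc by (intro vector_derivative_within_closed_interval step) auto
    then show ?case by simp
  qed (simp add: bump_def)
  then show "j \<le> k \<Longrightarrow> x \<in> {0..1} \<Longrightarrow> nderiv01 j (\<lambda>x. f x + bump \<alpha> a h x0 x) x = nderiv01 j f x + a * h powr \<alpha> / h ^ j * witch j ((x - x0) / h)" .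
  show "j < k \<Longrightarrow> x \<in> {0..1} \<Longrightarrow> nderiv01 j (\<lambda>x. f x + bump \<alpha> a h x0 x) differentiable (at x within {0..1})"
    using step[OF main] by (auto intro: differentiableI_vector)
qed

lemma holder_class_add_bump:
  assumes f: "f \<in> holder_class \<alpha> M'" and \<alpha>: "\<alpha> > 0" and h: "h > 0"
    and a: "a \<ge> 0" "a * (2 * fact (Suc (holder_order \<alpha>))) \<le> M - M'"
  shows "(\<lambda>x. f x + bump \<alpha> a h x0 x) \<in> holder_class \<alpha> M"
proof -
  define k where "k = holder_order \<alpha>"
  define s where "s = \<alpha> - real k"
  have s: "0 < s" "s \<le> 1" using holder_order_bounds[OF \<alpha>] by (auto simp: s_def k_def)
  have fd: "\<And>i x. i < k \<Longrightarrow> x \<in> {0..1} \<Longrightarrow> nderiv01 i f differentiable (at x within {0..1})"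
    and fH: "\<And>x y. 0 \<le> x \<and> x < y \<and> y \<le> 1 \<Longrightarrow> \<bar>nderiv01 k f x - nderiv01 k f y\<bar> \<le> M' * \<bar>x - y\<bar> powr s"
    using f by (auto simp: holder_class_def k_def s_def)
  have nd1: "nderiv01 k (\<lambda>x. f x + bump \<alpha> a h x0 x) x = nderiv01 k f x + a * h powr \<alpha> / h ^ k * witch k ((x - x0) / h)" if "x \<in> {0..1}" for x
    by (rule nderiv01_add_bump(1)[where k=k]) (use fd h that in auto)
  have nd2: "nderiv01 j (\<lambda>x. f x + bump \<alpha> a h x0 x) differentiable (at x within {0..1})" if "j < k" "x \<in> {0..1}" for j x
    by (rule nderiv01_add_bump(2)[where k=k]) (use fd h that in auto)
  have "\<bar>nderiv01 k (\<lambda>x. f x + bump \<alpha> a h x0 x) x - nderiv01 k (\<lambda>x. f x + bump \<alpha> a h x0 x) y\<bar> \<le> M * \<bar>x - y\<bar> powr s"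
    if xy: "0 \<le> x \<and> x < y \<and> y \<le> 1" for x y
  proof -
    let ?b = "\<lambda>x. witch k ((x - x0) / h)"
    have hk: "h powr \<alpha> / h ^ k = h powr s"
      using h by (simp add: s_def powr_diff powr_realpow)
    have "\<bar>?b x - ?b y\<bar> \<le> 2 * fact (Suc k) * \<bar>(x - x0) / h - (y - x0) / h\<bar> powr s"
      by (rule witch_Holder[OF s])
    also have "\<bar>(x - x0) / h - (y - x0) / h\<bar> powr s = \<bar>x - y\<bar> powr s / h powr s"
    proof -
      have "(x - x0) / h - (y - x0) / h = (x - y) / h" using h by (simp add: diff_divide_distrib)
      then show ?thesis using h by (simp add: abs_divide powr_divide)
    qed
    finally have "a * h powr s * \<bar>?b x - ?b y\<bar> \<le> a * h powr s * (2 * fact (Suc k) * (\<bar>x - y\<bar> powr s / h powr s))"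
      using a by (intro mult_left_mono) auto
    also have "\<dots> = a * (2 * fact (Suc k)) * \<bar>x - y\<bar> powr s" using h by simp
    also have "\<dots> \<le> (M - M') * \<bar>x - y\<bar> powr s" using a by (intro mult_right_mono) (auto simp: k_def)
    finally have 1: "\<bar>a * h powr s * (?b x - ?b y)\<bar> \<le> (M - M') * \<bar>x - y\<bar> powr s"
      using a by (simp add: abs_mult)
    have "nderiv01 k (\<lambda>x. f x + bump \<alpha> a h x0 x) x - nderiv01 k (\<lambda>x. f x + bump \<alpha> a h x0 x) y
        = (nderiv01 k f x - nderiv01 k f y) + a * h powr s * (?b x - ?b y)"
    proof -
      have "x \<in> {0..1}" "y \<in> {0..1}" using xy by auto
      then show ?thesis
        by (simp only: nd1 hk[symmetric]) (simp add: algebra_simps)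
    qed
    then have "\<bar>nderiv01 k (\<lambda>x. f x + bump \<alpha> a h x0 x) x - nderiv01 k (\<lambda>x. f x + bump \<alpha> a h x0 x) y\<bar>
        \<le> M' * \<bar>x - y\<bar> powr s + (M - M') * \<bar>x - y\<bar> powr s"
      using fH[OF xy] 1 abs_triangle_ineq by (smt (verit))
    then show ?thesis by (simp add: algebra_simps)
  qed
  then show ?thesis
    using nd2 unfolding holder_class_def k_def[symmetric] s_def[symmetric] by auto
qed

text \<open>
The witch of Agnesi is at most one, so its square is bounded by itself, and its primitive is the
arcus tangent.
\<close>

lemma bump_energy:
  assumes h: "h > 0"
  shows "integral {0..1} (\<lambda>x. (bump \<alpha> a h x0 x)\<^sup>2) \<le> a\<^sup>2 * h powr (2 * \<alpha> + 1) * pi"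
proof -
  let ?F = "\<lambda>x. (a * h powr \<alpha>)\<^sup>2 * h * arctan ((x - x0) / h)"
  have F: "((\<lambda>x. (a * h powr \<alpha>)\<^sup>2 * witch 0 ((x - x0) / h)) has_integral (?F 1 - ?F 0)) {0..1}"
  proof (rule fundamental_theorem_of_calculus)
    fix x :: real
    have "(?F has_real_derivative (a * h powr \<alpha>)\<^sup>2 * witch 0 ((x - x0) / h)) (at x within {0..1})"
      using h by (auto intro!: derivative_eq_intros simp: witch_0 inverse_eq_divide)
    then show "(?F has_vector_derivative (a * h powr \<alpha>)\<^sup>2 * witch 0 ((x - x0) / h)) (at x within {0..1})"
      by (simp add: has_real_derivative_iff_has_vector_derivative)
  qed simp
  have w: "0 \<le> witch 0 u" "witch 0 u \<le> 1" for u
    by (auto simp: witch_0 add_pos_nonneg)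
  have cont: "continuous_on UNIV (witch 0)"
    using witch_has_derivative by (meson DERIV_continuous_on DERIV_subset top_greatest)
  have "integral {0..1} (\<lambda>x. (bump \<alpha> a h x0 x)\<^sup>2) \<le> ?F 1 - ?F 0"
  proof (rule has_integral_le[OF integrable_integral F])
    show "(\<lambda>x. (bump \<alpha> a h x0 x)\<^sup>2) integrable_on {0..1}"
      unfolding bump_def using h
      by (intro integrable_continuous_interval continuous_intros continuous_on_compose2[OF cont]) auto
    fix x :: real
    have "(witch 0 ((x - x0) / h))\<^sup>2 \<le> witch 0 ((x - x0) / h)"
      using w[of "(x - x0) / h"] by (simp add: power2_eq_square mult_left_le)
    then show "(bump \<alpha> a h x0 x)\<^sup>2 \<le> (a * h powr \<alpha>)\<^sup>2 * witch 0 ((x - x0) / h)"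
      unfolding bump_def power_mult_distrib[of "a * h powr \<alpha>"] by (rule mult_left_mono) simp
  qed
  also have "\<dots> = (a * h powr \<alpha>)\<^sup>2 * h * (arctan ((1 - x0) / h) - arctan ((0 - x0) / h))"
    by (simp add: algebra_simps)
  also have "\<dots> \<le> (a * h powr \<alpha>)\<^sup>2 * h * pi"
    using arctan_ubound[of "(1 - x0) / h"] arctan_lbound[of "(0 - x0) / h"] h
    by (intro mult_left_mono) (simp_all add: field_simps)
  also have "(a * h powr \<alpha>)\<^sup>2 * h = a\<^sup>2 * h powr (2 * \<alpha> + 1)"
    using h by (simp add: powr_add power_mult_distrib powr_power mult.commute)
  finally show ?thesis by simp
qed

lemma bump_lower_bound:
  assumes h: "h > 0" and x: "\<bar>x - x0\<bar> \<le> h"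
  shows "(bump \<alpha> a h x0 x)\<^sup>2 \<ge> a\<^sup>2 * h powr (2 * \<alpha>) / 4"
proof -
  have "\<bar>(x - x0) / h\<bar> \<le> 1" using h x by (simp add: abs_divide)
  then have "((x - x0) / h)\<^sup>2 \<le> 1" by (simp add: abs_square_le_1)
  then have "1 / 2 \<le> witch 0 ((x - x0) / h)" unfolding witch_0 by (intro divide_left_mono) (auto simp: add_pos_nonneg)
  then have "(1 / 2)\<^sup>2 \<le> (witch 0 ((x - x0) / h))\<^sup>2" by (rule power_mono) simp
  then have "(a * h powr \<alpha>)\<^sup>2 * (1 / 4) \<le> (a * h powr \<alpha>)\<^sup>2 * (witch 0 ((x - x0) / h))\<^sup>2"
    by (intro mult_left_mono) (auto simp: power2_eq_square)
  note le = this
  have eq: "(a * h powr \<alpha>)\<^sup>2 = a\<^sup>2 * h powr (2 * \<alpha>)"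
    using h by (simp add: power_mult_distrib powr_power mult.commute)
  show ?thesis
    using le unfolding eq bump_def power_mult_distrib[of "a * h powr \<alpha>"] by simp
qed

section \<open>Exponential moments of Brownian increments\<close>

definition dyadic_floor :: "nat \<Rightarrow> real \<Rightarrow> real" where
  "dyadic_floor m x = of_int \<lfloor>2 ^ m * x\<rfloor> / 2 ^ m"

text \<open>
The product sigma-algebra on path space contains only events that depend on countably many times.
A limit along dyadic times respects this and still recovers continuous paths.
\<close>

definition path_eval :: "(real \<Rightarrow> real) \<Rightarrow> real \<Rightarrow> real" where
  "path_eval z x = lim (\<lambda>m. z (clip01 (dyadic_floor m x)))"

lemma measurable_path_eval [measurable]:
  "(\<lambda>p. path_eval (fst p) (snd p)) \<in> borel_measurable (path_space \<Otimes>\<^sub>M borel)"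
proof -
  have "(\<lambda>p. fst p (clip01 (dyadic_floor m (snd p)))) \<in> borel_measurable (path_space \<Otimes>\<^sub>M borel)" for m
  proof -
    have f: "(\<lambda>p. fst p (clip01 (of_int i / 2 ^ m))) \<in> borel_measurable (path_space \<Otimes>\<^sub>M borel)" for i :: int
      by (rule measurable_compose[OF measurable_fst measurable_component_singleton]) (rule clip01_in)
    have g: "(\<lambda>p. \<lfloor>2 ^ m * snd p\<rfloor>) \<in> measurable (path_space \<Otimes>\<^sub>M (borel :: real measure)) (count_space UNIV)"
      by measurable
    show ?thesis
      unfolding dyadic_floor_def by (rule measurable_compose_countable[OF f g])
  qed
  then show ?thesis unfolding path_eval_def by (rule borel_measurable_lim_metric)
qed

lemma dyadic_floor_tendsto: "(\<lambda>m. dyadic_floor m x) \<longlonglongrightarrow> x"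
proof -
  have "norm (dyadic_floor m x - x) \<le> inverse (2 ^ m)" for m
  proof -
    have "\<bar>of_int \<lfloor>2 ^ m * x\<rfloor> - 2 ^ m * x\<bar> \<le> 1" by linarith
    then have "\<bar>of_int \<lfloor>2 ^ m * x\<rfloor> - 2 ^ m * x\<bar> / 2 ^ m \<le> 1 / 2 ^ m" by (intro divide_right_mono) auto
    moreover have "dyadic_floor m x - x = (of_int \<lfloor>2 ^ m * x\<rfloor> - 2 ^ m * x) / 2 ^ m"
      by (simp add: dyadic_floor_def diff_divide_distrib)
    ultimately show ?thesis by (simp add: abs_divide inverse_eq_divide)
  qed
  then have "(\<lambda>m. dyadic_floor m x - x) \<longlonglongrightarrow> 0"
    by (intro Lim_null_comparison[OF always_eventually LIMSEQ_inverse_realpow_zero[of 2]]) simp_all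
  then show ?thesis using LIM_zero_iff by blast
qed

lemma path_eval_continuous:
  assumes z: "continuous_on {0..1} z" and x: "x \<in> {0..1}"
  shows "path_eval z x = z x"
proof -
  have "(\<lambda>m. clip01 (dyadic_floor m x)) \<longlonglongrightarrow> clip01 x"
    using dyadic_floor_tendsto continuous_clip01[of UNIV] by (intro continuous_on_tendsto_compose[of UNIV clip01]) auto
  then have "(\<lambda>m. z (clip01 (dyadic_floor m x))) \<longlonglongrightarrow> z x"
    using x by (intro continuous_on_tendsto_compose[OF z]) (simp_all del: atLeastAtMost_iff)
  then show ?thesis unfolding path_eval_def by (rule limI)
qed

text \<open>
The exponential function on the extended half line. With it, exponential moments of integrals that
may be infinite can be stated and compared directly.
\<close>

definition eexp :: "ennreal \<Rightarrow> ennreal" where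
  "eexp s = (if s = \<top> then \<top> else ennreal (exp (enn2real s)))"

lemma measurable_eexp [measurable]: "eexp \<in> borel_measurable borel"
  unfolding eexp_def[abs_def] by measurable

lemma eexp_ennreal: "a \<ge> 0 \<Longrightarrow> eexp (ennreal a) = ennreal (exp a)"
  by (simp add: eexp_def)

lemma eexp_mono: "s \<le> t \<Longrightarrow> eexp s \<le> eexp t"
  by (cases s; cases t) (auto simp: eexp_def top_unique)

lemma le_eexp: "s \<le> eexp s"
proof (cases s)
  case (real r)
  have "r \<le> exp r" using exp_ge_add_one_self[of r] by linarith
  then show ?thesis using real by (simp add: eexp_def ennreal_leI)
qed (simp add: eexp_def)

lemma eexp_sum_ennreal:
  assumes "finite I" "\<And>i. i \<in> I \<Longrightarrow> a i \<ge> 0"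
  shows "eexp (\<Sum>i\<in>I. ennreal (a i)) = (\<Prod>i\<in>I. ennreal (exp (a i)))"
  using assms by (simp add: sum_ennreal eexp_ennreal sum_nonneg exp_sum prod_ennreal)

text \<open>
A sum is at most its number of terms times its largest term. This replaces the convexity of the
exponential function wherever constants do not matter.
\<close>

lemma eexp_sum_le:
  assumes J: "finite J" "J \<noteq> {}"
  shows "eexp (\<Sum>j\<in>J. s j) \<le> (\<Sum>j\<in>J. eexp (of_nat (card J) * s j))"
proof -
  have fin: "finite (s ` J)" "s ` J \<noteq> {}" using J by auto
  from Max_in[OF this] obtain i where "i \<in> J" "Max (s ` J) = s i" by auto
  then have i: "i \<in> J" "\<And>j. j \<in> J \<Longrightarrow> s j \<le> s i" using Max_ge[OF fin(1)] by auto
  have "eexp (\<Sum>j\<in>J. s j) \<le> eexp (of_nat (card J) * s i)"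
    using sum_bounded_above[of J s "s i"] i by (intro eexp_mono) auto
  also have "\<dots> \<le> (\<Sum>j\<in>J. eexp (of_nat (card J) * s j))"
    using i J by (intro member_le_sum) auto
  finally show ?thesis .
qed

text \<open>
The graph of the exponential function lies above its tangent at the mean.
\<close>

lemma eexp_Jensen:
  assumes "prob_space \<mu>" and [measurable]: "\<phi> \<in> borel_measurable \<mu>"
  shows "eexp (\<integral>\<^sup>+x. \<phi> x \<partial>\<mu>) \<le> (\<integral>\<^sup>+x. eexp (\<phi> x) \<partial>\<mu>)"
proof -
  interpret prob_space \<mu> by fact
  show ?thesis
  proof (cases "\<integral>\<^sup>+x. \<phi> x \<partial>\<mu>")
    case (real s)
    have "ennreal (exp s) + ennreal (exp s) * \<phi> x \<le> eexp (\<phi> x) + ennreal (exp s * s)" for x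
    proof (cases "\<phi> x")
      case (real p)
      have "exp s * (1 + (p - s)) \<le> exp s * exp (p - s)"
        using exp_ge_add_one_self[of "p - s"] by (intro mult_left_mono) auto
      then have "exp s + exp s * p \<le> exp p + exp s * s" by (simp add: exp_diff algebra_simps)
      then have "ennreal (exp s + exp s * p) \<le> ennreal (exp p + exp s * s)" by (rule ennreal_leI)
      then show ?thesis using real \<open>0 \<le> s\<close> by (simp add: eexp_ennreal ennreal_mult ennreal_plus)
    qed (simp add: eexp_def)
    then have "(\<integral>\<^sup>+x. ennreal (exp s) + ennreal (exp s) * \<phi> x \<partial>\<mu>) \<le> (\<integral>\<^sup>+x. eexp (\<phi> x) + ennreal (exp s * s) \<partial>\<mu>)"
      by (rule nn_integral_mono)
    then have "ennreal (exp s) + ennreal (exp s * s) \<le> (\<integral>\<^sup>+x. eexp (\<phi> x) \<partial>\<mu>) + ennreal (exp s * s)"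
      using real by (simp add: nn_integral_add nn_integral_cmult emeasure_space_1 ennreal_mult)
    then have "ennreal (exp s) \<le> (\<integral>\<^sup>+x. eexp (\<phi> x) \<partial>\<mu>)"
      by (simp add: ennreal_add_left_cancel_le add.commute)
    then show ?thesis using real by (simp add: eexp_ennreal)
  next
    case top
    have "(\<integral>\<^sup>+x. \<phi> x \<partial>\<mu>) \<le> (\<integral>\<^sup>+x. eexp (\<phi> x) \<partial>\<mu>)" by (intro nn_integral_mono le_eexp)
    then show ?thesis using top by (simp add: top_unique)
  qed
qed

text \<open>
At \<open>\<theta> = 3 / (8 \<sigma>^2)\<close> the integrand is twice the normal density with standard deviation
\<open>2 \<sigma>\<close>.
\<close>

lemma normal_exp_square_moment:
  assumes \<sigma>: "\<sigma> > 0" and \<theta>: "\<theta> * \<sigma>\<^sup>2 \<le> 3 / 8"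
  shows "(\<integral>\<^sup>+x. ennreal (normal_density 0 \<sigma> x) * ennreal (exp (\<theta> * x\<^sup>2)) \<partial>lborel) \<le> 2"
proof -
  have "(\<integral>\<^sup>+x. ennreal (normal_density 0 \<sigma> x) * ennreal (exp (\<theta> * x\<^sup>2)) \<partial>lborel) \<le> (\<integral>\<^sup>+x. 2 * ennreal (normal_density 0 (2 * \<sigma>) x) \<partial>lborel)"
  proof (rule nn_integral_mono)
    fix x :: real
    have "\<theta> * x\<^sup>2 - x\<^sup>2 / (2 * \<sigma>\<^sup>2) \<le> - x\<^sup>2 / (2 * (2 * \<sigma>)\<^sup>2)"
    proof -
      have "\<theta> \<le> 3 / (8 * \<sigma>\<^sup>2)" using \<theta> \<sigma> by (simp add: field_simps)
      then have "\<theta> * x\<^sup>2 \<le> 3 / (8 * \<sigma>\<^sup>2) * x\<^sup>2" by (intro mult_right_mono) auto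
      also have "3 / (8 * \<sigma>\<^sup>2) * x\<^sup>2 = x\<^sup>2 / (2 * \<sigma>\<^sup>2) - x\<^sup>2 / (2 * (2 * \<sigma>)\<^sup>2)"
        using \<sigma> by (simp add: power2_eq_square field_simps)
      finally show ?thesis by simp
    qed
    then have "exp (-x\<^sup>2 / (2 * \<sigma>\<^sup>2)) * exp (\<theta> * x\<^sup>2) \<le> exp (- x\<^sup>2 / (2 * (2 * \<sigma>)\<^sup>2))"
      by (simp add: mult_exp_exp)
    then have "1 / sqrt (2 * pi * \<sigma>\<^sup>2) * (exp (-x\<^sup>2 / (2 * \<sigma>\<^sup>2)) * exp (\<theta> * x\<^sup>2)) \<le> 1 / sqrt (2 * pi * \<sigma>\<^sup>2) * exp (- x\<^sup>2 / (2 * (2 * \<sigma>)\<^sup>2))"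
      by (intro mult_left_mono) auto
    moreover have eqs: "1 / sqrt (2 * pi * \<sigma>\<^sup>2) = 2 * (1 / sqrt (2 * pi * (2 * \<sigma>)\<^sup>2))"
    proof -
      have "2 * pi * (2 * \<sigma>)\<^sup>2 = 2\<^sup>2 * (2 * pi * \<sigma>\<^sup>2)" by (simp add: power2_eq_square)
      then have "sqrt (2 * pi * (2 * \<sigma>)\<^sup>2) = sqrt (2\<^sup>2) * sqrt (2 * pi * \<sigma>\<^sup>2)" by (simp only: real_sqrt_mult)
      then have "sqrt (2 * pi * (2 * \<sigma>)\<^sup>2) = 2 * sqrt (2 * pi * \<sigma>\<^sup>2)" by simp
      then show ?thesis by (simp only:)
    qed
    ultimately have "normal_density 0 \<sigma> x * exp (\<theta> * x\<^sup>2) \<le> 2 * normal_density 0 (2 * \<sigma>) x"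
      by (simp only: normal_density_def diff_zero mult.assoc eqs)
    then have "ennreal (normal_density 0 \<sigma> x * exp (\<theta> * x\<^sup>2)) \<le> ennreal (2 * normal_density 0 (2 * \<sigma>) x)"
      by (rule ennreal_leI)
    then show "ennreal (normal_density 0 \<sigma> x) * ennreal (exp (\<theta> * x\<^sup>2)) \<le> 2 * ennreal (normal_density 0 (2 * \<sigma>) x)"
      by (simp add: ennreal_mult)
  qed
  also have "\<dots> = 2 * 1"
    using \<sigma> prob_space.emeasure_space_1[OF prob_space_normal_density[of "2 * \<sigma>" 0]]
    by (simp add: nn_integral_cmult emeasure_density)
  finally show ?thesis by simp
qed

lemma prod_le_power_ennreal:
  fixes g :: "nat \<Rightarrow> ennreal"
  shows "(\<And>i. i < n \<Longrightarrow> g i \<le> C) \<Longrightarrow> (\<Prod>i<n. g i) \<le> C ^ n"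
  by (induction n) (auto simp: mult.commute[of C] intro!: mult_mono)

context std_brownian_motion begin

lemma increment_exp_moment:
  assumes st: "0 \<le> s" "s \<le> t" "t \<le> 1" and \<theta>: "\<theta> * (t - s) \<le> 3 / 8"
  shows "(\<integral>\<^sup>+\<omega>. ennreal (exp (\<theta> * (W t \<omega> - W s \<omega>)\<^sup>2)) \<partial>P) \<le> 2"
proof (cases "s = t")
  case True
  then show ?thesis by (simp add: emeasure_space_1)
next
  case False
  then have st': "s < t" using st by simp
  have "(\<integral>\<^sup>+\<omega>. ennreal (exp (\<theta> * (W t \<omega> - W s \<omega>)\<^sup>2)) \<partial>P)
     = (\<integral>\<^sup>+x. ennreal (normal_density 0 (sqrt (t - s)) x) * ennreal (exp (\<theta> * x\<^sup>2)) \<partial>lborel)"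
    by (rule distributed_nn_integral[OF normal_increments[OF st(1) st' st(3)], symmetric]) measurable
  also have "\<dots> \<le> 2" using st' \<theta> by (intro normal_exp_square_moment) auto
  finally show ?thesis .
qed

lemma increments_exp_moment:
  assumes t: "mono_on {..N} t" "0 \<le> t 0" "t N \<le> 1" and \<theta>: "\<theta> \<ge> 0" "\<And>i. i < N \<Longrightarrow> \<theta> * (t (Suc i) - t i) \<le> 3 / 8"
  shows "(\<integral>\<^sup>+\<omega>. eexp (\<Sum>i<N. ennreal (\<theta> * (W (t (Suc i)) \<omega> - W (t i) \<omega>)\<^sup>2)) \<partial>P) \<le> 2 ^ N"
proof -
  have ind: "indep_vars (\<lambda>_. borel) (\<lambda>i \<omega>. ennreal (exp (\<theta> * (W (t (Suc i)) \<omega> - W (t i) \<omega>)\<^sup>2))) {..<N}"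
    by (rule indep_vars_compose2[where X="\<lambda>i \<omega>. W (t (Suc i)) \<omega> - W (t i) \<omega>", OF indep_increments[OF t]]) auto
  have "(\<integral>\<^sup>+\<omega>. eexp (\<Sum>i<N. ennreal (\<theta> * (W (t (Suc i)) \<omega> - W (t i) \<omega>)\<^sup>2)) \<partial>P)
     = (\<integral>\<^sup>+\<omega>. (\<Prod>i<N. ennreal (exp (\<theta> * (W (t (Suc i)) \<omega> - W (t i) \<omega>)\<^sup>2))) \<partial>P)"
    using \<theta> by (subst eexp_sum_ennreal) auto
  also have "\<dots> = (\<Prod>i<N. \<integral>\<^sup>+\<omega>. ennreal (exp (\<theta> * (W (t (Suc i)) \<omega> - W (t i) \<omega>)\<^sup>2)) \<partial>P)"
    by (rule indep_vars_nn_integral[OF _ ind]) auto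
  also have "\<dots> \<le> 2 ^ N"
  proof (rule prod_le_power_ennreal)
    fix i assume i: "i < N"
    have "0 \<le> t i" "t i \<le> t (Suc i)" "t (Suc i) \<le> 1"
      using mono_onD[OF t(1), of 0 i] mono_onD[OF t(1), of i "Suc i"] mono_onD[OF t(1), of "Suc i" N] t i by auto
    then show "(\<integral>\<^sup>+\<omega>. ennreal (exp (\<theta> * (W (t (Suc i)) \<omega> - W (t i) \<omega>)\<^sup>2)) \<partial>P) \<le> 2"
      using \<theta>(2)[OF i] by (intro increment_exp_moment) auto
  qed
  finally show ?thesis .
qed

text \<open>
A jointly measurable version of the Brownian motion.
\<close>

definition brownian_path :: "'w \<Rightarrow> real \<Rightarrow> real" where
  "brownian_path \<omega> = path_eval (\<lambda>t\<in>{0..1}. W t \<omega>)"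

lemma measurable_brownian_path [measurable]:
  "(\<lambda>p. brownian_path (fst p) (snd p)) \<in> borel_measurable (P \<Otimes>\<^sub>M borel)"
proof -
  have "(\<lambda>\<omega>. \<lambda>t\<in>{0..1}. W t \<omega>) \<in> measurable P path_space"
    by (intro measurable_restrict measurable_W)
  then have "(\<lambda>p. ((\<lambda>t\<in>{0..1}. W t (fst p)), snd p)) \<in> measurable (P \<Otimes>\<^sub>M borel) (path_space \<Otimes>\<^sub>M borel)"
    by (intro measurable_Pair measurable_compose[OF measurable_fst] measurable_snd)
  from measurable_compose[OF this measurable_path_eval] show ?thesis
    by (simp add: brownian_path_def)
qed

lemma AE_brownian_path: "AE \<omega> in P. \<forall>x\<in>{0..1}. brownian_path \<omega> x = W x \<omega>"
  using continuous_paths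
proof eventually_elim
  fix \<omega> assume "continuous_on {0..1} (\<lambda>t. W t \<omega>)"
  then have "continuous_on {0..1} (\<lambda>t\<in>{0..1}. W t \<omega>)" by (rule continuous_on_eq) auto
  then show "\<forall>x\<in>{0..1}. brownian_path \<omega> x = W x \<omega>"
    unfolding brownian_path_def by (auto simp: path_eval_continuous)
qed

text \<open>
Cut the interval into \<open>N\<close> blocks of length \<open>l\<close>. For a fixed offset \<open>u\<close> within a block, the
increments of length \<open>l\<close> that start at offset \<open>u\<close> in each block are independent, so their
exponential moments multiply. Jensen's inequality averages over \<open>u\<close>.
\<close>

lemma increment_energy_exp_moment:
  assumes ab: "0 \<le> a" "a \<le> b" "b + l \<le> 1" and l: "l > 0" and N: "b - a \<le> real N * l" "N > 0"
  shows "(\<integral>\<^sup>+\<omega>. eexp (\<integral>\<^sup>+x\<in>{a..b}. ennreal (3/8 * ((brownian_path \<omega> (x + l) - brownian_path \<omega> x) / l)\<^sup>2) \<partial>lborel) \<partial>P) \<le> 2 ^ N"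
proof -
  define q where "q \<omega> x = ennreal (3/8 * ((brownian_path \<omega> (x + l) - brownian_path \<omega> x) / l)\<^sup>2) * indicator {a..b} x" for \<omega> x
  have bp: "(\<lambda>p. brownian_path (fst p) (f (snd p))) \<in> borel_measurable (P \<Otimes>\<^sub>M borel)" if [measurable]: "f \<in> borel_measurable borel" for f :: "real \<Rightarrow> real"
  proof -
    have "(\<lambda>p. (fst p, f (snd p))) \<in> measurable (P \<Otimes>\<^sub>M borel) (P \<Otimes>\<^sub>M borel)" by measurable
    from measurable_compose[OF this measurable_brownian_path] show ?thesis by simp
  qed
  have qm: "(\<lambda>p. q (fst p) (f (snd p))) \<in> borel_measurable (P \<Otimes>\<^sub>M borel)" if [measurable]: "f \<in> borel_measurable borel" for f :: "real \<Rightarrow> real"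
  proof -
    have [measurable]: "(\<lambda>p. brownian_path (fst p) (f (snd p) + l)) \<in> borel_measurable (P \<Otimes>\<^sub>M borel)"
      by (rule bp) measurable
    note bp[OF that, measurable]
    show ?thesis unfolding q_def by measurable
  qed
  have qm1: "(\<lambda>x. q \<omega> (f x)) \<in> borel_measurable borel" if "\<omega> \<in> space P" "f \<in> borel_measurable borel" for \<omega> and f :: "real \<Rightarrow> real"
    using measurable_compose_Pair1[OF that(1) qm[OF that(2)]] by simp
  \<comment> \<open>the uniform distribution of the offset, on the interval from 0 to l\<close>
  define \<mu> where "\<mu> = window_measure (l / 2) (l / 2)"
  interpret \<mu>: prob_space \<mu> unfolding \<mu>_def using l by (intro prob_space_window_measure) auto
  have s\<mu>[measurable_cong]: "sets \<mu> = sets borel" by (simp add: \<mu>_def)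
  interpret pair_sigma_finite P \<mu> ..
  define Q where "Q \<omega> u = (\<Sum>i<N. ennreal l * q \<omega> (a + real i * l + u))" for \<omega> u
  have Qm[measurable]: "(\<lambda>p. Q (fst p) (snd p)) \<in> borel_measurable (P \<Otimes>\<^sub>M borel)"
    unfolding Q_def by (intro borel_measurable_sum borel_measurable_times_ennreal borel_measurable_const qm) measurable
  have Qm'[measurable]: "(\<lambda>p. Q (fst p) (snd p)) \<in> borel_measurable (P \<Otimes>\<^sub>M \<mu>)"
    using Qm by (simp cong: measurable_cong_sets sets_pair_measure_cong)
  have le: "(\<integral>\<^sup>+x. q \<omega> x \<partial>lborel) \<le> (\<integral>\<^sup>+u. Q \<omega> u \<partial>\<mu>)" if \<omega>: "\<omega> \<in> space P" for \<omega>
  proof -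
    note qm1[OF \<omega>, measurable]
    have [measurable]: "q \<omega> \<in> borel_measurable borel" using qm1[OF \<omega>, of "\<lambda>x. x"] by simp
    have "(\<integral>\<^sup>+x. q \<omega> x \<partial>lborel) \<le> (\<integral>\<^sup>+x. (\<Sum>i<N. q \<omega> x * indicator {0..l} (x - (a + real i * l))) \<partial>lborel)"
    proof (rule nn_integral_mono)
      fix x :: real
      show "q \<omega> x \<le> (\<Sum>i<N. q \<omega> x * indicator {0..l} (x - (a + real i * l)))"
      proof (cases "x \<in> {a..b}")
        case True
        define i where "i = min (nat \<lfloor>(x - a) / l\<rfloor>) (N - 1)"
        have i: "i < N" using N by (auto simp: i_def)
        have fl: "real (nat \<lfloor>(x - a) / l\<rfloor>) \<le> (x - a) / l" "(x - a) / l < real (nat \<lfloor>(x - a) / l\<rfloor>) + 1"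
          using True l by (auto intro!: of_nat_floor)
        have "real i \<le> (x - a) / l" using fl(1) by (simp add: i_def)
        moreover have "(x - a) / l \<le> real i + 1"
        proof (cases "nat \<lfloor>(x - a) / l\<rfloor> \<le> N - 1")
          case False
          have "(x - a) / l \<le> real N" using True N l by (simp add: divide_le_eq)
          then show ?thesis using False N by (simp add: i_def of_nat_diff)
        qed (use fl(2) in \<open>simp add: i_def\<close>)
        ultimately have "x - (a + real i * l) \<in> {0..l}" using l by (simp add: field_simps)
        then have "q \<omega> x = q \<omega> x * indicator {0..l} (x - (a + real i * l))" by simp
        also have "\<dots> \<le> (\<Sum>i<N. q \<omega> x * indicator {0..l} (x - (a + real i * l)))"
          using i by (intro member_le_sum) auto
        finally show ?thesis .
      qed (simp add: q_def)
    qed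
    also have "\<dots> = (\<Sum>i<N. \<integral>\<^sup>+x. q \<omega> x * indicator {0..l} (x - (a + real i * l)) \<partial>lborel)"
      by (rule nn_integral_sum) measurable
    also have "\<dots> = (\<Sum>i<N. \<integral>\<^sup>+u. q \<omega> (a + real i * l + u) * indicator {0..l} u \<partial>lborel)"
    proof (rule sum.cong[OF refl])
      fix i
      show "(\<integral>\<^sup>+x. q \<omega> x * indicator {0..l} (x - (a + real i * l)) \<partial>lborel) = (\<integral>\<^sup>+u. q \<omega> (a + real i * l + u) * indicator {0..l} u \<partial>lborel)"
        by (subst nn_integral_real_affine[where c=1 and t="a + real i * l"]) auto
    qed
    also have "\<dots> = (\<Sum>i<N. \<integral>\<^sup>+u. ennreal l * q \<omega> (a + real i * l + u) \<partial>\<mu>)"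
    proof (rule sum.cong[OF refl])
      fix i
      have [measurable]: "(\<lambda>u. q \<omega> (a + real i * l + u)) \<in> borel_measurable borel"
        by (rule qm1[OF \<omega>]) measurable
      have "(\<integral>\<^sup>+u. ennreal l * q \<omega> (a + real i * l + u) \<partial>\<mu>) = ennreal l * (\<integral>\<^sup>+u. q \<omega> (a + real i * l + u) \<partial>\<mu>)"
        by (rule nn_integral_cmult) measurable
      also have "\<dots> = ennreal l * (ennreal (1 / l) * (\<integral>\<^sup>+u. q \<omega> (a + real i * l + u) * indicator {0..l} u \<partial>lborel))"
        unfolding \<mu>_def using l by (subst nn_integral_window_measure) auto
      also have "\<dots> = (\<integral>\<^sup>+u. q \<omega> (a + real i * l + u) * indicator {0..l} u \<partial>lborel)"
        using l by (simp add: mult.assoc[symmetric] ennreal_mult[symmetric])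
      finally show "(\<integral>\<^sup>+u. q \<omega> (a + real i * l + u) * indicator {0..l} u \<partial>lborel) = (\<integral>\<^sup>+u. ennreal l * q \<omega> (a + real i * l + u) \<partial>\<mu>)" ..
    qed
    also have "\<dots> = (\<integral>\<^sup>+u. Q \<omega> u \<partial>\<mu>)"
      unfolding Q_def by (rule nn_integral_sum[symmetric]) (intro borel_measurable_times_ennreal borel_measurable_const qm1[OF \<omega>, unfolded measurable_cong_sets[OF s\<mu>[symmetric] refl]], measurable)
    finally show ?thesis .
  qed
  have fixu: "(\<integral>\<^sup>+\<omega>. eexp (Q \<omega> u) \<partial>P) \<le> 2 ^ N" if u: "u \<in> {0..l}" for u
  proof -
    \<comment> \<open>stopping at b + l keeps all times inside the unit interval and only shortens increments\<close>
    define t where "t i = min (a + real i * l + u) (b + l)" for i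
    have "mono_on {..N} t"
    proof (rule mono_onI)
      fix r s :: nat assume "r \<le> s"
      then have "real r * l \<le> real s * l" using l by (intro mult_right_mono) auto
      then show "t r \<le> t s" by (auto simp: t_def min_def)
    qed
    moreover have "0 \<le> t 0" "t N \<le> 1" using ab l u by (auto simp: t_def)
    moreover have "3 / (8 * l) * (t (Suc i) - t i) \<le> 3 / 8" for i
    proof -
      have "t (Suc i) - t i \<le> l" using l by (auto simp: t_def min_def algebra_simps)
      then show ?thesis using l by (simp add: field_simps)
    qed
    ultimately have 1: "(\<integral>\<^sup>+\<omega>. eexp (\<Sum>i<N. ennreal (3 / (8 * l) * (W (t (Suc i)) \<omega> - W (t i) \<omega>)\<^sup>2)) \<partial>P) \<le> 2 ^ N"
      using l by (intro increments_exp_moment) auto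
    have "(\<integral>\<^sup>+\<omega>. eexp (Q \<omega> u) \<partial>P) \<le> (\<integral>\<^sup>+\<omega>. eexp (\<Sum>i<N. ennreal (3 / (8 * l) * (W (t (Suc i)) \<omega> - W (t i) \<omega>)\<^sup>2)) \<partial>P)"
    proof (rule nn_integral_mono_AE, use AE_brownian_path in eventually_elim)
      fix \<omega> assume bw: "\<forall>x\<in>{0..1}. brownian_path \<omega> x = W x \<omega>"
      show "eexp (Q \<omega> u) \<le> eexp (\<Sum>i<N. ennreal (3 / (8 * l) * (W (t (Suc i)) \<omega> - W (t i) \<omega>)\<^sup>2))"
        unfolding Q_def
      proof (intro eexp_mono sum_mono)
        fix i
        let ?y = "a + real i * l + u"
        show "ennreal l * q \<omega> ?y \<le> ennreal (3 / (8 * l) * (W (t (Suc i)) \<omega> - W (t i) \<omega>)\<^sup>2)"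
        proof (cases "?y \<in> {a..b}")
          case True
          then have ti: "t i = ?y" "t (Suc i) = ?y + l" "?y \<in> {0..1}" "?y + l \<in> {0..1}"
            using l ab by (auto simp: t_def min_def algebra_simps)
          have "ennreal l * q \<omega> ?y = ennreal (l * (3/8 * ((W (?y + l) \<omega> - W ?y \<omega>) / l)\<^sup>2))"
            unfolding q_def using True l bw[rule_format, OF ti(3)] bw[rule_format, OF ti(4)] by (simp add: ennreal_mult[symmetric])
          also have "l * (3/8 * ((W (?y + l) \<omega> - W ?y \<omega>) / l)\<^sup>2) = 3 / (8 * l) * (W (t (Suc i)) \<omega> - W (t i) \<omega>)\<^sup>2"
            unfolding ti using l by (simp add: power2_eq_square field_simps)
          finally show ?thesis by simp
        qed (simp add: q_def)
      qed
    qed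
    then show ?thesis using 1 by (rule order.trans)
  qed
  have "(\<integral>\<^sup>+\<omega>. eexp (\<integral>\<^sup>+x. q \<omega> x \<partial>lborel) \<partial>P) \<le> (\<integral>\<^sup>+\<omega>. \<integral>\<^sup>+u. eexp (Q \<omega> u) \<partial>\<mu> \<partial>P)"
  proof (rule nn_integral_mono)
    fix \<omega> assume \<omega>: "\<omega> \<in> space P"
    have "Q \<omega> \<in> borel_measurable \<mu>"
      using measurable_compose_Pair1[OF \<omega> Qm'] by simp
    from order.trans[OF eexp_mono[OF le[OF \<omega>]] eexp_Jensen[OF \<mu>.prob_space_axioms this]]
    show "eexp (\<integral>\<^sup>+x. q \<omega> x \<partial>lborel) \<le> (\<integral>\<^sup>+u. eexp (Q \<omega> u) \<partial>\<mu>)" .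
  qed
  also have "\<dots> = (\<integral>\<^sup>+u. \<integral>\<^sup>+\<omega>. eexp (Q \<omega> u) \<partial>P \<partial>\<mu>)"
    by (rule Fubini'[symmetric]) (use measurable_compose[OF Qm' measurable_eexp] in \<open>simp add: case_prod_beta'\<close>)
  also have "\<dots> \<le> (\<integral>\<^sup>+u. 2 ^ N \<partial>\<mu>)"
  proof (rule nn_integral_mono_AE)
    have "AE u in \<mu>. u \<in> {l/2 - l/2..l/2 + l/2}"
      unfolding \<mu>_def using l by (intro AE_window_measure) simp
    then show "AE u in \<mu>. (\<integral>\<^sup>+\<omega>. eexp (Q \<omega> u) \<partial>P) \<le> 2 ^ N"
    proof eventually_elim
      fix u assume "u \<in> {l/2 - l/2..l/2 + l/2}"
      then have "u \<in> {0..l}" by simp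
      then show "(\<integral>\<^sup>+\<omega>. eexp (Q \<omega> u) \<partial>P) \<le> 2 ^ N" by (rule fixu)
    qed
  qed
  also have "\<dots> = 2 ^ N" by (simp add: \<mu>.emeasure_space_1)
  finally show ?thesis by (simp add: q_def)
qed

end

section \<open>Exponential moments of the smoothed noise\<close>

text \<open>
Steps are taken towards the centre \<open>x0\<close>, so that a kernel placed at any point of the unit interval
stays inside the interval once \<open>(k + 1) h\<close> is at most the distance of \<open>x0\<close> from its end points.
\<close>

definition inward :: "real \<Rightarrow> real \<Rightarrow> real \<Rightarrow> real" where
  "inward x0 h x = (if x \<le> x0 then h else - h)"

lemma measurable_inward [measurable]: "inward x0 h \<in> borel_measurable borel"
  unfolding inward_def by measurable

definition smooth :: "nat \<Rightarrow> real \<Rightarrow> real \<Rightarrow> (real \<Rightarrow> real) \<Rightarrow> real \<Rightarrow> real" where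
  "smooth k h x0 y x = kernel_est k (inward x0 h x) y x"

definition slope_sq :: "real \<Rightarrow> real \<Rightarrow> nat \<Rightarrow> (real \<Rightarrow> real) \<Rightarrow> real \<Rightarrow> real" where
  "slope_sq h x0 j y x = ((y (x + real j * inward x0 h x) - y x) / (real j * h))\<^sup>2"

text \<open>
The loss in passing from squares of kernel estimates to squares of single difference quotients:
\<open>4 ^ (k + 1)\<close> bounds the squared weights, one factor \<open>k + 1\<close> comes from the Cauchy-Schwarz
inequality and the other one from splitting the exponential of a sum.
\<close>

definition kernel_const :: "nat \<Rightarrow> real" where
  "kernel_const k = (real k + 1)\<^sup>2 * 4 ^ (k + 1)"

lemma kernel_const_pos: "kernel_const k > 0"
  by (simp add: kernel_const_def add_pos_nonneg)

lemma smooth_sq_le: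
  "(smooth k h x0 y x)\<^sup>2 \<le> (real k + 1) * 4 ^ (k + 1) * (\<Sum>j=1..k+1. slope_sq h x0 j y x)"
proof -
  let ?d = "\<lambda>j. (y (x + real j * inward x0 h x) - y x) / (real j * inward x0 h x)"
  let ?w = "kernel_weight k"
  have sq: "(?d j)\<^sup>2 = slope_sq h x0 j y x" for j
    by (simp add: slope_sq_def inward_def power_divide power_mult_distrib)
  have "(smooth k h x0 y x)\<^sup>2 \<le> (\<Sum>j=1..k+1. (?w j * ?d j)\<^sup>2) * real (card {1..k+1})"
    unfolding smooth_def kernel_est_def by (rule sum_squared_le_sum_of_squares)
  also have "(\<Sum>j=1..k+1. (?w j * ?d j)\<^sup>2) \<le> (\<Sum>j=1..k+1. 4 ^ (k + 1) * slope_sq h x0 j y x)"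
  proof (rule sum_mono)
    fix j
    have "real ((k+1) choose j) \<le> real (2 ^ (k+1))"
      by (intro of_nat_mono binomial_le_pow2)
    then have "(real ((k+1) choose j))\<^sup>2 \<le> (2 ^ (k+1))\<^sup>2"
      by (intro power_mono) (simp_all del: power_Suc)
    also have "((2::real) ^ (k+1))\<^sup>2 = 4 ^ (k+1)" by (simp add: power2_eq_square power_mult_distrib[symmetric] del: power_Suc power_add)
    finally have "(?w j)\<^sup>2 \<le> 4 ^ (k+1)" by (simp only: abs_kernel_weight[symmetric] power2_abs)
    then have "(?w j)\<^sup>2 * (?d j)\<^sup>2 \<le> 4 ^ (k+1) * (?d j)\<^sup>2" by (rule mult_right_mono) simp
    then show "(?w j * ?d j)\<^sup>2 \<le> 4 ^ (k+1) * slope_sq h x0 j y x"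
      by (simp only: sq power_mult_distrib)
  qed
  finally have "(smooth k h x0 y x)\<^sup>2 \<le> (\<Sum>j=1..k+1. 4 ^ (k + 1) * slope_sq h x0 j y x) * real (card {1..k+1})"
    by (simp del: power_Suc sum.cl_ivl_Suc)
  also have "\<dots> = (real k + 1) * 4 ^ (k + 1) * (\<Sum>j=1..k+1. slope_sq h x0 j y x)"
    unfolding sum_distrib_left[symmetric] by simp
  finally show ?thesis .
qed

context std_brownian_motion begin

lemma measurable_brownian_path_comp [measurable (raw)]:
  assumes f: "f \<in> measurable N borel" and w: "w \<in> measurable N P"
  shows "(\<lambda>p. brownian_path (w p) (f p)) \<in> borel_measurable N"
  using measurable_compose[OF measurable_Pair[OF w f] measurable_brownian_path] by simp

lemma measurable_slope_sq [measurable]: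
  "(\<lambda>p. slope_sq h x0 j (brownian_path (fst p)) (snd p)) \<in> borel_measurable (P \<Otimes>\<^sub>M borel)"
  unfolding slope_sq_def by measurable

lemma measurable_noise [measurable]:
  "(\<lambda>p. smooth k h x0 (brownian_path (fst p)) (snd p)) \<in> borel_measurable (P \<Otimes>\<^sub>M borel)"
  unfolding smooth_def kernel_est_def by measurable

text \<open>
A difference quotient with step \<open>j h\<close> is normal with variance \<open>1 / (j h)\<close>, which is at most
\<open>1 / h\<close>.
\<close>

lemma slope_sq_exp_moment:
  assumes x: "x \<in> {0..1}" and h: "h > 0" "(real k + 1) * h \<le> x0" "(real k + 1) * h \<le> 1 - x0" and j: "j \<in> {1..k+1}"
  shows "(\<integral>\<^sup>+\<omega>. eexp (ennreal (3 * h / 8 * slope_sq h x0 j (brownian_path \<omega>) x)) \<partial>P) \<le> 2"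
proof -
  have "real j \<le> real k + 1" using j by auto
  then have jh: "real j * h > 0" "real j * h \<le> (real k + 1) * h" using j h(1) mult_right_mono[of "real j" "real k + 1" h] by auto
  define s where "s = (if x \<le> x0 then x else x - real j * h)"
  define t where "t = (if x \<le> x0 then x + real j * h else x)"
  have st: "0 \<le> s" "s \<le> t" "t \<le> 1" "t - s = real j * h" 
  proof -
    have "0 \<le> x0 - real j * h" "x0 + real j * h \<le> 1" using h jh by linarith+
    then show "0 \<le> s" "s \<le> t" "t \<le> 1" "t - s = real j * h"
      using x jh(1) by (cases "x \<le> x0"; simp add: s_def t_def)+
  qed
  define \<theta> where "\<theta> = 3 * h / 8 / (real j * h)\<^sup>2"
  have "\<theta> * (t - s) = 3 / 8 / real j" unfolding \<theta>_def st using jh h by (simp add: power2_eq_square)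
  also have "\<dots> \<le> 3 / 8" using j by (simp add: field_simps)
  finally have \<theta>: "\<theta> * (t - s) \<le> 3 / 8" .
  have "(\<integral>\<^sup>+\<omega>. eexp (ennreal (3 * h / 8 * slope_sq h x0 j (brownian_path \<omega>) x)) \<partial>P)
     = (\<integral>\<^sup>+\<omega>. ennreal (exp (\<theta> * (W t \<omega> - W s \<omega>)\<^sup>2)) \<partial>P)"
  proof (rule nn_integral_cong_AE, use AE_brownian_path in eventually_elim)
    fix \<omega> assume bw: "\<forall>x\<in>{0..1}. brownian_path \<omega> x = W x \<omega>"
    have "slope_sq h x0 j (brownian_path \<omega>) x = ((brownian_path \<omega> t - brownian_path \<omega> s) / (real j * h))\<^sup>2"
      by (simp add: slope_sq_def inward_def s_def t_def power_divide power2_commute)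
    also have "\<dots> = (W t \<omega> - W s \<omega>)\<^sup>2 / (real j * h)\<^sup>2"
      using bw st by (simp add: power_divide)
    finally have "3 * h / 8 * slope_sq h x0 j (brownian_path \<omega>) x = \<theta> * (W t \<omega> - W s \<omega>)\<^sup>2"
      by (simp add: \<theta>_def)
    moreover have "0 \<le> \<theta> * (W t \<omega> - W s \<omega>)\<^sup>2" using h by (simp add: \<theta>_def)
    ultimately show "eexp (ennreal (3 * h / 8 * slope_sq h x0 j (brownian_path \<omega>) x)) = ennreal (exp (\<theta> * (W t \<omega> - W s \<omega>)\<^sup>2))"
      by (simp add: eexp_ennreal)
  qed
  also have "\<dots> \<le> 2" by (rule increment_exp_moment[OF st(1-3) \<theta>])
  finally show ?thesis .
qed

text \<open>
Jensen's inequality under the averaging measure reduces the claim to single points.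
\<close>

lemma slope_sq_mean_exp_moment:
  assumes \<mu>: "prob_space \<mu>" "sets \<mu> = sets borel" "AE x in \<mu>. x \<in> {0..1}"
    and h: "h > 0" "(real k + 1) * h \<le> x0" "(real k + 1) * h \<le> 1 - x0" and j: "j \<in> {1..k+1}"
  shows "(\<integral>\<^sup>+\<omega>. eexp (\<integral>\<^sup>+x. ennreal (3 * h / 8 * slope_sq h x0 j (brownian_path \<omega>) x) \<partial>\<mu>) \<partial>P) \<le> 2"
proof -
  interpret \<mu>: prob_space \<mu> by fact
  interpret pair_sigma_finite P \<mu> ..
  note [measurable_cong] = \<mu>(2)
  define Q where "Q \<omega> x = ennreal (3 * h / 8 * slope_sq h x0 j (brownian_path \<omega>) x)" for \<omega> x
  have Qm: "(\<lambda>p. Q (fst p) (snd p)) \<in> borel_measurable (P \<Otimes>\<^sub>M \<mu>)"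
    unfolding Q_def by measurable
  have "(\<integral>\<^sup>+\<omega>. eexp (\<integral>\<^sup>+x. Q \<omega> x \<partial>\<mu>) \<partial>P) \<le> (\<integral>\<^sup>+\<omega>. \<integral>\<^sup>+x. eexp (Q \<omega> x) \<partial>\<mu> \<partial>P)"
  proof (rule nn_integral_mono)
    fix \<omega> assume \<omega>: "\<omega> \<in> space P"
    have "Q \<omega> \<in> borel_measurable \<mu>" using measurable_compose_Pair1[OF \<omega> Qm] by simp
    then show "eexp (\<integral>\<^sup>+x. Q \<omega> x \<partial>\<mu>) \<le> (\<integral>\<^sup>+x. eexp (Q \<omega> x) \<partial>\<mu>)"
      by (rule eexp_Jensen[OF \<mu>(1)])
  qed
  also have "\<dots> = (\<integral>\<^sup>+x. \<integral>\<^sup>+\<omega>. eexp (Q \<omega> x) \<partial>P \<partial>\<mu>)"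
    by (rule Fubini'[symmetric]) (use measurable_compose[OF Qm measurable_eexp] in \<open>simp add: case_prod_beta'\<close>)
  also have "\<dots> \<le> (\<integral>\<^sup>+x. 2 \<partial>\<mu>)"
    by (rule nn_integral_mono_AE, use \<mu>(3) in eventually_elim) (unfold Q_def, rule slope_sq_exp_moment[OF _ h j])
  also have "\<dots> = 2" by (simp add: \<mu>.emeasure_space_1)
  finally show ?thesis by (simp add: Q_def)
qed

text \<open>
Compared with the pointwise bound, the exponent is larger by the factor \<open>c / h\<close>, at the price of
a moment that grows exponentially in the number of blocks. The two halves of the window, where the
kernels look in opposite directions, are treated separately; translating the right half by \<open>l\<close>
turns its backward increments into forward ones.
\<close>

lemma slope_sq_window_exp_moment:
  assumes c: "c > 0" "{x0 - c..x0 + c} \<subseteq> {0..1}" and N: "c \<le> real N * h" "N > 0"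
    and h: "h > 0" "(real k + 1) * h \<le> x0" "(real k + 1) * h \<le> 1 - x0" and j: "j \<in> {1..k+1}"
  shows "(\<integral>\<^sup>+\<omega>. eexp (\<integral>\<^sup>+x. ennreal (3 * c / 8 * slope_sq h x0 j (brownian_path \<omega>) x) \<partial>window_measure x0 c) \<partial>P) \<le> 2 * 2 ^ N"
proof -
  define l where "l = real j * h"
  have "real j \<le> real k + 1" "1 \<le> real j" using j by auto
  then have l: "l > 0" "l \<le> (real k + 1) * h" "h \<le> l"
    using h(1) mult_right_mono[of "real j" "real k + 1" h] mult_right_mono[of 1 "real j" h] by (auto simp: l_def)
  define q where "q \<omega> x = ((brownian_path \<omega> (x + l) - brownian_path \<omega> x) / l)\<^sup>2" for \<omega> x
  have cw: "0 \<le> x0 - c" "x0 + c \<le> 1" using c by auto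
  have Nl: "c \<le> real N * l" using N l mult_left_mono[of h l "real N"] by linarith
  define A where "A \<omega> = (\<integral>\<^sup>+x\<in>{x0 - c..x0}. ennreal (3/8 * q \<omega> x) \<partial>lborel)" for \<omega>
  define B where "B \<omega> = (\<integral>\<^sup>+x\<in>{x0 - l..x0 + c - l}. ennreal (3/8 * q \<omega> x) \<partial>lborel)" for \<omega>
  have A: "(\<integral>\<^sup>+\<omega>. eexp (A \<omega>) \<partial>P) \<le> 2 ^ N"
    unfolding A_def q_def using cw l h Nl N c by (intro increment_energy_exp_moment) auto
  have B: "(\<integral>\<^sup>+\<omega>. eexp (B \<omega>) \<partial>P) \<le> 2 ^ N"
    unfolding B_def q_def using cw l h Nl N c by (intro increment_energy_exp_moment) auto
  have qm[measurable]: "(\<lambda>p. q (fst p) (snd p)) \<in> borel_measurable (P \<Otimes>\<^sub>M borel)"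
    unfolding q_def by measurable
  have Am[measurable]: "A \<in> borel_measurable P" and Bm[measurable]: "B \<in> borel_measurable P"
    unfolding A_def B_def by measurable
  have main: "(\<integral>\<^sup>+x. ennreal (3 * c / 8 * slope_sq h x0 j (brownian_path \<omega>) x) \<partial>window_measure x0 c) \<le> ennreal (1/2) * A \<omega> + ennreal (1/2) * B \<omega>"
    if \<omega>: "\<omega> \<in> space P" for \<omega>
  proof -
    have [measurable]: "q \<omega> \<in> borel_measurable borel" using measurable_compose_Pair1[OF \<omega> qm] by simp
    have [measurable]: "slope_sq h x0 j (brownian_path \<omega>) \<in> borel_measurable borel" using measurable_compose_Pair1[OF \<omega> measurable_slope_sq] by simp
    have "(\<integral>\<^sup>+x. ennreal (3 * c / 8 * slope_sq h x0 j (brownian_path \<omega>) x) \<partial>window_measure x0 c)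
      = ennreal (1 / (2 * c)) * (\<integral>\<^sup>+x\<in>{x0 - c..x0 + c}. ennreal (3 * c / 8 * slope_sq h x0 j (brownian_path \<omega>) x) \<partial>lborel)"
      using c by (intro nn_integral_window_measure) auto
    also have "\<dots> = (\<integral>\<^sup>+x. ennreal (1 / (2 * c)) * (ennreal (3 * c / 8 * slope_sq h x0 j (brownian_path \<omega>) x) * indicator {x0 - c..x0 + c} x) \<partial>lborel)"
      by (rule nn_integral_cmult[symmetric]) measurable
    also have "\<dots> \<le> (\<integral>\<^sup>+x. ennreal (1/2) * (ennreal (3/8 * q \<omega> x) * indicator {x0 - c..x0} x) + ennreal (1/2) * (ennreal (3/8 * q \<omega> (- l + 1 * x)) * indicator {x0 - l..x0 + c - l} (- l + 1 * x)) \<partial>lborel)"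
    proof (rule nn_integral_mono)
      fix x :: real
      have e: "ennreal (1 / (2 * c)) * ennreal (3 * c / 8 * r) = ennreal (1/2) * ennreal (3/8 * r)" for r
        using c by (subst (1 2) ennreal_mult'[symmetric]) auto
      show "ennreal (1 / (2 * c)) * (ennreal (3 * c / 8 * slope_sq h x0 j (brownian_path \<omega>) x) * indicator {x0 - c..x0 + c} x)
        \<le> ennreal (1/2) * (ennreal (3/8 * q \<omega> x) * indicator {x0 - c..x0} x) + ennreal (1/2) * (ennreal (3/8 * q \<omega> (- l + 1 * x)) * indicator {x0 - l..x0 + c - l} (- l + 1 * x))"
      proof (cases "x \<in> {x0 - c..x0 + c}")
        case True
        show ?thesis
        proof (cases "x \<le> x0")
          case le: True
          then have "slope_sq h x0 j (brownian_path \<omega>) x = q \<omega> x" by (simp add: slope_sq_def q_def inward_def l_def)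
          then show ?thesis using True le e by (auto simp: mult.assoc[symmetric] intro: order.trans[OF _ le_add1])
        next
          case False
          then have "slope_sq h x0 j (brownian_path \<omega>) x = q \<omega> (- l + 1 * x)"
            by (simp add: slope_sq_def q_def inward_def l_def power_divide power2_commute)
          then show ?thesis using True False e by (auto simp: mult.assoc[symmetric])
        qed
      qed simp
    qed
    also have "\<dots> = ennreal (1/2) * A \<omega> + ennreal (1/2) * (\<integral>\<^sup>+x. ennreal (3/8 * q \<omega> (- l + 1 * x)) * indicator {x0 - l..x0 + c - l} (- l + 1 * x) \<partial>lborel)"
      unfolding A_def by (subst nn_integral_add) (simp_all add: nn_integral_cmult)
    also have "(\<integral>\<^sup>+x. ennreal (3/8 * q \<omega> (- l + 1 * x)) * indicator {x0 - l..x0 + c - l} (- l + 1 * x) \<partial>lborel) = B \<omega>"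
      unfolding B_def by (subst (2) nn_integral_real_affine[where c=1 and t="- l"]) simp_all
    finally show ?thesis .
  qed
  have half: "2 * (ennreal (1/2) * a) = a" for a
    using ennreal_mult[of 2 "1/2", symmetric] by (simp add: mult.assoc[symmetric])
  have "(\<integral>\<^sup>+\<omega>. eexp (\<integral>\<^sup>+x. ennreal (3 * c / 8 * slope_sq h x0 j (brownian_path \<omega>) x) \<partial>window_measure x0 c) \<partial>P) \<le> (\<integral>\<^sup>+\<omega>. eexp (A \<omega>) + eexp (B \<omega>) \<partial>P)"
  proof (rule nn_integral_mono)
    fix \<omega> assume \<omega>: "\<omega> \<in> space P"
    have "eexp (\<Sum>i\<in>{True, False}. ennreal (1/2) * (if i then A \<omega> else B \<omega>)) \<le> (\<Sum>i\<in>{True, False}. eexp (of_nat (card {True, False}) * (ennreal (1/2) * (if i then A \<omega> else B \<omega>))))"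
      by (rule eexp_sum_le) auto
    then have "eexp (ennreal (1/2) * A \<omega> + ennreal (1/2) * B \<omega>) \<le> eexp (A \<omega>) + eexp (B \<omega>)"
      using half[of "A \<omega>"] half[of "B \<omega>"] by simp
    then show "eexp (\<integral>\<^sup>+x. ennreal (3 * c / 8 * slope_sq h x0 j (brownian_path \<omega>) x) \<partial>window_measure x0 c) \<le> eexp (A \<omega>) + eexp (B \<omega>)"
      by (rule order.trans[OF eexp_mono[OF main[OF \<omega>]]])
  qed
  also have "\<dots> = (\<integral>\<^sup>+\<omega>. eexp (A \<omega>) \<partial>P) + (\<integral>\<^sup>+\<omega>. eexp (B \<omega>) \<partial>P)"
    by (rule nn_integral_add) measurable
  also have "\<dots> \<le> 2 ^ N + 2 ^ N" by (rule add_mono[OF A B])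
  finally show ?thesis by (simp add: mult_2)
qed

definition noise_mgf :: "nat \<Rightarrow> real \<Rightarrow> real \<Rightarrow> real measure \<Rightarrow> real \<Rightarrow> ennreal" where
  "noise_mgf k h x0 \<mu> \<theta> =
     (\<integral>\<^sup>+\<omega>. eexp (\<integral>\<^sup>+x. ennreal (\<theta> * (smooth k h x0 (brownian_path \<omega>) x)\<^sup>2) \<partial>\<mu>) \<partial>P)"

lemma noise_exp_moment:
  assumes \<mu>: "sets \<mu> = sets borel" "sigma_finite_measure \<mu>" and \<theta>: "\<theta> \<ge> 0"
    and bd: "\<And>j. j \<in> {1..k+1} \<Longrightarrow> (\<integral>\<^sup>+\<omega>. eexp (\<integral>\<^sup>+x. ennreal (\<theta> * slope_sq h x0 j (brownian_path \<omega>) x) \<partial>\<mu>) \<partial>P) \<le> \<Lambda>"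
  shows "noise_mgf k h x0 \<mu> (\<theta> / kernel_const k) \<le> of_nat (k + 1) * \<Lambda>"
proof -
  interpret \<mu>: sigma_finite_measure \<mu> by fact
  note [measurable_cong] = \<mu>(1)
  define S where "S j \<omega> = (\<integral>\<^sup>+x. ennreal (\<theta> * slope_sq h x0 j (brownian_path \<omega>) x) \<partial>\<mu>)" for j \<omega>
  have Sm[measurable]: "S j \<in> borel_measurable P" for j
    unfolding S_def by measurable
  have "(\<integral>\<^sup>+\<omega>. eexp (\<integral>\<^sup>+x. ennreal (\<theta> / kernel_const k * (smooth k h x0 (brownian_path \<omega>) x)\<^sup>2) \<partial>\<mu>) \<partial>P)
    \<le> (\<integral>\<^sup>+\<omega>. (\<Sum>j=1..k+1. eexp (S j \<omega>)) \<partial>P)"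
  proof (rule nn_integral_mono)
    fix \<omega> assume \<omega>: "\<omega> \<in> space P"
    have sm[measurable]: "slope_sq h x0 j (brownian_path \<omega>) \<in> borel_measurable \<mu>" for j
      using measurable_compose_Pair1[OF \<omega> measurable_slope_sq] by simp
    have "(\<integral>\<^sup>+x. ennreal (\<theta> / kernel_const k * (smooth k h x0 (brownian_path \<omega>) x)\<^sup>2) \<partial>\<mu>)
      \<le> (\<integral>\<^sup>+x. (\<Sum>j=1..k+1. ennreal (1 / (real k + 1)) * ennreal (\<theta> * slope_sq h x0 j (brownian_path \<omega>) x)) \<partial>\<mu>)"
    proof (rule nn_integral_mono)
      fix x
      have s0: "slope_sq h x0 j (brownian_path \<omega>) x \<ge> 0" for j by (simp add: slope_sq_def)
      have "\<theta> / kernel_const k * (smooth k h x0 (brownian_path \<omega>) x)\<^sup>2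
        \<le> \<theta> / kernel_const k * ((real k + 1) * 4 ^ (k + 1) * (\<Sum>j=1..k+1. slope_sq h x0 j (brownian_path \<omega>) x))"
        using \<theta> kernel_const_pos[of k] by (intro mult_left_mono smooth_sq_le) auto
      also have "\<dots> = \<theta> / (real k + 1) * (\<Sum>j=1..k+1. slope_sq h x0 j (brownian_path \<omega>) x)"
        unfolding kernel_const_def by (simp add: power2_eq_square del: power_Suc)
      also have "\<dots> = (\<Sum>j=1..k+1. 1 / (real k + 1) * (\<theta> * slope_sq h x0 j (brownian_path \<omega>) x))"
        by (simp only: sum_distrib_left) simp
      finally have "ennreal (\<theta> / kernel_const k * (smooth k h x0 (brownian_path \<omega>) x)\<^sup>2) \<le> ennreal (\<Sum>j=1..k+1. 1 / (real k + 1) * (\<theta> * slope_sq h x0 j (brownian_path \<omega>) x))"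
        by (rule ennreal_leI)
      also have "\<dots> = (\<Sum>j=1..k+1. ennreal (1 / (real k + 1) * (\<theta> * slope_sq h x0 j (brownian_path \<omega>) x)))"
        using \<theta> s0 by (intro sum_ennreal[symmetric]) simp
      also have "\<dots> = (\<Sum>j=1..k+1. ennreal (1 / (real k + 1)) * ennreal (\<theta> * slope_sq h x0 j (brownian_path \<omega>) x))"
        using \<theta> s0 by (intro sum.cong refl ennreal_mult) simp_all
      finally show "ennreal (\<theta> / kernel_const k * (smooth k h x0 (brownian_path \<omega>) x)\<^sup>2) \<le> \<dots>" .
    qed
    also have "\<dots> = (\<Sum>j=1..k+1. ennreal (1 / (real k + 1)) * S j \<omega>)"
    proof -
      have "(\<integral>\<^sup>+x. (\<Sum>j=1..k+1. ennreal (1 / (real k + 1)) * ennreal (\<theta> * slope_sq h x0 j (brownian_path \<omega>) x)) \<partial>\<mu>)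
        = (\<Sum>j=1..k+1. \<integral>\<^sup>+x. ennreal (1 / (real k + 1)) * ennreal (\<theta> * slope_sq h x0 j (brownian_path \<omega>) x) \<partial>\<mu>)"
        by (rule nn_integral_sum) measurable
      also have "\<dots> = (\<Sum>j=1..k+1. ennreal (1 / (real k + 1)) * S j \<omega>)"
        unfolding S_def by (rule sum.cong[OF refl], rule nn_integral_cmult) measurable
      finally show ?thesis .
    qed
    finally have "eexp (\<integral>\<^sup>+x. ennreal (\<theta> / kernel_const k * (smooth k h x0 (brownian_path \<omega>) x)\<^sup>2) \<partial>\<mu>)
      \<le> eexp (\<Sum>j=1..k+1. ennreal (1 / (real k + 1)) * S j \<omega>)" by (rule eexp_mono)
    also have "\<dots> \<le> (\<Sum>j=1..k+1. eexp (of_nat (card {1..k+1}) * (ennreal (1 / (real k + 1)) * S j \<omega>)))"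
      by (rule eexp_sum_le) auto
    finally have le: "eexp (\<integral>\<^sup>+x. ennreal (\<theta> / kernel_const k * (smooth k h x0 (brownian_path \<omega>) x)\<^sup>2) \<partial>\<mu>)
      \<le> (\<Sum>j=1..k+1. eexp (of_nat (card {1..k+1}) * (ennreal (1 / (real k + 1)) * S j \<omega>)))" .
    have eq: "of_nat (card {1..k+1}) * (ennreal (1 / (real k + 1)) * S j \<omega>) = S j \<omega>" for j
    proof -
      have "of_nat (card {1..k+1}) * ennreal (1 / (real k + 1)) = ennreal (real (k + 1) * (1 / (real k + 1)))"
        by (subst ennreal_mult) (simp_all add: ennreal_of_nat_eq_real_of_nat)
      also have "real (k + 1) * (1 / (real k + 1)) = 1" by (simp add: divide_simps)
      finally show ?thesis by (simp only: mult.assoc[symmetric] ennreal_1 mult_1)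
    qed
    show "eexp (\<integral>\<^sup>+x. ennreal (\<theta> / kernel_const k * (smooth k h x0 (brownian_path \<omega>) x)\<^sup>2) \<partial>\<mu>) \<le> (\<Sum>j=1..k+1. eexp (S j \<omega>))"
      using le by (simp only: eq)
  qed
  also have "\<dots> = (\<Sum>j=1..k+1. \<integral>\<^sup>+\<omega>. eexp (S j \<omega>) \<partial>P)"
    by (rule nn_integral_sum) measurable
  also have "\<dots> \<le> (\<Sum>j=1..k+1. \<Lambda>)" unfolding S_def by (intro sum_mono bd)
  finally show ?thesis unfolding noise_mgf_def by simp
qed

text \<open>
A number is bounded by its exponential, so an exponential moment controls the mean.
\<close>

lemma noise_second_moment:
  assumes \<mu>: "prob_space \<mu>" "sets \<mu> = sets borel" "AE x in \<mu>. x \<in> {0..1}"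
    and h: "h > 0" "(real k + 1) * h \<le> x0" "(real k + 1) * h \<le> 1 - x0"
  shows "(\<integral>\<^sup>+\<omega>. \<integral>\<^sup>+x. ennreal ((smooth k h x0 (brownian_path \<omega>) x)\<^sup>2) \<partial>\<mu> \<partial>P) \<le> ennreal (16 * kernel_const k * (real k + 1) / (3 * h))"
proof -
  interpret \<mu>: prob_space \<mu> by fact
  note [measurable_cong] = \<mu>(2)
  define r where "r = 3 * h / 8 / kernel_const k"
  have r: "r > 0" using h kernel_const_pos[of k] by (simp add: r_def)
  define S where "S \<omega> = (\<integral>\<^sup>+x. ennreal ((smooth k h x0 (brownian_path \<omega>) x)\<^sup>2) \<partial>\<mu>)" for \<omega>
  have [measurable]: "S \<in> borel_measurable P" unfolding S_def by measurable
  have "ennreal r * (\<integral>\<^sup>+\<omega>. S \<omega> \<partial>P) = (\<integral>\<^sup>+\<omega>. ennreal r * S \<omega> \<partial>P)" by (rule nn_integral_cmult[symmetric]) measurable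
  also have "\<dots> \<le> noise_mgf k h x0 \<mu> r"
    unfolding noise_mgf_def
  proof (rule nn_integral_mono)
    fix \<omega> assume \<omega>: "\<omega> \<in> space P"
    have [measurable]: "smooth k h x0 (brownian_path \<omega>) \<in> borel_measurable \<mu>"
      using measurable_compose_Pair1[OF \<omega> measurable_noise] by simp
    have "ennreal r * S \<omega> = (\<integral>\<^sup>+x. ennreal (r * (smooth k h x0 (brownian_path \<omega>) x)\<^sup>2) \<partial>\<mu>)"
      unfolding S_def using r by (simp add: nn_integral_cmult[symmetric] ennreal_mult)
    then show "ennreal r * S \<omega> \<le> eexp (\<integral>\<^sup>+x. ennreal (r * (smooth k h x0 (brownian_path \<omega>) x)\<^sup>2) \<partial>\<mu>)"
      using le_eexp by simp
  qed
  also have "\<dots> \<le> of_nat (k + 1) * 2"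
    unfolding r_def using h by (intro noise_exp_moment \<mu>.sigma_finite_measure_axioms \<mu>(2) slope_sq_mean_exp_moment \<mu>) auto
  finally have 1: "ennreal r * (\<integral>\<^sup>+\<omega>. S \<omega> \<partial>P) \<le> of_nat (k + 1) * 2" .
  have "(\<integral>\<^sup>+\<omega>. S \<omega> \<partial>P) = ennreal (1 / r) * (ennreal r * (\<integral>\<^sup>+\<omega>. S \<omega> \<partial>P))"
    using r by (simp add: mult.assoc[symmetric] ennreal_mult[symmetric])
  also have "\<dots> \<le> ennreal (1 / r) * (of_nat (k + 1) * 2)" by (rule mult_left_mono[OF 1]) simp
  also have "of_nat (k + 1) * 2 = ennreal (2 * (real k + 1))"
    by (simp add: ennreal_of_nat_eq_real_of_nat ennreal_mult mult.commute)
  also have "ennreal (1 / r) * \<dots> = ennreal (1 / r * (2 * (real k + 1)))"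
    using r by (subst ennreal_mult) auto
  also have "1 / r * (2 * (real k + 1)) = 16 * kernel_const k * (real k + 1) / (3 * h)"
    using h kernel_const_pos[of k] by (simp add: r_def)
  finally show ?thesis by (simp add: S_def)
qed

end

section \<open>The two-stage estimator\<close>

lemma measurable_path_eval_comp [measurable (raw)]:
  assumes f: "f \<in> measurable N borel" and w: "w \<in> measurable N path_space"
  shows "(\<lambda>p. path_eval (w p) (f p)) \<in> borel_measurable N"
  using measurable_compose[OF measurable_Pair[OF w f] measurable_path_eval] by simp

lemma continuous_on_primitive:
  assumes f: "continuous_on {0..1} f"
  shows "continuous_on {0..1} (primitive f)"
  by (rule continuous_on_vector_derivative[where f'=f]) (rule primitive_has_derivative[OF f])

lemma measurable_primitive:
  assumes f: "continuous_on {0..1} f"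
  shows "primitive f \<in> borel_measurable borel"
proof -
  have "continuous_on {0..1} (primitive f)" by (rule continuous_on_primitive[OF f])
  note m = measurable_comp_clip01[OF this]
  have "primitive f = (\<lambda>x. primitive f (clip01 x))"
    unfolding primitive_def by (simp add: clip01_def)
  then show ?thesis using m by simp
qed

text \<open>
A test of \<open>f0\<close> followed by a kernel estimate. The test compares the kernel estimate with its
expectation under \<open>f0\<close> rather than with \<open>f0\<close> itself, so that at \<open>f0\<close> the statistic consists of
pure noise.
\<close>

definition two_stage ::
  "nat \<Rightarrow> real \<Rightarrow> real \<Rightarrow> real measure \<Rightarrow> real \<Rightarrow> (real \<Rightarrow> real) \<Rightarrow> (real \<Rightarrow> real) \<Rightarrow> real \<Rightarrow> real" where
  "two_stage k h x0 \<mu> \<tau> f0 z x =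
     (if (\<integral>\<^sup>+x. ennreal ((smooth k h x0 (path_eval z) x - smooth k h x0 (primitive f0) x)\<^sup>2) \<partial>\<mu>) \<le> ennreal \<tau>
      then f0 (clip01 x) else smooth k h x0 (path_eval z) x)"

lemma two_stage_in_estimators:
  assumes f0: "continuous_on {0..1} f0" and c: "c \<ge> 0"
  shows "two_stage k h x0 (window_measure x0 c) \<tau> f0 \<in> estimators"
proof -
  interpret prob_space "window_measure x0 c" by (rule prob_space_window_measure[OF c])
  note measurable_comp_clip01[OF f0, measurable] measurable_primitive[OF f0, measurable]
  have [measurable]: "(\<lambda>p. smooth k h x0 (path_eval (fst p)) (snd p)) \<in> borel_measurable (path_space \<Otimes>\<^sub>M borel)"
    unfolding smooth_def kernel_est_def by measurable
  have [measurable]: "smooth k h x0 (primitive f0) \<in> borel_measurable borel"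
    unfolding smooth_def kernel_est_def by measurable
  have "(\<lambda>p. ennreal ((smooth k h x0 (path_eval (fst p)) (snd p) - smooth k h x0 (primitive f0) (snd p))\<^sup>2)) \<in> borel_measurable (path_space \<Otimes>\<^sub>M borel)"
    by measurable
  then have "(\<lambda>p. ennreal ((smooth k h x0 (path_eval (fst p)) (snd p) - smooth k h x0 (primitive f0) (snd p))\<^sup>2)) \<in> borel_measurable (path_space \<Otimes>\<^sub>M window_measure x0 c)"
    by (simp cong: measurable_cong_sets sets_pair_measure_cong)
  then have [measurable]: "(\<lambda>z. \<integral>\<^sup>+x. ennreal ((smooth k h x0 (path_eval z) x - smooth k h x0 (primitive f0) x)\<^sup>2) \<partial>window_measure x0 c) \<in> borel_measurable path_space"
    using borel_measurable_nn_integral_fst[of _ path_space] by (auto simp: case_prod_beta')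
  show ?thesis
    unfolding estimators_def two_stage_def by (simp add: case_prod_beta')
qed

lemma inward_in_01:
  assumes x: "x \<in> {0..1}" and h: "h > 0" "(real k + 1) * h \<le> x0" "(real k + 1) * h \<le> 1 - x0" and j: "j \<le> k + 1"
  shows "x + real j * inward x0 h x \<in> {0..1}"
proof -
  have "real j \<le> real k + 1" using j by auto
  then have jh: "real j * h \<ge> 0" "real j * h \<le> (real k + 1) * h" using h(1) mult_right_mono[of "real j" "real k + 1" h] by auto
  then have "0 \<le> x0 - real j * h" "x0 + real j * h \<le> 1" using h by linarith+
  then show ?thesis using x jh(1) by (auto simp: inward_def)
qed

lemma smooth_bias:
  assumes f: "f \<in> holder_class \<alpha> M" and a: "\<alpha> > 0" and M: "M \<ge> 0" and x: "x \<in> {0..1}"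
    and h: "h > 0" "(real k + 1) * h \<le> x0" "(real k + 1) * h \<le> 1 - x0" and k: "k = holder_order \<alpha>"
  shows "\<bar>smooth k h x0 (primitive f) x - f x\<bar> \<le> (\<Sum>j=1..k+1. of_nat ((k+1) choose j) * real j powr \<alpha>) * M * h powr \<alpha>"
proof -
  have "x + real (k + 1) * inward x0 h x \<in> {0..1}" by (rule inward_in_01[OF x h]) simp
  then have "x + (real k + 1) * inward x0 h x \<in> {0..1}" by (simp add: add.commute)
  moreover have "inward x0 h x \<noteq> 0" "\<bar>inward x0 h x\<bar> = h" using h by (auto simp: inward_def)
  ultimately show ?thesis
    using kernel_est_bias[OF f a M x, of "inward x0 h x" k] k unfolding smooth_def by simp
qed

lemma ennreal_sq_sum4: "ennreal ((a + b + c + d)\<^sup>2) \<le> 4 * ennreal (a\<^sup>2) + 4 * ennreal (b\<^sup>2) + 4 * ennreal (c\<^sup>2) + 4 * ennreal (d\<^sup>2)"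
proof -
  have "(a + b + c + d)\<^sup>2 \<le> 4 * a\<^sup>2 + 4 * b\<^sup>2 + 4 * c\<^sup>2 + 4 * d\<^sup>2"
  proof -
    have "0 \<le> (a - b)\<^sup>2 + (a - c)\<^sup>2 + (a - d)\<^sup>2 + (b - c)\<^sup>2 + (b - d)\<^sup>2 + (c - d)\<^sup>2" by simp
    then show ?thesis by (simp add: power2_eq_square algebra_simps)
  qed
  then have "ennreal ((a + b + c + d)\<^sup>2) \<le> ennreal (4 * a\<^sup>2 + 4 * b\<^sup>2 + 4 * c\<^sup>2 + 4 * d\<^sup>2)" by (rule ennreal_leI)
  then show ?thesis by (simp add: ennreal_mult)
qed

lemma ennreal_sq_sum2: "ennreal ((a + b)\<^sup>2) \<le> 2 * ennreal (a\<^sup>2) + 2 * ennreal (b\<^sup>2)"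
proof -
  have "(a + b)\<^sup>2 \<le> 2 * a\<^sup>2 + 2 * b\<^sup>2"
    using zero_le_power2[of "a - b"] by (simp add: power2_eq_square algebra_simps)
  then have "ennreal ((a + b)\<^sup>2) \<le> ennreal (2 * a\<^sup>2 + 2 * b\<^sup>2)" by (rule ennreal_leI)
  then show ?thesis by (simp add: ennreal_mult)
qed

context std_brownian_motion begin

lemma AE_smooth_observation:
  assumes f: "continuous_on {0..1} f"
    and h: "h > 0" "(real k + 1) * h \<le> x0" "(real k + 1) * h \<le> 1 - x0"
  shows "AE \<omega> in P. \<forall>x\<in>{0..1}. smooth k h x0 (path_eval (observation W n f \<omega>)) x
           = smooth k h x0 (primitive f) x + smooth k h x0 (brownian_path \<omega>) x / sqrt (real n)"
  using AE_brownian_path continuous_paths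
proof eventually_elim
  fix \<omega> assume bw: "\<forall>x\<in>{0..1}. brownian_path \<omega> x = W x \<omega>" and cW: "continuous_on {0..1} (\<lambda>t. W t \<omega>)"
  have "continuous_on {0..1} (primitive f)" by (rule continuous_on_primitive[OF f])
  then have "continuous_on {0..1} (\<lambda>t. primitive f t + 1 / sqrt (real n) * W t \<omega>)"
    by (intro continuous_intros cW)
  then have "continuous_on {0..1} (observation W n f \<omega>)"
    by (rule continuous_on_eq) (simp add: observation_eq)
  then have pe: "path_eval (observation W n f \<omega>) y = primitive f y + brownian_path \<omega> y / sqrt (real n)" if "y \<in> {0..1}" for y
    using that bw by (simp add: path_eval_continuous observation_eq)
  show "\<forall>x\<in>{0..1}. smooth k h x0 (path_eval (observation W n f \<omega>)) x
           = smooth k h x0 (primitive f) x + smooth k h x0 (brownian_path \<omega>) x / sqrt (real n)"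
  proof
    fix x :: real assume x: "x \<in> {0..1}"
    let ?s = "inward x0 h x"
    have "smooth k h x0 (path_eval (observation W n f \<omega>)) x
      = (\<Sum>j=1..k+1. kernel_weight k j * ((primitive f (x + real j * ?s) - primitive f x) / (real j * ?s))
         + kernel_weight k j * ((brownian_path \<omega> (x + real j * ?s) - brownian_path \<omega> x) / (real j * ?s)) / sqrt (real n))"
      unfolding smooth_def kernel_est_def
    proof (rule sum.cong[OF refl])
      fix j assume "j \<in> {1..k+1}"
      then have "x + real j * ?s \<in> {0..1}" by (intro inward_in_01[OF x h]) simp
      then have "path_eval (observation W n f \<omega>) (x + real j * ?s) - path_eval (observation W n f \<omega>) x
        = (primitive f (x + real j * ?s) - primitive f x) + (brownian_path \<omega> (x + real j * ?s) - brownian_path \<omega> x) / sqrt (real n)"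
        using x by (simp only: pe) (simp add: diff_divide_distrib)
      then show "kernel_weight k j * ((path_eval (observation W n f \<omega>) (x + real j * ?s) - path_eval (observation W n f \<omega>) x) / (real j * ?s))
        = kernel_weight k j * ((primitive f (x + real j * ?s) - primitive f x) / (real j * ?s))
         + kernel_weight k j * ((brownian_path \<omega> (x + real j * ?s) - brownian_path \<omega> x) / (real j * ?s)) / sqrt (real n)"
        by (simp only: add_divide_distrib distrib_left) (simp add: mult.commute)
    qed
    then show "smooth k h x0 (path_eval (observation W n f \<omega>)) x
           = smooth k h x0 (primitive f) x + smooth k h x0 (brownian_path \<omega>) x / sqrt (real n)"
      unfolding smooth_def kernel_est_def by (simp only: sum.distrib sum_divide_distrib)
  qed
qed

text \<open>
If the test accepts, \<open>f0 - f\<close> is the sum of the bias at \<open>f0\<close>, the discrepancy that passed the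
test, the noise, and the bias at \<open>f\<close>. If it rejects, the error is noise plus bias at \<open>f\<close>. At
\<open>f = f0\<close> an accepted test makes no error; a rejected one makes an error of the size of the noise,
because the threshold dominates the bias, and the noise exceeding \<open>\<tau>\<close> is paid for by the
exponential moment.
\<close>

lemma two_stage_risk:
  assumes f0: "continuous_on {0..1} f0" and f: "continuous_on {0..1} f"
    and c: "c \<ge> 0" "{x0 - c..x0 + c} \<subseteq> {0..1}" and n: "n > 0"
    and h: "h > 0" "(real k + 1) * h \<le> x0" "(real k + 1) * h \<le> 1 - x0"
    and b0: "\<And>x. x \<in> {0..1} \<Longrightarrow> \<bar>smooth k h x0 (primitive f0) x - f0 x\<bar> \<le> \<beta>"
    and b: "\<And>x. x \<in> {0..1} \<Longrightarrow> \<bar>smooth k h x0 (primitive f) x - f x\<bar> \<le> \<beta>"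
    and \<tau>: "\<tau> \<ge> 0"
  shows "risk P W n (two_stage k h x0 (window_measure x0 c) \<tau> f0) f x0 c
      \<le> ennreal (8 * \<beta>\<^sup>2 + 4 * \<tau> + 64 * kernel_const k * (real k + 1) / (3 * real n * h))" (is "?R \<le> _")
    and "\<tau> \<ge> \<beta>\<^sup>2 \<Longrightarrow> \<theta> > 0 \<Longrightarrow> \<Lambda> \<ge> 0 \<Longrightarrow>
       noise_mgf k h x0 (window_measure x0 c) \<theta> \<le> ennreal \<Lambda> \<Longrightarrow>
       risk P W n (two_stage k h x0 (window_measure x0 c) \<tau> f0) f0 x0 c
      \<le> ennreal (8 / (real n * \<theta>) * exp (- (real n * \<theta> * \<tau> / 2)) * \<Lambda>)"
proof -
  let ?\<mu> = "window_measure x0 c"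
  define est where "est = two_stage k h x0 ?\<mu> \<tau> f0"
  have est: "est \<in> estimators" unfolding est_def by (rule two_stage_in_estimators[OF f0 c(1)])
  interpret \<mu>: prob_space ?\<mu> by (rule prob_space_window_measure[OF c(1)])
  have AE\<mu>: "AE x in ?\<mu>. x \<in> {0..1}"
    using AE_window_measure[OF c(1), of x0] by eventually_elim (use c(2) in blast)
  define noise where "noise \<omega> x = smooth k h x0 (brownian_path \<omega>) x / sqrt (real n)" for \<omega> x
  define \<nu> where "\<nu> \<omega> = (\<integral>\<^sup>+x. ennreal ((noise \<omega> x)\<^sup>2) \<partial>?\<mu>)" for \<omega>
  have noise_m: "(\<lambda>p. noise (fst p) (snd p)) \<in> borel_measurable (P \<Otimes>\<^sub>M borel)"
    unfolding noise_def by measurable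
  have [measurable]: "(\<lambda>p. noise (fst p) (snd p)) \<in> borel_measurable (P \<Otimes>\<^sub>M ?\<mu>)"
    using noise_m by (simp cong: measurable_cong_sets sets_pair_measure_cong)
  have \<nu>m[measurable]: "\<nu> \<in> borel_measurable P" unfolding \<nu>_def by measurable
  have noise_m1: "noise \<omega> \<in> borel_measurable borel" if "\<omega> \<in> space P" for \<omega>
    using measurable_compose_Pair1[OF that noise_m] by simp
  have \<beta>0: "\<beta> \<ge> 0" using b[of 0] by simp
  have bias_int: "(\<integral>\<^sup>+x. ennreal ((g x)\<^sup>2) \<partial>?\<mu>) \<le> ennreal (\<beta>\<^sup>2)" if g: "\<And>x. x \<in> {0..1} \<Longrightarrow> \<bar>g x\<bar> \<le> \<beta>" for g
  proof -
    have "(\<integral>\<^sup>+x. ennreal ((g x)\<^sup>2) \<partial>?\<mu>) \<le> (\<integral>\<^sup>+x. ennreal (\<beta>\<^sup>2) \<partial>?\<mu>)"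
    proof (rule nn_integral_mono_AE, use AE\<mu> in eventually_elim)
      fix x :: real assume "x \<in> {0..1}"
      then have "\<bar>g x\<bar> \<le> \<beta>" by (rule g)
      then show "ennreal ((g x)\<^sup>2) \<le> ennreal (\<beta>\<^sup>2)" by (intro ennreal_leI) (simp add: abs_le_square_iff[symmetric])
    qed
    also have "\<dots> = ennreal (\<beta>\<^sup>2)" using \<mu>.emeasure_space_1 by simp
    finally show ?thesis .
  qed
  define bias where "bias f x = smooth k h x0 (primitive f) x - f (clip01 x)" for f x
  have sm_m: "smooth k h x0 (primitive f) \<in> borel_measurable borel" if "continuous_on {0..1} f" for f
  proof -
    note measurable_primitive[OF that, measurable]
    show ?thesis unfolding smooth_def kernel_est_def by measurable
  qed
  have bias_m: "bias f \<in> borel_measurable borel" if "continuous_on {0..1} f" for f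
    unfolding bias_def using sm_m[OF that] measurable_comp_clip01[OF that] by measurable
  have B0: "(\<integral>\<^sup>+x. ennreal ((bias f0 x)\<^sup>2) \<partial>?\<mu>) \<le> ennreal (\<beta>\<^sup>2)"
    by (rule bias_int) (use b0 in \<open>simp add: bias_def\<close>)
  have B: "(\<integral>\<^sup>+x. ennreal ((bias f x)\<^sup>2) \<partial>?\<mu>) \<le> ennreal (\<beta>\<^sup>2)"
    by (rule bias_int) (use b in \<open>simp add: bias_def\<close>)
  define S where "S z = (\<integral>\<^sup>+x. ennreal ((smooth k h x0 (path_eval z) x - smooth k h x0 (primitive f0) x)\<^sup>2) \<partial>?\<mu>)" for z
  have reject: "loss est g ?\<mu> z \<le> 2 * \<nu> \<omega> + 2 * (\<integral>\<^sup>+x. ennreal ((bias g x)\<^sup>2) \<partial>?\<mu>)"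
    if \<omega>: "\<omega> \<in> space P" and g: "continuous_on {0..1} g" and S: "\<not> S z \<le> ennreal \<tau>"
      and z: "\<forall>x\<in>{0..1}. smooth k h x0 (path_eval z) x = smooth k h x0 (primitive g) x + noise \<omega> x" for \<omega> g z
  proof -
    note [measurable] = noise_m1[OF \<omega>] bias_m[OF g]
    have "loss est g ?\<mu> z \<le> (\<integral>\<^sup>+x. 2 * ennreal ((noise \<omega> x)\<^sup>2) + 2 * ennreal ((bias g x)\<^sup>2) \<partial>?\<mu>)"
      unfolding loss_def
    proof (rule nn_integral_mono_AE, use AE\<mu> in eventually_elim)
      fix x :: real assume x: "x \<in> {0..1}"
      have "est z x - g (clip01 x) = noise \<omega> x + bias g x"
        using S z x by (simp add: est_def two_stage_def S_def bias_def)
      then show "ennreal ((est z x - g (clip01 x))\<^sup>2) \<le> 2 * ennreal ((noise \<omega> x)\<^sup>2) + 2 * ennreal ((bias g x)\<^sup>2)"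
        using ennreal_sq_sum2 by simp
    qed
    also have "\<dots> = 2 * \<nu> \<omega> + 2 * (\<integral>\<^sup>+x. ennreal ((bias g x)\<^sup>2) \<partial>?\<mu>)"
      unfolding \<nu>_def by (subst nn_integral_add) (simp_all add: nn_integral_cmult)
    finally show ?thesis .
  qed
  have sqrtn: "sqrt (real n) > 0" using n by simp
  have noise_sq: "(noise \<omega> x)\<^sup>2 = 1 / real n * (smooth k h x0 (brownian_path \<omega>) x)\<^sup>2" for \<omega> x
    by (simp add: noise_def power_divide)
  show "?R \<le> ennreal (8 * \<beta>\<^sup>2 + 4 * \<tau> + 64 * kernel_const k * (real k + 1) / (3 * real n * h))"
  proof -
    have "risk P W n est f x0 c = (\<integral>\<^sup>+\<omega>. loss est f ?\<mu> (observation W n f \<omega>) \<partial>P)"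
      by (rule risk_eq_nn_integral_loss[OF est f c])
    also have "\<dots> \<le> (\<integral>\<^sup>+\<omega>. ennreal (8 * \<beta>\<^sup>2 + 4 * \<tau>) + 4 * \<nu> \<omega> \<partial>P)"
    proof (rule nn_integral_mono_AE, use AE_smooth_observation[OF f h, of n] AE_space in eventually_elim)
      fix \<omega> assume \<omega>: "\<omega> \<in> space P" and eq: "\<forall>x\<in>{0..1}. smooth k h x0 (path_eval (observation W n f \<omega>)) x
           = smooth k h x0 (primitive f) x + smooth k h x0 (brownian_path \<omega>) x / sqrt (real n)"
      let ?z = "observation W n f \<omega>"
      have eq: "\<forall>x\<in>{0..1}. smooth k h x0 (path_eval ?z) x = smooth k h x0 (primitive f) x + noise \<omega> x"
        using eq by (simp add: noise_def)
      show "loss est f ?\<mu> ?z \<le> ennreal (8 * \<beta>\<^sup>2 + 4 * \<tau>) + 4 * \<nu> \<omega>"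
      proof (cases "S ?z \<le> ennreal \<tau>")
        case False
        have "loss est f ?\<mu> ?z \<le> 2 * \<nu> \<omega> + 2 * ennreal (\<beta>\<^sup>2)"
          using order.trans[OF reject[OF \<omega> f False eq] add_left_mono[OF mult_left_mono[OF B]]] by simp
        also have "\<dots> \<le> 4 * \<nu> \<omega> + ennreal (8 * \<beta>\<^sup>2 + 4 * \<tau>)"
        proof (rule add_mono)
          have "2 * \<beta>\<^sup>2 \<le> 8 * \<beta>\<^sup>2 + 4 * \<tau>" using \<tau> zero_le_power2[of \<beta>] by linarith
          from ennreal_leI[OF this] show "2 * ennreal (\<beta>\<^sup>2) \<le> ennreal (8 * \<beta>\<^sup>2 + 4 * \<tau>)"
            by (simp only: ennreal_times_2[OF zero_le_power2])
        qed (simp add: mult_right_mono)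
        finally show ?thesis by (simp add: add.commute)
      next
        case True
        note [measurable] = noise_m1[OF \<omega>] bias_m[OF f] bias_m[OF f0] sm_m[OF f0]
        have [measurable]: "smooth k h x0 (path_eval ?z) \<in> borel_measurable borel"
        proof -
          have [measurable]: "path_eval ?z \<in> borel_measurable borel"
            using observation_in_space by measurable
          show ?thesis unfolding smooth_def kernel_est_def by measurable
        qed
        let ?D = "\<lambda>x. smooth k h x0 (path_eval ?z) x - smooth k h x0 (primitive f0) x"
        have "loss est f ?\<mu> ?z \<le> (\<integral>\<^sup>+x. 4 * ennreal ((bias f0 x)\<^sup>2) + 4 * ennreal ((?D x)\<^sup>2) + 4 * ennreal ((noise \<omega> x)\<^sup>2) + 4 * ennreal ((bias f x)\<^sup>2) \<partial>?\<mu>)"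
          unfolding loss_def
        proof (rule nn_integral_mono_AE, use AE\<mu> in eventually_elim)
          fix x :: real assume x: "x \<in> {0..1}"
          have "est ?z x - f (clip01 x) = - bias f0 x + - ?D x + noise \<omega> x + bias f x"
            using True eq x by (simp add: est_def two_stage_def S_def bias_def)
          then have "ennreal ((est ?z x - f (clip01 x))\<^sup>2) \<le> 4 * ennreal ((- bias f0 x)\<^sup>2) + 4 * ennreal ((- ?D x)\<^sup>2) + 4 * ennreal ((noise \<omega> x)\<^sup>2) + 4 * ennreal ((bias f x)\<^sup>2)"
            by (simp only: ennreal_sq_sum4)
          then show "ennreal ((est ?z x - f (clip01 x))\<^sup>2) \<le> 4 * ennreal ((bias f0 x)\<^sup>2) + 4 * ennreal ((?D x)\<^sup>2) + 4 * ennreal ((noise \<omega> x)\<^sup>2) + 4 * ennreal ((bias f x)\<^sup>2)"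
            by (simp only: power2_minus)
        qed
        also have "\<dots> = 4 * (\<integral>\<^sup>+x. ennreal ((bias f0 x)\<^sup>2) \<partial>?\<mu>) + 4 * S ?z + 4 * \<nu> \<omega> + 4 * (\<integral>\<^sup>+x. ennreal ((bias f x)\<^sup>2) \<partial>?\<mu>)"
          unfolding \<nu>_def S_def by (simp add: nn_integral_add nn_integral_cmult)
        also have "\<dots> \<le> 4 * ennreal (\<beta>\<^sup>2) + 4 * ennreal \<tau> + 4 * \<nu> \<omega> + 4 * ennreal (\<beta>\<^sup>2)"
          by (intro add_mono mult_left_mono B B0 True order.refl) simp_all
        also have "\<dots> = ennreal (8 * \<beta>\<^sup>2 + 4 * \<tau>) + 4 * \<nu> \<omega>"
        proof -
          have "ennreal (8 * \<beta>\<^sup>2 + 4 * \<tau>) = ennreal (4 * \<beta>\<^sup>2 + 4 * \<tau> + 4 * \<beta>\<^sup>2)" by simp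
          also have "\<dots> = 4 * ennreal (\<beta>\<^sup>2) + 4 * ennreal \<tau> + 4 * ennreal (\<beta>\<^sup>2)"
            using \<tau> by (simp only: ennreal_plus ennreal_mult mult_nonneg_nonneg zero_le_power2 add_nonneg_nonneg zero_le_numeral ennreal_numeral)
          finally show ?thesis by (simp only: ac_simps)
        qed
        finally show ?thesis .
      qed
    qed
    also have "\<dots> = ennreal (8 * \<beta>\<^sup>2 + 4 * \<tau>) + 4 * (\<integral>\<^sup>+\<omega>. \<nu> \<omega> \<partial>P)"
      by (subst nn_integral_add) (simp_all add: nn_integral_cmult emeasure_space_1)
    also have "(\<integral>\<^sup>+\<omega>. \<nu> \<omega> \<partial>P) = ennreal (1 / real n) * (\<integral>\<^sup>+\<omega>. \<integral>\<^sup>+x. ennreal ((smooth k h x0 (brownian_path \<omega>) x)\<^sup>2) \<partial>?\<mu> \<partial>P)"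
    proof -
      have [measurable]: "(\<lambda>p. smooth k h x0 (brownian_path (fst p)) (snd p)) \<in> borel_measurable (P \<Otimes>\<^sub>M ?\<mu>)"
        using measurable_noise by (simp cong: measurable_cong_sets sets_pair_measure_cong)
      have "\<nu> \<omega> = ennreal (1 / real n) * (\<integral>\<^sup>+x. ennreal ((smooth k h x0 (brownian_path \<omega>) x)\<^sup>2) \<partial>?\<mu>)" if "\<omega> \<in> space P" for \<omega>
      proof -
        have [measurable]: "smooth k h x0 (brownian_path \<omega>) \<in> borel_measurable ?\<mu>"
          using measurable_compose_Pair1[OF that measurable_noise] by simp
        show ?thesis unfolding \<nu>_def noise_sq using n by (simp add: nn_integral_cmult[symmetric] ennreal_mult'[symmetric])
      qed
      then have "(\<integral>\<^sup>+\<omega>. \<nu> \<omega> \<partial>P) = (\<integral>\<^sup>+\<omega>. ennreal (1 / real n) * (\<integral>\<^sup>+x. ennreal ((smooth k h x0 (brownian_path \<omega>) x)\<^sup>2) \<partial>?\<mu>) \<partial>P)"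
        by (rule nn_integral_cong)
      also have "\<dots> = ennreal (1 / real n) * (\<integral>\<^sup>+\<omega>. \<integral>\<^sup>+x. ennreal ((smooth k h x0 (brownian_path \<omega>) x)\<^sup>2) \<partial>?\<mu> \<partial>P)"
        by (rule nn_integral_cmult) measurable
      finally show ?thesis .
    qed
    also have "ennreal (8 * \<beta>\<^sup>2 + 4 * \<tau>) + 4 * (ennreal (1 / real n) * (\<integral>\<^sup>+\<omega>. \<integral>\<^sup>+x. ennreal ((smooth k h x0 (brownian_path \<omega>) x)\<^sup>2) \<partial>?\<mu> \<partial>P))
      \<le> ennreal (8 * \<beta>\<^sup>2 + 4 * \<tau>) + 4 * (ennreal (1 / real n) * ennreal (16 * kernel_const k * (real k + 1) / (3 * h)))"
      by (intro add_left_mono mult_left_mono noise_second_moment \<mu>.prob_space_axioms AE\<mu> h) simp_all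
    also have "4 * (ennreal (1 / real n) * ennreal (16 * kernel_const k * (real k + 1) / (3 * h))) = ennreal (4 * (1 / real n * (16 * kernel_const k * (real k + 1) / (3 * h))))"
    proof -
      have "ennreal (1 / real n) * ennreal (16 * kernel_const k * (real k + 1) / (3 * h)) = ennreal (1 / real n * (16 * kernel_const k * (real k + 1) / (3 * h)))"
        by (rule ennreal_mult'[symmetric]) simp
      moreover have "4 * ennreal v = ennreal (4 * v)" for v
        using ennreal_mult'[of 4 v] by simp
      ultimately show ?thesis by (simp only:)
    qed
    also have "4 * (1 / real n * (16 * kernel_const k * (real k + 1) / (3 * h))) = 64 * kernel_const k * (real k + 1) / (3 * real n * h)"
      by simp
    also have "ennreal (8 * \<beta>\<^sup>2 + 4 * \<tau>) + ennreal (64 * kernel_const k * (real k + 1) / (3 * real n * h)) = ennreal (8 * \<beta>\<^sup>2 + 4 * \<tau> + 64 * kernel_const k * (real k + 1) / (3 * real n * h))"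
      using \<tau> h kernel_const_pos[of k] by (intro ennreal_plus[symmetric]) auto
    finally show ?thesis unfolding est_def .
  qed
  show "risk P W n (two_stage k h x0 ?\<mu> \<tau> f0) f0 x0 c \<le> ennreal (8 / (real n * \<theta>) * exp (- (real n * \<theta> * \<tau> / 2)) * \<Lambda>)"
    if \<tau>\<beta>: "\<tau> \<ge> \<beta>\<^sup>2" and \<theta>: "\<theta> > 0" and \<Lambda>: "\<Lambda> \<ge> 0"
      and mom: "noise_mgf k h x0 ?\<mu> \<theta> \<le> ennreal \<Lambda>"
  proof -
    define t where "t = real n * \<theta>"
    have t: "t > 0" using n \<theta> by (simp add: t_def)
    define C where "C = 8 / t * exp (- (t * \<tau> / 2))"
    have C: "C \<ge> 0" using t by (simp add: C_def)
    have \<nu>t: "ennreal t * \<nu> \<omega> = (\<integral>\<^sup>+x. ennreal (\<theta> * (smooth k h x0 (brownian_path \<omega>) x)\<^sup>2) \<partial>?\<mu>)" if "\<omega> \<in> space P" for \<omega>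
    proof -
      note [measurable] = noise_m1[OF that]
      have "ennreal t * \<nu> \<omega> = (\<integral>\<^sup>+x. ennreal (t * (noise \<omega> x)\<^sup>2) \<partial>?\<mu>)"
        unfolding \<nu>_def using t by (simp add: nn_integral_cmult[symmetric] ennreal_mult)
      also have "(\<lambda>x. t * (noise \<omega> x)\<^sup>2) = (\<lambda>x. \<theta> * (smooth k h x0 (brownian_path \<omega>) x)\<^sup>2)"
        using n by (simp add: noise_sq t_def)
      finally show ?thesis .
    qed
    \<comment> \<open>exponential Chebyshev, with half of the exponent spent on absorbing the factor a itself\<close>
    have tail: "4 * a \<le> ennreal C * eexp (ennreal t * a)" if a: "\<not> a \<le> ennreal \<tau>" for a
    proof (cases a)
      case (real r)
      then have r: "r > \<tau>" "r \<ge> 0" using a \<tau> by (auto simp: not_le ennreal_less_iff)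
      have "t * r / 2 \<le> exp (t * r / 2)" using exp_ge_add_one_self[of "t * r / 2"] by linarith
      also have "t * r / 2 \<le> t * r - t * \<tau> / 2" using r t by simp
      then have "exp (t * r / 2) \<le> exp (t * r - t * \<tau> / 2)" by simp
      also have "\<dots> = exp (- (t * \<tau> / 2)) * exp (t * r)" by (simp add: mult_exp_exp)
      finally have "8 / t * (t * r / 2) \<le> 8 / t * (exp (- (t * \<tau> / 2)) * exp (t * r))"
        using t by (intro mult_left_mono) auto
      then have "4 * r \<le> C * exp (t * r)" using t by (simp add: C_def mult.assoc)
      then have "ennreal (4 * r) \<le> ennreal (C * exp (t * r))" by (rule ennreal_leI)
      moreover have "eexp (ennreal t * a) = ennreal (exp (t * r))"
        using real t r by (simp add: ennreal_mult[symmetric] eexp_ennreal)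
      ultimately show ?thesis using real r C by (simp add: ennreal_mult)
    next
      case top
      have "C > 0" using t by (simp add: C_def)
      then show ?thesis using top t by (simp add: ennreal_mult_top eexp_def)
    qed
    have "risk P W n est f0 x0 c = (\<integral>\<^sup>+\<omega>. loss est f0 ?\<mu> (observation W n f0 \<omega>) \<partial>P)"
      by (rule risk_eq_nn_integral_loss[OF est f0 c])
    also have "\<dots> \<le> (\<integral>\<^sup>+\<omega>. ennreal C * eexp (ennreal t * \<nu> \<omega>) \<partial>P)"
    proof (rule nn_integral_mono_AE, use AE_smooth_observation[OF f0 h, of n] AE_space in eventually_elim)
      fix \<omega> assume \<omega>: "\<omega> \<in> space P" and eq: "\<forall>x\<in>{0..1}. smooth k h x0 (path_eval (observation W n f0 \<omega>)) x
           = smooth k h x0 (primitive f0) x + smooth k h x0 (brownian_path \<omega>) x / sqrt (real n)"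
      let ?z = "observation W n f0 \<omega>"
      have eq: "\<forall>x\<in>{0..1}. smooth k h x0 (path_eval ?z) x = smooth k h x0 (primitive f0) x + noise \<omega> x"
        using eq by (simp add: noise_def)
      show "loss est f0 ?\<mu> ?z \<le> ennreal C * eexp (ennreal t * \<nu> \<omega>)"
      proof (cases "S ?z \<le> ennreal \<tau>")
        case True
        then have "est ?z x = f0 (clip01 x)" for x by (simp add: est_def two_stage_def S_def)
        then have "loss est f0 ?\<mu> ?z = 0" by (simp add: loss_def)
        then show ?thesis by simp
      next
        case False
        have S\<nu>: "S ?z = \<nu> \<omega>"
          unfolding S_def \<nu>_def by (rule nn_integral_cong_AE, use AE\<mu> in eventually_elim) (use eq in simp)
        have "ennreal (\<beta>\<^sup>2) \<le> \<nu> \<omega>"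
          using False \<tau>\<beta> unfolding S\<nu> by (meson ennreal_leI le_cases order.trans)
        have "loss est f0 ?\<mu> ?z \<le> 2 * \<nu> \<omega> + 2 * ennreal (\<beta>\<^sup>2)"
          using order.trans[OF reject[OF \<omega> f0 False eq] add_left_mono[OF mult_left_mono[OF B0]]] by simp
        also have "\<dots> \<le> 2 * \<nu> \<omega> + 2 * \<nu> \<omega>" by (intro add_left_mono mult_left_mono) (fact, simp)
        also have "\<dots> = 4 * \<nu> \<omega>" by (simp add: distrib_right[symmetric])
        also have "\<dots> \<le> ennreal C * eexp (ennreal t * \<nu> \<omega>)" using tail False unfolding S\<nu> by blast
        finally show ?thesis .
      qed
    qed
    also have "\<dots> = ennreal C * (\<integral>\<^sup>+\<omega>. eexp (ennreal t * \<nu> \<omega>) \<partial>P)"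
      by (rule nn_integral_cmult) measurable
    also have "(\<integral>\<^sup>+\<omega>. eexp (ennreal t * \<nu> \<omega>) \<partial>P) = noise_mgf k h x0 ?\<mu> \<theta>"
      unfolding noise_mgf_def by (intro nn_integral_cong) (simp add: \<nu>t)
    also have "ennreal C * \<dots> \<le> ennreal C * ennreal \<Lambda>" by (intro mult_left_mono mom) simp
    also have "\<dots> = ennreal (C * \<Lambda>)" using C \<Lambda> by (simp add: ennreal_mult)
    finally show ?thesis unfolding est_def C_def t_def .
  qed
qed

end

section \<open>Risk bounds at a fixed sample size\<close>

definition bias_const :: "nat \<Rightarrow> real \<Rightarrow> real \<Rightarrow> real" where
  "bias_const k \<alpha> M = (\<Sum>j=1..k+1. of_nat ((k+1) choose j) * real j powr \<alpha>) * M"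

lemma holder_class_mono:
  assumes "M' \<le> M" shows "holder_class \<alpha> M' \<subseteq> holder_class \<alpha> M"
proof -
  have "M' * r powr s \<le> M * r powr s" for r s :: real using assms by (intro mult_right_mono) auto
  then show ?thesis unfolding holder_class_def
    by (intro Collect_mono impI conjI allI) (blast, blast intro: order.trans)
qed

context std_brownian_motion begin

text \<open>
The two-point bound for \<open>f0\<close> and \<open>f0\<close> plus a bump. The energy condition caps the second moment
of the likelihood ratio at the square root of \<open>B\<close>, which the superefficiency factor \<open>B\<close>
outweighs.
\<close>

lemma max_risk_lower_bound:
  assumes fh: "fh \<in> estimators" and \<alpha>: "\<alpha> > 0" and f0: "f0 \<in> holder_class \<alpha> M'" and M: "0 \<le> M'" "M' \<le> M"
    and n: "n > 0" and c: "c \<ge> 0" "{x0 - c..x0 + c} \<subseteq> {0..1}"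
    and h: "h > 0" and a: "a > 0" "a * (2 * fact (Suc (holder_order \<alpha>))) \<le> M - M'"
    and B: "B > 0" "real n * (a\<^sup>2 * h powr (2 * \<alpha> + 1) * pi) \<le> ln B / 2"
    and r: "risk P W n fh f0 x0 c \<le> ennreal r" "r \<ge> 0"
    and \<Delta>: "\<Delta> > 0" "\<Delta> \<le> a\<^sup>2 * h powr (2 * \<alpha>) / 4 * (if c \<le> h then 1 else h / c)"
    and small: "16 * sqrt B * r \<le> \<Delta>"
  shows "ennreal (\<Delta> / 8) \<le> max_risk P W n fh \<alpha> M x0 c"
proof -
  let ?b = "bump \<alpha> a h x0"
  define f1 where "f1 x = f0 x + ?b x" for x
  have f1: "f1 \<in> holder_class \<alpha> M"
    unfolding f1_def by (rule holder_class_add_bump[OF f0 \<alpha> h less_imp_le[OF a(1)] a(2)])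
  have c0: "continuous_on {0..1} f0" by (rule holder_class_continuous[OF f0 \<alpha> M(1)])
  have c1: "continuous_on {0..1} f1" by (rule holder_class_continuous[OF f1 \<alpha>]) (use M in simp)
  have "ennreal (\<Delta> / 8) \<le> risk P W n fh f1 x0 c"
  proof (rule two_point_lower_bound[OF fh c0 c1 n c r \<Delta>(1)])
    let ?I = "{x0 - h..x0 + h}"
    have "ennreal \<Delta> \<le> ennreal (a\<^sup>2 * h powr (2 * \<alpha>) / 4 * (if c \<le> h then 1 else h / c))"
      using \<Delta>(2) by (rule ennreal_leI)
    also have "\<dots> = ennreal (a\<^sup>2 * h powr (2 * \<alpha>) / 4) * ennreal (if c \<le> h then 1 else h / c)"
      by (rule ennreal_mult') simp
    also have "\<dots> \<le> ennreal (a\<^sup>2 * h powr (2 * \<alpha>) / 4) * emeasure (window_measure x0 c) ?I"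
      by (intro mult_left_mono window_measure_mass c h) simp
    also have "\<dots> = (\<integral>\<^sup>+x. ennreal (a\<^sup>2 * h powr (2 * \<alpha>) / 4) * indicator ?I x \<partial>window_measure x0 c)"
      by (simp add: nn_integral_cmult_indicator)
    also have "\<dots> \<le> (\<integral>\<^sup>+x. ennreal ((f1 (clip01 x) - f0 (clip01 x))\<^sup>2) \<partial>window_measure x0 c)"
    proof (rule nn_integral_mono_AE, use AE_window_measure[OF c(1), of x0] in eventually_elim)
      fix x assume "x \<in> {x0 - c..x0 + c}"
      then have x: "clip01 x = x" using c(2) by (intro clip01_id) blast
      show "ennreal (a\<^sup>2 * h powr (2 * \<alpha>) / 4) * indicator ?I x \<le> ennreal ((f1 (clip01 x) - f0 (clip01 x))\<^sup>2)"
      proof (cases "x \<in> ?I")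
        case True
        then have "\<bar>x - x0\<bar> \<le> h" by auto
        from ennreal_leI[OF bump_lower_bound[OF h this, where a=a and \<alpha>=\<alpha>]] show ?thesis using True by (simp add: x f1_def)
      qed simp
    qed
    finally show "ennreal \<Delta> \<le> (\<integral>\<^sup>+x. ennreal ((f1 (clip01 x) - f0 (clip01 x))\<^sup>2) \<partial>window_measure x0 c)" .
    have "real n * integral {0..1} (\<lambda>x. (f1 x - f0 x)\<^sup>2) \<le> real n * (a\<^sup>2 * h powr (2 * \<alpha> + 1) * pi)"
      unfolding f1_def using bump_energy[OF h, of \<alpha> a x0] by (intro mult_left_mono) auto
    then have "exp (real n * integral {0..1} (\<lambda>x. (f1 x - f0 x)\<^sup>2)) \<le> exp (ln B / 2)"
      using B(2) by simp
    also have "exp (ln B / 2) = sqrt B"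
      using B(1) by (simp add: ln_sqrt[symmetric])
    finally have "16 * exp (real n * integral {0..1} (\<lambda>x. (f1 x - f0 x)\<^sup>2)) * r \<le> 16 * sqrt B * r"
      using r(2) by (intro mult_right_mono mult_left_mono) auto
    then show "16 * exp (real n * integral {0..1} (\<lambda>x. (f1 x - f0 x)\<^sup>2)) * r \<le> \<Delta>" using small by simp
  qed
  also have "\<dots> \<le> max_risk P W n fh \<alpha> M x0 c"
    unfolding max_risk_def by (rule SUP_upper[OF f1])
  finally show ?thesis .
qed

lemma two_stage_max_risk:
  assumes \<alpha>: "\<alpha> > 0" and f0: "f0 \<in> holder_class \<alpha> M'" and M: "0 \<le> M'" "M' \<le> M"
    and c: "c \<ge> 0" "{x0 - c..x0 + c} \<subseteq> {0..1}" and n: "n > 0"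
    and k: "k = holder_order \<alpha>"
    and h: "h > 0" "(real k + 1) * h \<le> x0" "(real k + 1) * h \<le> 1 - x0"
    and \<tau>: "\<tau> \<ge> (bias_const k \<alpha> M)\<^sup>2 * h powr (2 * \<alpha>)"
  shows "max_risk P W n (two_stage k h x0 (window_measure x0 c) \<tau> f0) \<alpha> M x0 c
      \<le> ennreal (8 * (bias_const k \<alpha> M)\<^sup>2 * h powr (2 * \<alpha>) + 4 * \<tau> + 64 * kernel_const k * (real k + 1) / (3 * real n * h))"
    and "\<theta> > 0 \<Longrightarrow> \<Lambda> \<ge> 0 \<Longrightarrow>
       noise_mgf k h x0 (window_measure x0 c) \<theta> \<le> ennreal \<Lambda> \<Longrightarrow>
       risk P W n (two_stage k h x0 (window_measure x0 c) \<tau> f0) f0 x0 c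
      \<le> ennreal (8 / (real n * \<theta>) * exp (- (real n * \<theta> * \<tau> / 2)) * \<Lambda>)"
proof -
  define \<beta> where "\<beta> = bias_const k \<alpha> M * h powr \<alpha>"
  have \<beta>: "\<beta>\<^sup>2 = (bias_const k \<alpha> M)\<^sup>2 * h powr (2 * \<alpha>)"
    using h by (simp add: \<beta>_def power_mult_distrib powr_power mult.commute)
  have \<tau>0: "\<tau> \<ge> 0" using \<tau> order.trans[OF _ \<tau>, of 0] by simp
  have \<tau>\<beta>: "\<beta>\<^sup>2 \<le> \<tau>" using \<tau> unfolding \<beta> .
  have bias: "\<bar>smooth k h x0 (primitive f) x - f x\<bar> \<le> \<beta>" if f: "f \<in> holder_class \<alpha> M" and x: "x \<in> {0..1}" for f x
    using smooth_bias[OF f \<alpha> _ x h k] M unfolding \<beta>_def bias_const_def by simp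
  have f0M: "f0 \<in> holder_class \<alpha> M" using f0 holder_class_mono[OF M(2)] by blast
  have cont: "continuous_on {0..1} f" if "f \<in> holder_class \<alpha> M" for f
    by (rule holder_class_continuous[OF that \<alpha>]) (use M in simp)
  show "max_risk P W n (two_stage k h x0 (window_measure x0 c) \<tau> f0) \<alpha> M x0 c
      \<le> ennreal (8 * (bias_const k \<alpha> M)\<^sup>2 * h powr (2 * \<alpha>) + 4 * \<tau> + 64 * kernel_const k * (real k + 1) / (3 * real n * h))"
    unfolding max_risk_def
  proof (rule SUP_least)
    fix f assume f: "f \<in> holder_class \<alpha> M"
    show "risk P W n (two_stage k h x0 (window_measure x0 c) \<tau> f0) f x0 c
      \<le> ennreal (8 * (bias_const k \<alpha> M)\<^sup>2 * h powr (2 * \<alpha>) + 4 * \<tau> + 64 * kernel_const k * (real k + 1) / (3 * real n * h))"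
      using two_stage_risk(1)[OF cont[OF f0M] cont[OF f] c n h bias[OF f0M] bias[OF f] \<tau>0]
      by (simp only: \<beta> mult.assoc)
  qed
  show "risk P W n (two_stage k h x0 (window_measure x0 c) \<tau> f0) f0 x0 c
      \<le> ennreal (8 / (real n * \<theta>) * exp (- (real n * \<theta> * \<tau> / 2)) * \<Lambda>)"
    if "\<theta> > 0" "\<Lambda> \<ge> 0" "noise_mgf k h x0 (window_measure x0 c) \<theta> \<le> ennreal \<Lambda>"
    by (rule two_stage_risk(2)[OF cont[OF f0M] cont[OF f0M] c n h bias[OF f0M] bias[OF f0M] \<tau>0 \<tau>\<beta> that])
qed

text \<open>
The bandwidth is tuned so that the bias has the order of the threshold and the exponent of the tail
is at least \<open>L\<close>, which will be \<open>ln B\<close>. The second lower bound on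
\<open>T\<close> provides the latter.
\<close>

lemma two_stage_risk_narrow_window:
  assumes \<alpha>: "\<alpha> > 0" and f0: "f0 \<in> holder_class \<alpha> M'" and M: "0 \<le> M'" "M' \<le> M"
    and c: "c \<ge> 0" "{x0 - c..x0 + c} \<subseteq> {0..1}" and n: "n > 0"
    and k: "k = holder_order \<alpha>"
    and h: "h > 0" "(real k + 1) * h \<le> x0" "(real k + 1) * h \<le> 1 - x0"
    and T: "T \<ge> (bias_const k \<alpha> M)\<^sup>2" "T \<ge> 16 * kernel_const k / 3"
    and L: "L \<ge> 1" "real n * h powr (2 * \<alpha> + 1) = L"
  defines "fh \<equiv> two_stage k h x0 (window_measure x0 c) (T * h powr (2 * \<alpha>)) f0"
  shows "max_risk P W n fh \<alpha> M x0 c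
      \<le> ennreal ((8 * (bias_const k \<alpha> M)\<^sup>2 + 4 * T + 64 * kernel_const k * (real k + 1) / 3) * h powr (2 * \<alpha>))"
    and "risk P W n fh f0 x0 c \<le> ennreal (128 * kernel_const k * (real k + 1) / (3 * real n * h) * exp (- L))"
proof -
  let ?K = "kernel_const k"
  let ?\<tau> = "T * h powr (2 * \<alpha>)"
  have K: "?K > 0" by (rule kernel_const_pos)
  have \<tau>: "?\<tau> \<ge> (bias_const k \<alpha> M)\<^sup>2 * h powr (2 * \<alpha>)" using T by (intro mult_right_mono) auto
  have nh: "real n * h * h powr (2 * \<alpha>) = L" using L h by (simp add: powr_add mult.commute mult.left_commute)
  then have nh1: "1 / (real n * h) \<le> h powr (2 * \<alpha>)"
    using L(1) n h by (simp add: divide_le_eq mult.commute)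
  note ub = two_stage_max_risk[OF \<alpha> f0 M c n k h \<tau>]
  have "64 * ?K * (real k + 1) / (3 * real n * h) = 64 * ?K * (real k + 1) / 3 * (1 / (real n * h))" by simp
  also have "\<dots> \<le> 64 * ?K * (real k + 1) / 3 * h powr (2 * \<alpha>)" using K by (intro mult_left_mono nh1) auto
  finally have "8 * (bias_const k \<alpha> M)\<^sup>2 * h powr (2 * \<alpha>) + 4 * ?\<tau> + 64 * ?K * (real k + 1) / (3 * real n * h)
     \<le> (8 * (bias_const k \<alpha> M)\<^sup>2 + 4 * T + 64 * ?K * (real k + 1) / 3) * h powr (2 * \<alpha>)"
    by (simp add: distrib_right mult.assoc)
  from order.trans[OF ub(1) ennreal_leI[OF this]]
  show "max_risk P W n fh \<alpha> M x0 c
      \<le> ennreal ((8 * (bias_const k \<alpha> M)\<^sup>2 + 4 * T + 64 * ?K * (real k + 1) / 3) * h powr (2 * \<alpha>))"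
    unfolding fh_def .
  define \<theta> where "\<theta> = 3 * h / 8 / ?K"
  have \<theta>: "\<theta> > 0" using h K by (simp add: \<theta>_def)
  interpret \<mu>: prob_space "window_measure x0 c" by (rule prob_space_window_measure[OF c(1)])
  have AE\<mu>: "AE x in window_measure x0 c. x \<in> {0..1}"
    using AE_window_measure[OF c(1), of x0] by eventually_elim (use c(2) in blast)
  have "noise_mgf k h x0 (window_measure x0 c) \<theta> \<le> of_nat (k + 1) * 2"
    unfolding \<theta>_def using h
    by (intro noise_exp_moment \<mu>.sigma_finite_measure_axioms sets_window_measure slope_sq_mean_exp_moment \<mu>.prob_space_axioms AE\<mu>) auto
  also have "of_nat (k + 1) * 2 = ennreal (2 * (real k + 1))"
    by (simp add: ennreal_of_nat_eq_real_of_nat ennreal_mult mult.commute)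
  finally have mom: "noise_mgf k h x0 (window_measure x0 c) \<theta> \<le> ennreal (2 * (real k + 1))" .
  have "real n * \<theta> * ?\<tau> / 2 = 3 * T / (16 * ?K) * (real n * h * h powr (2 * \<alpha>))"
    by (simp add: \<theta>_def)
  also have "\<dots> \<ge> 1 * L" unfolding nh using T(2) K L by (intro mult_right_mono) (auto simp: field_simps)
  finally have "exp (- (real n * \<theta> * ?\<tau> / 2)) \<le> exp (- L)" by simp
  then have "8 / (real n * \<theta>) * exp (- (real n * \<theta> * ?\<tau> / 2)) * (2 * (real k + 1)) \<le> 8 / (real n * \<theta>) * exp (- L) * (2 * (real k + 1))"
    using \<theta> by (intro mult_right_mono mult_left_mono) auto
  also have "\<dots> = 8 / (real n * \<theta>) * (2 * (real k + 1)) * exp (- L)" by simp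
  also have "8 / (real n * \<theta>) * (2 * (real k + 1)) = 128 * ?K * (real k + 1) / (3 * real n * h)"
  proof -
    have "8 / (real n * \<theta>) * (2 * r) = 128 * ?K * r / (3 * real n * h)" for r by (simp add: \<theta>_def)
    then show ?thesis .
  qed
  finally show "risk P W n fh f0 x0 c \<le> ennreal (128 * ?K * (real k + 1) / (3 * real n * h) * exp (- L))"
    using order.trans[OF ub(2)[OF \<theta> _ mom] ennreal_leI] unfolding fh_def by simp
qed

text \<open>
The exponential moment over a window of \<open>d\<close> bandwidths is at most a constant times
\<open>exp (d + 1)\<close>. The summand \<open>d + 1\<close> in the threshold cancels it, and the summand \<open>L\<close> leaves the
factor \<open>exp (- L)\<close>.
\<close>

lemma two_stage_risk_wide_window:
  assumes \<alpha>: "\<alpha> > 0" and f0: "f0 \<in> holder_class \<alpha> M'" and M: "0 \<le> M'" "M' \<le> M"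
    and c: "c = d * h" "d > 0" "{x0 - c..x0 + c} \<subseteq> {0..1}" and n: "n > 0"
    and k: "k = holder_order \<alpha>"
    and h: "h > 0" "(real k + 1) * h \<le> x0" "(real k + 1) * h \<le> 1 - x0"
    and T: "T \<ge> (bias_const k \<alpha> M)\<^sup>2" "T \<ge> 16 * kernel_const k / 3"
    and L: "L \<ge> 0" "real n * h powr (2 * \<alpha> + 1) = 1"
  defines "fh \<equiv> two_stage k h x0 (window_measure x0 c) (T * (L + d + 1) / d * h powr (2 * \<alpha>)) f0"
  shows "max_risk P W n fh \<alpha> M x0 c
      \<le> ennreal ((8 * (bias_const k \<alpha> M)\<^sup>2 + 4 * T * (L + d + 1) / d + 64 * kernel_const k * (real k + 1) / 3) * h powr (2 * \<alpha>))"
    and "risk P W n fh f0 x0 c \<le> ennreal (128 * kernel_const k * (real k + 1) / (3 * real n * c) * exp (- L))"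
proof -
  let ?K = "kernel_const k"
  let ?\<tau> = "T * (L + d + 1) / d * h powr (2 * \<alpha>)"
  have K: "?K > 0" by (rule kernel_const_pos)
  have T0: "T \<ge> 0" using T(2) K by linarith
  have c0: "c > 0" using c h by simp
  have "T * 1 \<le> T * ((L + d + 1) / d)" using T0 c L by (intro mult_left_mono) (auto simp: field_simps)
  then have \<tau>: "?\<tau> \<ge> (bias_const k \<alpha> M)\<^sup>2 * h powr (2 * \<alpha>)" using T by (intro mult_right_mono) auto
  have nh: "real n * h * h powr (2 * \<alpha>) = 1" using L h by (simp add: powr_add mult.commute mult.left_commute)
  then have nh1: "1 / (real n * h) = h powr (2 * \<alpha>)"
    using n h by (simp add: divide_eq_eq mult.commute)
  note ub = two_stage_max_risk[OF \<alpha> f0 M less_imp_le[OF c0] c(3) n k h \<tau>]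
  have "64 * ?K * (real k + 1) / (3 * real n * h) = 64 * ?K * (real k + 1) / 3 * (1 / (real n * h))" by simp
  then have "8 * (bias_const k \<alpha> M)\<^sup>2 * h powr (2 * \<alpha>) + 4 * ?\<tau> + 64 * ?K * (real k + 1) / (3 * real n * h)
     = (8 * (bias_const k \<alpha> M)\<^sup>2 + 4 * T * (L + d + 1) / d + 64 * ?K * (real k + 1) / 3) * h powr (2 * \<alpha>)"
    unfolding nh1 by (simp add: distrib_right mult.assoc)
  then show "max_risk P W n fh \<alpha> M x0 c
      \<le> ennreal ((8 * (bias_const k \<alpha> M)\<^sup>2 + 4 * T * (L + d + 1) / d + 64 * ?K * (real k + 1) / 3) * h powr (2 * \<alpha>))"
    using ub(1) unfolding fh_def by simp
  define \<theta> where "\<theta> = 3 * c / 8 / ?K"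
  have \<theta>: "\<theta> > 0" using c0 K by (simp add: \<theta>_def)
  interpret \<mu>: prob_space "window_measure x0 c" by (rule prob_space_window_measure[OF less_imp_le[OF c0]])
  define N where "N = nat \<lceil>d\<rceil>"
  have N: "N > 0" "d \<le> real N" "real N \<le> d + 1" using c(2) unfolding N_def by linarith+
  have cN: "c \<le> real N * h" unfolding c(1) using N h by (intro mult_right_mono) auto
  have "noise_mgf k h x0 (window_measure x0 c) \<theta> \<le> of_nat (k + 1) * (2 * 2 ^ N)"
    unfolding \<theta>_def using c0
    by (intro noise_exp_moment \<mu>.sigma_finite_measure_axioms sets_window_measure slope_sq_window_exp_moment[OF c0 c(3) cN N(1) h]) auto
  also have "of_nat (k + 1) * (2 * 2 ^ N) = ennreal (real (k + 1) * (2 * 2 ^ N))"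
    by (simp add: ennreal_of_nat_eq_real_of_nat ennreal_mult ennreal_power[symmetric] del: of_nat_add of_nat_Suc)
  also have "\<dots> \<le> ennreal (2 * (real k + 1) * exp (d + 1))"
  proof (rule ennreal_leI)
    have "(2::real) ^ N \<le> exp 1 ^ N" using exp_ge_add_one_self[of 1] by (intro power_mono) auto
    also have "\<dots> = exp (real N)" by (simp add: exp_of_nat_mult[symmetric])
    also have "\<dots> \<le> exp (d + 1)" using N by simp
    finally have "2 * (real k + 1) * 2 ^ N \<le> 2 * (real k + 1) * exp (d + 1)" by (intro mult_left_mono) auto
    then show "real (k + 1) * (2 * 2 ^ N) \<le> 2 * (real k + 1) * exp (d + 1)" by (simp add: algebra_simps)
  qed
  finally have mom: "noise_mgf k h x0 (window_measure x0 c) \<theta> \<le> ennreal (2 * (real k + 1) * exp (d + 1))" .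
  have "real n * \<theta> * ?\<tau> / 2 = 3 * T / (16 * ?K) * (L + d + 1) * (real n * h * h powr (2 * \<alpha>))"
    using c(2) by (simp add: \<theta>_def c(1))
  also have "\<dots> \<ge> 1 * (L + d + 1) * 1" unfolding nh using T(2) K L c by (intro mult_right_mono) (auto simp: field_simps)
  finally have "exp (- (real n * \<theta> * ?\<tau> / 2)) \<le> exp (- (L + d + 1))" by simp
  then have "8 / (real n * \<theta>) * exp (- (real n * \<theta> * ?\<tau> / 2)) * (2 * (real k + 1) * exp (d + 1)) \<le> 8 / (real n * \<theta>) * exp (- (L + d + 1)) * (2 * (real k + 1) * exp (d + 1))"
    using \<theta> by (intro mult_right_mono mult_left_mono) auto
  also have "\<dots> = 8 / (real n * \<theta>) * (2 * (real k + 1)) * (exp (- (L + d + 1)) * exp (d + 1))" by simp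
  also have "exp (- (L + d + 1)) * exp (d + 1) = exp (- L)" by (simp add: mult_exp_exp)
  also have "8 / (real n * \<theta>) * (2 * (real k + 1)) = 128 * ?K * (real k + 1) / (3 * real n * c)"
  proof -
    have "8 / (real n * \<theta>) * (2 * r) = 128 * ?K * r / (3 * real n * c)" for r by (simp add: \<theta>_def)
    then show ?thesis .
  qed
  finally show "risk P W n fh f0 x0 c \<le> ennreal (128 * ?K * (real k + 1) / (3 * real n * c) * exp (- L))"
    using order.trans[OF ub(2)[OF \<theta> _ mom] ennreal_leI] unfolding fh_def by simp
qed

end

section \<open>Rates along the sequence\<close>

lemma limsup_finite_iff_eventually_bounded:
  fixes u :: "nat \<Rightarrow> ennreal"
  shows "limsup u < \<infinity> \<longleftrightarrow> (\<exists>K>0. eventually (\<lambda>n. u n \<le> ennreal K) sequentially)"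
proof
  assume "limsup u < \<infinity>"
  then obtain l where l: "limsup u = ennreal l" "l \<ge> 0" by (cases "limsup u") auto
  then have "limsup u < ennreal (l + 1)" by (simp add: ennreal_less_iff)
  then have "eventually (\<lambda>n. u n < ennreal (l + 1)) sequentially" by (rule Limsup_lessD)
  then show "\<exists>K>0. eventually (\<lambda>n. u n \<le> ennreal K) sequentially"
    using l by (intro exI[of _ "l + 1"]) (auto elim: eventually_mono)
next
  assume "\<exists>K>0. eventually (\<lambda>n. u n \<le> ennreal K) sequentially"
  then obtain K where "eventually (\<lambda>n. u n \<le> ennreal K) sequentially" by blast
  then have "limsup u \<le> ennreal K" by (rule Limsup_bounded)
  also have "\<dots> < \<infinity>" by simp
  finally show "limsup u < \<infinity>" .
qed

text \<open>
The asymptotic setting, with the hypotheses shared by all three regimes.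
\<close>

locale superefficiency = std_brownian_motion P W
  for P :: "'w measure" and W :: "real \<Rightarrow> 'w \<Rightarrow> real" +
  fixes \<alpha> x0 M M' :: real and B c d :: "nat \<Rightarrow> real" and f0 :: "real \<Rightarrow> real"
  assumes \<alpha>: "\<alpha> > 0" and x0: "0 < x0" "x0 < 1" and M: "0 < M'" "M' < M"
    and d_nonneg: "\<And>n. d n \<ge> 0"
    and c_eq: "\<And>n. c n = d n * real n powr (- 1 / (1 + 2 * \<alpha>))"
    and window: "\<And>n. {x0 - c n .. x0 + c n} \<subseteq> {0..1}"
    and B: "filterlim B at_top sequentially"
    and nB: "filterlim (\<lambda>n. real n / ln (B n)) at_top sequentially"
    and f0: "f0 \<in> holder_class \<alpha> M'"
begin

text \<open>
The classical bandwidth is \<open>n powr (- \<gamma>)\<close> and the classical squared rate is \<open>n powr (- p)\<close>.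
\<close>

definition \<gamma> :: real where "\<gamma> = 1 / (1 + 2 * \<alpha>)"
definition p :: real where "p = 2 * \<alpha> / (1 + 2 * \<alpha>)"
definition k :: nat where "k = holder_order \<alpha>"

lemma \<gamma>_p: "\<gamma> > 0" "p > 0" "\<gamma> + p = 1" "\<gamma> * (2 * \<alpha>) = p" "\<gamma> * (2 * \<alpha> + 1) = 1"
  using \<alpha> by (auto simp: \<gamma>_def p_def field_simps)

lemma powr_\<gamma>: "X > 0 \<Longrightarrow> (X powr \<gamma>) powr (2 * \<alpha>) = X powr p" "X > 0 \<Longrightarrow> (X powr \<gamma>) powr (2 * \<alpha> + 1) = X"
  by (simp_all only: powr_powr \<gamma>_p powr_one less_imp_le)

lemma powr_\<gamma>_cancel: "X > 0 \<Longrightarrow> X powr (- \<gamma>) * X powr \<gamma> = 1"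
  by (simp add: powr_add[symmetric])

lemma n_split: "n > 0 \<Longrightarrow> real n = real n powr \<gamma> * real n powr p"
  by (simp add: powr_add[symmetric] \<gamma>_p)

lemma c_eq': "c n = d n * real n powr (- \<gamma>)"
  by (simp add: c_eq \<gamma>_def)

lemma c_nonneg: "c n \<ge> 0"
  using d_nonneg by (simp add: c_eq)

lemma ev_n: "eventually (\<lambda>n. n > 0) sequentially"
  by (rule eventually_gt_at_top)

lemma ev_B: "eventually (\<lambda>n. B n \<ge> C) sequentially"
  using B by (simp add: filterlim_at_top)

lemma ev_ln_B: "eventually (\<lambda>n. ln (B n) \<ge> C) sequentially"
  using ev_B[of "exp C"]
proof eventually_elim
  fix n assume n: "exp C \<le> B n"
  then have "0 < B n" using exp_gt_zero[of C] by linarith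
  then show "C \<le> ln (B n)" using n by (simp add: ln_ge_iff)
qed

definition bandwidth :: "nat \<Rightarrow> real" where
  "bandwidth n = (ln (B n) / real n) powr \<gamma>"

lemma ln_B_over_n: "(\<lambda>n. ln (B n) / real n) \<longlonglongrightarrow> 0"
proof -
  have "(\<lambda>n. inverse (real n / ln (B n))) \<longlonglongrightarrow> 0"
    by (rule tendsto_inverse_0_at_top[OF nB])
  then show ?thesis by simp
qed

lemma ln_B_over_n_nonneg: "eventually (\<lambda>n. ln (B n) / real n \<ge> 0) sequentially"
  using ev_ln_B[of 0] by eventually_elim simp

lemma ev_small_powr:
  assumes X: "X \<longlonglongrightarrow> 0" "eventually (\<lambda>n. X n \<ge> 0) sequentially" and e: "e > 0"
  shows "eventually (\<lambda>n. X n powr \<gamma> < e) sequentially"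
proof -
  have "(\<lambda>n. \<bar>X n\<bar> powr \<gamma>) \<longlonglongrightarrow> 0 powr \<gamma>"
    using \<gamma>_p tendsto_rabs_zero[OF X(1)] by (intro tendsto_powr' tendsto_const) auto
  then have "eventually (\<lambda>n. \<bar>X n\<bar> powr \<gamma> < e) sequentially"
    using e by (intro order_tendstoD(2)) auto
  then show ?thesis using X(2) by eventually_elim simp
qed

lemma ev_constraint:
  assumes X: "X \<longlonglongrightarrow> 0" "eventually (\<lambda>n. X n \<ge> 0) sequentially"
  shows "eventually (\<lambda>n. (real k + 1) * X n powr \<gamma> \<le> x0 \<and> (real k + 1) * X n powr \<gamma> \<le> 1 - x0) sequentially"
proof -
  have "min x0 (1 - x0) / (real k + 1) > 0" using x0 by simp
  from ev_small_powr[OF X this] show ?thesis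
    by eventually_elim (auto simp: field_simps)
qed

lemma superefficient_risk_bound:
  assumes "fh \<in> superefficient P W \<alpha> x0 c B f0"
  obtains K where "K > 0" "eventually (\<lambda>n. risk P W n (fh n) f0 x0 (c n) \<le> ennreal (K / (real n powr p * B n))) sequentially"
proof -
  have "limsup (\<lambda>n. ennreal (real n powr p * B n) * risk P W n (fh n) f0 x0 (c n)) < \<infinity>"
    using assms by (simp add: superefficient_def p_def)
  then obtain K where K: "K > 0" "eventually (\<lambda>n. ennreal (real n powr p * B n) * risk P W n (fh n) f0 x0 (c n) \<le> ennreal K) sequentially"
    unfolding limsup_finite_iff_eventually_bounded by blast
  have "eventually (\<lambda>n. risk P W n (fh n) f0 x0 (c n) \<le> ennreal (K / (real n powr p * B n))) sequentially"
    using K(2) ev_n ev_B[of 1]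
  proof eventually_elim
    case (elim n)
    let ?s = "real n powr p * B n" and ?r = "risk P W n (fh n) f0 x0 (c n)"
    have s: "?s > 0" using elim by simp
    have "ennreal (1 / s) * ennreal s = 1" if "s > 0" for s
      using that by (subst ennreal_mult'[symmetric]) auto
    then have "?r = ennreal (1 / ?s) * (ennreal ?s * ?r)"
      using s by (simp only: mult.assoc[symmetric] mult_1)
    also have "\<dots> \<le> ennreal (1 / ?s) * ennreal K" by (intro mult_left_mono elim) simp
    also have "\<dots> = ennreal (1 / ?s * K)" using s by (intro ennreal_mult'[symmetric]) simp
    finally show ?case by simp
  qed
  then show ?thesis using K(1) that by blast
qed

lemma superefficientI:
  assumes "\<And>n. fh n \<in> estimators"
    and "eventually (\<lambda>n. risk P W n (fh n) f0 x0 (c n) \<le> ennreal (V n) \<and> real n powr p * B n * V n \<le> K) sequentially"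
  shows "fh \<in> superefficient P W \<alpha> x0 c B f0"
proof -
  have "limsup (\<lambda>n. ennreal (real n powr p * B n) * risk P W n (fh n) f0 x0 (c n)) < \<infinity>"
    unfolding limsup_finite_iff_eventually_bounded
  proof (intro exI conjI)
    show "max K 1 > 0" by simp
    show "eventually (\<lambda>n. ennreal (real n powr p * B n) * risk P W n (fh n) f0 x0 (c n) \<le> ennreal (max K 1)) sequentially"
      using assms(2) ev_B[of 1]
    proof eventually_elim
      case (elim n)
      have "ennreal (real n powr p * B n) * risk P W n (fh n) f0 x0 (c n) \<le> ennreal (real n powr p * B n) * ennreal (V n)"
        using elim by (intro mult_left_mono) auto
      also have "\<dots> = ennreal (real n powr p * B n * V n)" using elim by (intro ennreal_mult'[symmetric]) simp
      also have "\<dots> \<le> ennreal (max K 1)" using elim by (intro ennreal_leI) auto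
      finally show ?case .
    qed
  qed
  then show ?thesis using assms(1) by (simp add: superefficient_def p_def)
qed

lemma limsup_max_risk_finiteI:
  assumes "eventually (\<lambda>n. s n \<ge> 0 \<and> max_risk P W n (fh n) \<alpha> M x0 (c n) \<le> ennreal (U n) \<and> s n * U n \<le> K) sequentially"
  shows "limsup (\<lambda>n. ennreal (s n) * max_risk P W n (fh n) \<alpha> M x0 (c n)) < \<infinity>"
  unfolding limsup_finite_iff_eventually_bounded
proof (intro exI conjI)
  show "max K 1 > 0" by simp
  show "eventually (\<lambda>n. ennreal (s n) * max_risk P W n (fh n) \<alpha> M x0 (c n) \<le> ennreal (max K 1)) sequentially"
    using assms
  proof eventually_elim
    case (elim n)
    have "ennreal (s n) * max_risk P W n (fh n) \<alpha> M x0 (c n) \<le> ennreal (s n) * ennreal (U n)"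
      using elim by (intro mult_left_mono) auto
    also have "\<dots> = ennreal (s n * U n)" using elim by (intro ennreal_mult'[symmetric]) simp
    also have "\<dots> \<le> ennreal (max K 1)" using elim by (intro ennreal_leI) auto
    finally show ?case .
  qed
qed

text \<open>
The largest factor for which a bump is known to keep the perturbed function in the class with
constant \<open>M\<close>.
\<close>

definition amplitude :: real where
  "amplitude = (M - M') / (2 * fact (Suc k))"

text \<open>
With this constant, \<open>n\<close> times the bound on the energy of a bump of width \<open>bump_width n\<close> is
\<open>ln (B n) / 2\<close>.
\<close>

definition \<kappa> :: real where
  "\<kappa> = 1 / (2 * amplitude\<^sup>2 * pi)"

lemma amplitude_pos: "amplitude > 0" and \<kappa>_pos: "\<kappa> > 0"
proof -
  show "amplitude > 0" using M by (simp add: amplitude_def del: fact_Suc)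
  then show "\<kappa> > 0" by (simp add: \<kappa>_def)
qed

definition bump_width :: "nat \<Rightarrow> real" where
  "bump_width n = (\<kappa> * ln (B n) / real n) powr \<gamma>"

lemma bump_width_pos: "n > 0 \<Longrightarrow> ln (B n) > 0 \<Longrightarrow> bump_width n > 0"
  using \<kappa>_pos by (auto simp: bump_width_def)

lemma quotient_powr_\<gamma>: "n > 0 \<Longrightarrow> L > 0 \<Longrightarrow> (L / real n) powr \<gamma> = L powr \<gamma> * real n powr (- \<gamma>)"
  by (simp add: powr_divide powr_minus_divide)

text \<open>
\<open>D n\<close> is a lower bound for the mean square of the bump over the window. Once \<open>n powr p * D n\<close>
stays away from zero, the risk allowed at \<open>f0\<close> is smaller than \<open>D n\<close> by a factor of order
\<open>1 / B\<close>, and the two-point bound applies for all large \<open>n\<close>.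
\<close>

lemma superefficient_lower_bound:
  assumes fh: "fh \<in> superefficient P W \<alpha> x0 c B f0"
    and C: "C > 0"
    and D: "eventually (\<lambda>n. D n \<le> amplitude\<^sup>2 * bump_width n powr (2 * \<alpha>) / 4 * (if c n \<le> bump_width n then 1 else bump_width n / c n)
              \<and> real n powr p * D n \<ge> C \<and> s n \<ge> 0 \<and> s n * D n \<ge> C) sequentially"
  shows "liminf (\<lambda>n. ennreal (s n) * max_risk P W n (fh n) \<alpha> M x0 (c n)) > 0"
proof -
  obtain K where K: "K > 0" "eventually (\<lambda>n. risk P W n (fh n) f0 x0 (c n) \<le> ennreal (K / (real n powr p * B n))) sequentially"
    using superefficient_risk_bound[OF fh] by blast
  have est: "fh n \<in> estimators" for n using fh by (simp add: superefficient_def)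
  have "eventually (\<lambda>n. ennreal (C / 8) \<le> ennreal (s n) * max_risk P W n (fh n) \<alpha> M x0 (c n)) sequentially"
    using K(2) D ev_n ev_ln_B[of 1] ev_B[of 1] ev_B[of "(16 * K / C)\<^sup>2"]
  proof eventually_elim
    case (elim n)
    let ?h = "bump_width n" and ?X = "\<kappa> * ln (B n) / real n"
    have Lp: "ln (B n) > 0" using elim by linarith
    then have X: "?X > 0" using elim \<kappa>_pos by simp
    have h: "?h > 0" using elim Lp by (intro bump_width_pos)
    have np: "real n powr p > 0" using elim by simp
    have D0: "D n > 0"
    proof (rule ccontr)
      assume "\<not> D n > 0"
      then have "real n powr p * D n \<le> 0" by (simp add: mult_nonneg_nonpos)
      then show False using elim C by linarith
    qed
    have "ennreal (D n / 8) \<le> max_risk P W n (fh n) \<alpha> M x0 (c n)"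
    proof (rule max_risk_lower_bound[OF est \<alpha> f0 _ _ _ c_nonneg window h amplitude_pos])
      show "0 \<le> M'" "M' \<le> M" "n > 0" using M elim by auto
      show "amplitude * (2 * fact (Suc (holder_order \<alpha>))) \<le> M - M'"
        by (simp add: amplitude_def k_def del: fact_Suc)
      show "B n > 0" using elim by simp
      have "?h powr (2 * \<alpha> + 1) = ?X" unfolding bump_width_def using X by (rule powr_\<gamma>)
      then show "real n * (amplitude\<^sup>2 * ?h powr (2 * \<alpha> + 1) * pi) \<le> ln (B n) / 2"
        using elim amplitude_pos by (simp add: \<kappa>_def)
      show "risk P W n (fh n) f0 x0 (c n) \<le> ennreal (K / (real n powr p * B n))" using elim by simp
      show "0 \<le> K / (real n powr p * B n)" using elim K by simp
      show "D n > 0" by (rule D0)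
      show "D n \<le> amplitude\<^sup>2 * ?h powr (2 * \<alpha>) / 4 * (if c n \<le> ?h then 1 else ?h / c n)" using elim by simp
      have "16 * K / C \<le> sqrt (B n)" using elim by (intro real_le_rsqrt) simp
      then have "16 * K \<le> C * sqrt (B n)" using C by (simp add: field_simps)
      also have "\<dots> \<le> real n powr p * D n * sqrt (B n)" using elim by (intro mult_right_mono) auto
      finally have "16 * K * sqrt (B n) \<le> real n powr p * D n * sqrt (B n) * sqrt (B n)"
        using elim by (intro mult_right_mono) auto
      then have "16 * K * sqrt (B n) \<le> D n * (real n powr p * B n)"
        using elim by (simp add: mult.assoc mult.left_commute)
      then show "16 * sqrt (B n) * (K / (real n powr p * B n)) \<le> D n"
        using np elim by (simp add: divide_le_eq mult.commute mult.left_commute)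
    qed
    then have "ennreal (s n) * ennreal (D n / 8) \<le> ennreal (s n) * max_risk P W n (fh n) \<alpha> M x0 (c n)"
      by (intro mult_left_mono) auto
    moreover have "ennreal (s n) * ennreal (D n / 8) = ennreal (s n * (D n / 8))"
      using elim by (intro ennreal_mult'[symmetric]) simp
    moreover have "ennreal (C / 8) \<le> ennreal (s n * (D n / 8))"
      using elim by (intro ennreal_leI) simp
    ultimately show ?case by simp
  qed
  then have "ennreal (C / 8) \<le> liminf (\<lambda>n. ennreal (s n) * max_risk P W n (fh n) \<alpha> M x0 (c n))"
    by (rule Liminf_bounded)
  moreover have "0 < ennreal (C / 8)" using C by simp
  ultimately show ?thesis by (rule less_le_trans[rotated])
qed

lemma rate_scale_inverse: "n > 0 \<Longrightarrow> L > 0 \<Longrightarrow> (real n / L) powr p * (L / real n) powr p = 1"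
  by (simp add: powr_mult[symmetric])

lemma c_le_scaled_bandwidth:
  assumes "n > 0" "L > 0" "b \<ge> 0" "d n * L powr (- 1 / (1 + 2 * \<alpha>)) \<le> b"
  shows "c n \<le> b * (L / real n) powr \<gamma>"
proof -
  have "d n \<le> b * L powr \<gamma>"
  proof -
    have "d n * L powr (- \<gamma>) * L powr \<gamma> \<le> b * L powr \<gamma>"
      using assms(4) by (intro mult_right_mono) (simp_all add: \<gamma>_def)
    then show ?thesis using powr_\<gamma>_cancel[OF assms(2)] by (simp only: mult.assoc mult_1_right)
  qed
  then have "d n * real n powr (- \<gamma>) \<le> b * L powr \<gamma> * real n powr (- \<gamma>)"
    by (intro mult_right_mono) auto
  then show ?thesis unfolding c_eq' quotient_powr_\<gamma>[OF assms(1,2)] by (simp only: mult.assoc)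
qed

text \<open>
The window lies inside the central part of the bump, where the bump has at least half of its height.
\<close>

lemma narrow_lower_bound:
  assumes "limsup (\<lambda>n. ereal (d n * ln (B n) powr (- 1 / (1 + 2 * \<alpha>)))) = 0"
    and fh: "fh \<in> superefficient P W \<alpha> x0 c B f0"
  shows "liminf (\<lambda>n. ennreal ((real n / ln (B n)) powr p) * max_risk P W n (fh n) \<alpha> M x0 (c n)) > 0"
proof -
  have "eventually (\<lambda>n. ereal (d n * ln (B n) powr (- 1 / (1 + 2 * \<alpha>))) < ereal (\<kappa> powr \<gamma>)) sequentially"
    using assms(1) \<kappa>_pos by (intro Limsup_lessD) (simp add: zero_ereal_def)
  then have small: "eventually (\<lambda>n. d n * ln (B n) powr (- 1 / (1 + 2 * \<alpha>)) \<le> \<kappa> powr \<gamma>) sequentially"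
    by (rule eventually_mono) simp
  define C where "C = amplitude\<^sup>2 * \<kappa> powr p / 4"
  have C: "C > 0" using amplitude_pos \<kappa>_pos by (simp add: C_def)
  show ?thesis
  proof (rule superefficient_lower_bound[OF fh C, where D="\<lambda>n. C * (ln (B n) / real n) powr p"])
    show "eventually (\<lambda>n. C * (ln (B n) / real n) powr p \<le> amplitude\<^sup>2 * bump_width n powr (2 * \<alpha>) / 4 * (if c n \<le> bump_width n then 1 else bump_width n / c n)
              \<and> real n powr p * (C * (ln (B n) / real n) powr p) \<ge> C \<and> (real n / ln (B n)) powr p \<ge> 0
              \<and> (real n / ln (B n)) powr p * (C * (ln (B n) / real n) powr p) \<ge> C) sequentially"
      using small ev_n ev_ln_B[of 1]
    proof eventually_elim
      case (elim n)
      let ?L = "ln (B n)"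
      have L: "?L > 0" using elim by linarith
      then have L: "?L > 0" "\<kappa> * ?L / real n > 0" using elim \<kappa>_pos by auto
      have bw: "bump_width n = \<kappa> powr \<gamma> * (?L / real n) powr \<gamma>"
        unfolding bump_width_def using L \<kappa>_pos by (simp add: powr_mult[symmetric])
      have cn: "c n \<le> bump_width n"
        unfolding bw by (rule c_le_scaled_bandwidth) (use elim L in auto)
      have "bump_width n powr (2 * \<alpha>) = (\<kappa> * ?L / real n) powr p"
        unfolding bump_width_def by (rule powr_\<gamma>[OF L(2)])
      also have "\<dots> = \<kappa> powr p * (?L / real n) powr p"
        using L \<kappa>_pos by (simp add: powr_mult[symmetric])
      finally have 1: "C * (?L / real n) powr p \<le> amplitude\<^sup>2 * bump_width n powr (2 * \<alpha>) / 4 * (if c n \<le> bump_width n then 1 else bump_width n / c n)"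
        using cn by (simp add: C_def)
      have "real n powr p * (C * (?L / real n) powr p) = C * ?L powr p"
        using elim L by (simp add: powr_divide)
      also have "\<dots> \<ge> C * 1" using elim C \<gamma>_p by (intro mult_left_mono ge_one_powr_ge_zero) auto
      finally have 2: "real n powr p * (C * (?L / real n) powr p) \<ge> C" by simp
      have "(real n / ?L) powr p * (C * (?L / real n) powr p) = C * ((real n / ?L) powr p * (?L / real n) powr p)" by simp
      also have "\<dots> = C" using rate_scale_inverse[OF elim(2) L(1)] by (simp only: mult_1_right)
      finally have 3: "C \<le> (real n / ?L) powr p * (C * (?L / real n) powr p)" by (simp only: order.refl)
      show ?case by (intro conjI 1 2 3 powr_ge_zero)
    qed
  qed
qed

text \<open>
The window contains a fixed fraction of the central part of the bump, so the mean square is of the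
order of the energy of the bump divided by the length of the window.
\<close>

lemma intermediate_lower_bound:
  assumes lo: "liminf (\<lambda>n. ereal (d n * ln (B n) powr (- 1 / (1 + 2 * \<alpha>)))) > 0"
    and hi: "limsup (\<lambda>n. ereal (d n / ln (B n))) = 0"
    and fh: "fh \<in> superefficient P W \<alpha> x0 c B f0"
  shows "liminf (\<lambda>n. ennreal (real n powr p * (d n / ln (B n))) * max_risk P W n (fh n) \<alpha> M x0 (c n)) > 0"
proof -
  obtain e where e: "e > 0" "eventually (\<lambda>n. e \<le> d n * ln (B n) powr (- 1 / (1 + 2 * \<alpha>))) sequentially"
  proof -
    obtain e where "0 < ereal e" "ereal e < liminf (\<lambda>n. ereal (d n * ln (B n) powr (- 1 / (1 + 2 * \<alpha>))))"
      using ereal_dense2[OF lo] by auto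
    moreover from less_LiminfD[OF this(2)] have "eventually (\<lambda>n. e \<le> d n * ln (B n) powr (- 1 / (1 + 2 * \<alpha>))) sequentially"
      by (rule eventually_mono) simp
    ultimately show ?thesis using that by auto
  qed
  have "eventually (\<lambda>n. ereal (d n / ln (B n)) < ereal 1) sequentially"
    using hi by (intro Limsup_lessD) (simp add: one_ereal_def[symmetric])
  then have small: "eventually (\<lambda>n. d n / ln (B n) \<le> 1) sequentially"
    by (rule eventually_mono) simp
  define q where "q = min 1 (e / \<kappa> powr \<gamma>)"
  have q: "q > 0" "q \<le> 1" "q \<le> e / \<kappa> powr \<gamma>" using e \<kappa>_pos by (auto simp: q_def)
  define C where "C = amplitude\<^sup>2 * q * \<kappa> / 4"
  have C: "C > 0" using amplitude_pos \<kappa>_pos q by (simp add: C_def)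
  show ?thesis
  proof (rule superefficient_lower_bound[OF fh C, where D="\<lambda>n. C * ln (B n) / (d n * real n powr p)"])
    show "eventually (\<lambda>n. C * ln (B n) / (d n * real n powr p) \<le> amplitude\<^sup>2 * bump_width n powr (2 * \<alpha>) / 4 * (if c n \<le> bump_width n then 1 else bump_width n / c n)
              \<and> real n powr p * (C * ln (B n) / (d n * real n powr p)) \<ge> C \<and> real n powr p * (d n / ln (B n)) \<ge> 0
              \<and> real n powr p * (d n / ln (B n)) * (C * ln (B n) / (d n * real n powr p)) \<ge> C) sequentially"
      using small e(2) ev_n ev_ln_B[of 1]
    proof eventually_elim
      case (elim n)
      let ?L = "ln (B n)" and ?h = "bump_width n"
      have L: "?L > 0" using elim by linarith
      then have L: "?L > 0" "\<kappa> * ?L / real n > 0" using elim \<kappa>_pos by auto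
      have h: "?h > 0" using elim L(1) by (intro bump_width_pos)
      have dn: "d n > 0" using elim e d_nonneg[of n] by (cases "d n = 0") auto
      have c0: "c n > 0" using dn elim by (simp add: c_eq')
      have bw: "?h = \<kappa> powr \<gamma> * (?L / real n) powr \<gamma>"
        unfolding bump_width_def using L \<kappa>_pos by (simp add: powr_mult[symmetric])
      have "e * ?L powr \<gamma> \<le> d n"
      proof -
        have "e * ?L powr \<gamma> \<le> d n * ?L powr (- \<gamma>) * ?L powr \<gamma>"
          using elim by (intro mult_right_mono) (simp_all add: \<gamma>_def)
        then show ?thesis using powr_\<gamma>_cancel[OF L(1)] by (simp only: mult.assoc mult_1_right)
      qed
      then have "e * ?L powr \<gamma> * real n powr (- \<gamma>) \<le> c n"
        unfolding c_eq' by (intro mult_right_mono) auto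
      then have "e * (?L / real n) powr \<gamma> \<le> c n"
        using elim L(1) by (simp only: quotient_powr_\<gamma> mult.assoc)
      moreover have "q * ?h \<le> e * (?L / real n) powr \<gamma>"
      proof -
        have "q * ?h \<le> e / \<kappa> powr \<gamma> * ?h" using q h by (intro mult_right_mono) auto
        also have "\<dots> = e * (?L / real n) powr \<gamma>" unfolding bw using \<kappa>_pos by simp
        finally show ?thesis .
      qed
      ultimately have "q * (?h / c n) \<le> (if c n \<le> ?h then 1 else ?h / c n)"
        using q c0 h by (auto simp: divide_le_eq mult_le_cancel_right1 intro!: mult_left_le_one_le)
      then have "amplitude\<^sup>2 * ?h powr (2 * \<alpha>) / 4 * (q * (?h / c n)) \<le> amplitude\<^sup>2 * ?h powr (2 * \<alpha>) / 4 * (if c n \<le> ?h then 1 else ?h / c n)"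
        by (intro mult_left_mono) auto
      note le = this
      have eq: "amplitude\<^sup>2 * ?h powr (2 * \<alpha>) / 4 * (q * (?h / c n)) = C * ?L / (d n * real n powr p)"
      proof -
        have "?h powr (2 * \<alpha>) * ?h = ?h powr (2 * \<alpha> + 1)" using h by (simp add: powr_add)
        also have "\<dots> = \<kappa> * ?L / real n" unfolding bump_width_def by (rule powr_\<gamma>[OF L(2)])
        finally have hh: "?h powr (2 * \<alpha>) * ?h = \<kappa> * ?L / real n" .
        have nc: "real n * c n = d n * real n powr p"
        proof -
          have "real n * c n = d n * (real n powr \<gamma> * real n powr (- \<gamma>)) * real n powr p"
            unfolding c_eq' by (subst n_split) (use elim in auto)
          then show ?thesis using elim by (simp add: powr_add[symmetric])
        qed
        have "amplitude\<^sup>2 * ?h powr (2 * \<alpha>) / 4 * (q * (?h / c n)) = amplitude\<^sup>2 * q / 4 * (?h powr (2 * \<alpha>) * ?h) / c n" by simp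
        also have "\<dots> = C * ?L / (real n * c n)" unfolding hh C_def by simp
        finally show ?thesis unfolding nc .
      qed
      have 1: "C * ?L / (d n * real n powr p) \<le> amplitude\<^sup>2 * ?h powr (2 * \<alpha>) / 4 * (if c n \<le> ?h then 1 else ?h / c n)"
        by (rule ord_eq_le_trans[OF eq[symmetric] le])
      have "d n \<le> ?L" using elim L by (simp add: divide_le_eq)
      then have "C * 1 \<le> C * (?L / d n)" using C dn by (intro mult_left_mono) (auto simp: le_divide_eq)
      then have 2: "real n powr p * (C * ?L / (d n * real n powr p)) \<ge> C" using elim by simp
      have 3: "real n powr p * (d n / ?L) * (C * ?L / (d n * real n powr p)) = C" using dn L elim by simp
      show ?case using 1 2 3 dn L by simp
    qed
  qed
qed

text \<open>
The first entry makes the threshold dominate the squared bias, the second one gives the tail the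
exponent that is needed.
\<close>

definition T :: real where
  "T = max ((bias_const k \<alpha> M)\<^sup>2) (16 * kernel_const k / 3)"

lemma f0_cont: "continuous_on {0..1} f0"
  by (rule holder_class_continuous[OF f0 \<alpha>]) (use M in simp)

lemma narrow_upper_bound:
  "\<exists>fh \<in> superefficient P W \<alpha> x0 c B f0.
     limsup (\<lambda>n. ennreal ((real n / ln (B n)) powr p) * max_risk P W n (fh n) \<alpha> M x0 (c n)) < \<infinity>"
proof -
  let ?h = bandwidth
  define fh where "fh n = two_stage k (?h n) x0 (window_measure x0 (c n)) (T * ?h n powr (2 * \<alpha>)) f0" for n
  define K1 where "K1 = 128 * kernel_const k * (real k + 1) / 3"
  define K2 where "K2 = 8 * (bias_const k \<alpha> M)\<^sup>2 + 4 * T + 64 * kernel_const k * (real k + 1) / 3"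
  define V where "V n = 128 * kernel_const k * (real k + 1) / (3 * real n * ?h n) * exp (- ln (B n))" for n
  have K1: "K1 > 0" using kernel_const_pos[of k] by (simp add: K1_def)
  have ev: "eventually (\<lambda>n. n > 0 \<and> ln (B n) \<ge> 1 \<and> B n > 0 \<and> ?h n = (ln (B n) / real n) powr \<gamma> \<and> ?h n > 0
     \<and> max_risk P W n (fh n) \<alpha> M x0 (c n) \<le> ennreal (K2 * ?h n powr (2 * \<alpha>))
     \<and> risk P W n (fh n) f0 x0 (c n) \<le> ennreal (V n)) sequentially"
    using ev_n ev_ln_B[of 1] ev_B[of 1] ev_constraint[OF ln_B_over_n ln_B_over_n_nonneg]
  proof eventually_elim
    case (elim n)
    have "ln (B n) > 0" using elim by linarith
    then have X: "ln (B n) / real n > 0" using elim by simp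
    have h: "?h n > 0" using X unfolding bandwidth_def powr_gt_zero by linarith
    have L: "real n * ?h n powr (2 * \<alpha> + 1) = ln (B n)"
      unfolding bandwidth_def powr_\<gamma>(2)[OF X] using elim by simp
    have con: "(real k + 1) * ?h n \<le> x0" "(real k + 1) * ?h n \<le> 1 - x0" using elim by (simp_all add: bandwidth_def)
    have T: "T \<ge> (bias_const k \<alpha> M)\<^sup>2" "T \<ge> 16 * kernel_const k / 3" by (auto simp: T_def)
    note r = two_stage_risk_narrow_window[OF \<alpha> f0 less_imp_le[OF M(1)] less_imp_le[OF M(2)] c_nonneg window elim(1) k_def h con T elim(2) L]
    show ?case using elim h r unfolding fh_def K2_def V_def by (auto simp: bandwidth_def)
  qed
  have "fh \<in> superefficient P W \<alpha> x0 c B f0"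
  proof (rule superefficientI[where V=V and K=K1])
    show "fh n \<in> estimators" for n
      unfolding fh_def by (rule two_stage_in_estimators[OF f0_cont c_nonneg])
    show "eventually (\<lambda>n. risk P W n (fh n) f0 x0 (c n) \<le> ennreal (V n) \<and> real n powr p * B n * V n \<le> K1) sequentially"
      using ev
    proof eventually_elim
      case (elim n)
      have "real n * ?h n = real n powr p * ln (B n) powr \<gamma>"
      proof -
        have "real n * ?h n = real n powr \<gamma> * real n powr p * (ln (B n) powr \<gamma> / real n powr \<gamma>)"
          using elim n_split[of n] by (simp add: powr_divide)
        then show ?thesis using elim by simp
      qed
      moreover have "ln (B n) powr \<gamma> \<ge> 1" using elim \<gamma>_p by (intro ge_one_powr_ge_zero) auto
      ultimately have "real n powr p * 1 \<le> real n * ?h n" by (simp only: mult_left_mono powr_ge_zero)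
      moreover have "real n * ?h n > 0" using elim by (intro mult_pos_pos) auto
      ultimately have "real n powr p / (real n * ?h n) \<le> 1" by (simp only: divide_le_eq_1_pos mult_1_right)
      then have "K1 * (real n powr p / (real n * ?h n)) \<le> K1 * 1" using K1 by (intro mult_left_mono) auto
      moreover have "B n * exp (- ln (B n)) = 1" using elim by (simp add: exp_minus)
      moreover have "real n powr p * B n * V n = K1 * (real n powr p / (real n * ?h n)) * (B n * exp (- ln (B n)))"
        by (simp add: V_def K1_def ac_simps)
      ultimately show ?case using elim by simp
    qed
  qed
  moreover have "limsup (\<lambda>n. ennreal ((real n / ln (B n)) powr p) * max_risk P W n (fh n) \<alpha> M x0 (c n)) < \<infinity>"
  proof (rule limsup_max_risk_finiteI[where K=K2 and U="\<lambda>n. K2 * ?h n powr (2 * \<alpha>)"])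
    show "eventually (\<lambda>n. (real n / ln (B n)) powr p \<ge> 0 \<and> max_risk P W n (fh n) \<alpha> M x0 (c n) \<le> ennreal (K2 * ?h n powr (2 * \<alpha>))
        \<and> (real n / ln (B n)) powr p * (K2 * ?h n powr (2 * \<alpha>)) \<le> K2) sequentially"
      using ev
    proof eventually_elim
      case (elim n)
      have Lp: "ln (B n) > 0" using elim by linarith
      then have X: "ln (B n) / real n > 0" using elim by simp
      have "?h n powr (2 * \<alpha>) = (ln (B n) / real n) powr p" unfolding bandwidth_def by (rule powr_\<gamma>(1)[OF X])
      then have "(real n / ln (B n)) powr p * (K2 * ?h n powr (2 * \<alpha>)) = K2"
        using rate_scale_inverse[of n "ln (B n)"] elim Lp by (simp only: mult.left_commute mult_1_right)
      then have "(real n / ln (B n)) powr p * (K2 * ?h n powr (2 * \<alpha>)) \<le> K2" by (rule eq_refl)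
      then show ?case using elim by (intro conjI powr_ge_zero) blast+
    qed
  qed
  ultimately show ?thesis by blast
qed

text \<open>
Covers the second and the third regime: there, \<open>s n\<close> is \<open>d n / ln (B n)\<close> and \<open>1\<close>. The
risk is of order \<open>n powr (- p) * (1 + ln (B n) / d n)\<close>.
\<close>

lemma wide_upper_bound:
  assumes d: "\<delta> > 0" "eventually (\<lambda>n. d n \<ge> \<delta>) sequentially"
    and s: "eventually (\<lambda>n. s n \<ge> 0 \<and> s n \<le> b \<and> s n * (ln (B n) / d n) \<le> b) sequentially"
  shows "\<exists>fh \<in> superefficient P W \<alpha> x0 c B f0.
     limsup (\<lambda>n. ennreal (real n powr p * s n) * max_risk P W n (fh n) \<alpha> M x0 (c n)) < \<infinity>"
proof -
  define h where "h n = (1 / real n) powr \<gamma>" for n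
  define fh where "fh n = two_stage k (h n) x0 (window_measure x0 (c n)) (T * (ln (B n) + d n + 1) / d n * h n powr (2 * \<alpha>)) f0" for n
  define K1 where "K1 = 128 * kernel_const k * (real k + 1) / 3"
  define K2 where "K2 = 8 * (bias_const k \<alpha> M)\<^sup>2 + 64 * kernel_const k * (real k + 1) / 3"
  define U where "U n = (8 * (bias_const k \<alpha> M)\<^sup>2 + 4 * T * (ln (B n) + d n + 1) / d n + 64 * kernel_const k * (real k + 1) / 3) * h n powr (2 * \<alpha>)" for n
  define V where "V n = 128 * kernel_const k * (real k + 1) / (3 * real n * c n) * exp (- ln (B n))" for n
  have K1: "K1 > 0" using kernel_const_pos[of k] by (simp add: K1_def)
  have K2: "K2 \<ge> 0" using kernel_const_pos[of k] by (simp add: K2_def)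
  have T: "T \<ge> (bias_const k \<alpha> M)\<^sup>2" "T \<ge> 16 * kernel_const k / 3" by (auto simp: T_def)
  then have T0: "T \<ge> 0" using kernel_const_pos[of k] by linarith
  have lim: "(\<lambda>n. 1 / real n) \<longlonglongrightarrow> 0" by (rule lim_1_over_n)
  have lim0: "eventually (\<lambda>n. 1 / real n \<ge> 0) sequentially" by simp
  have ev: "eventually (\<lambda>n. n > 0 \<and> ln (B n) \<ge> 1 \<and> B n > 0 \<and> d n \<ge> \<delta> \<and> c n = d n * h n \<and> h n > 0
     \<and> max_risk P W n (fh n) \<alpha> M x0 (c n) \<le> ennreal (U n)
     \<and> risk P W n (fh n) f0 x0 (c n) \<le> ennreal (V n)) sequentially"
    using ev_n ev_ln_B[of 1] ev_B[of 1] ev_constraint[OF lim lim0] d(2)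
  proof eventually_elim
    case (elim n)
    have X: "1 / real n > 0" using elim by simp
    have h: "h n > 0" using X by (simp add: h_def)
    have L: "real n * h n powr (2 * \<alpha> + 1) = 1"
      unfolding h_def powr_\<gamma>(2)[OF X] using elim by simp
    have con: "(real k + 1) * h n \<le> x0" "(real k + 1) * h n \<le> 1 - x0" using elim by (simp_all add: h_def)
    have cn: "c n = d n * h n" by (simp add: c_eq' h_def powr_divide powr_minus_divide)
    have dn: "d n > 0" using elim d by simp
    have L0: "ln (B n) \<ge> 0" using elim by simp
    note r = two_stage_risk_wide_window[OF \<alpha> f0 less_imp_le[OF M(1)] less_imp_le[OF M(2)] cn dn window elim(1) k_def h con T L0 L]
    show ?case using elim h cn r unfolding fh_def U_def V_def by auto
  qed
  have "fh \<in> superefficient P W \<alpha> x0 c B f0"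
  proof (rule superefficientI[where V=V and K="K1 / \<delta>"])
    show "fh n \<in> estimators" for n
      unfolding fh_def by (rule two_stage_in_estimators[OF f0_cont c_nonneg])
    show "eventually (\<lambda>n. risk P W n (fh n) f0 x0 (c n) \<le> ennreal (V n) \<and> real n powr p * B n * V n \<le> K1 / \<delta>) sequentially"
      using ev
    proof eventually_elim
      case (elim n)
      have nh: "real n * h n = real n powr p"
      proof -
        have "h n = real n powr (- \<gamma>)" by (simp add: h_def powr_divide powr_minus_divide)
        then have "real n * h n = real n powr 1 * real n powr (- \<gamma>)" by simp
        also have "\<dots> = real n powr (1 + - \<gamma>)" by (rule powr_add[symmetric])
        also have "1 + - \<gamma> = p" using \<gamma>_p by simp
        finally show ?thesis .
      qed
      have "c n = d n * h n" using elim by blast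
      then have "real n powr p * B n * V n = K1 * (real n powr p / (real n * h n)) / d n * (B n * exp (- ln (B n)))"
        by (simp add: V_def K1_def ac_simps)
      also have "B n * exp (- ln (B n)) = 1" using elim by (simp add: exp_minus)
      also have "K1 * (real n powr p / (real n * h n)) / d n * 1 = K1 * (real n powr p / (real n * h n)) / d n" by simp
      also have "\<dots> = K1 / d n" unfolding nh using elim by simp
      also have "\<dots> \<le> K1 / \<delta>" using elim d K1 by (intro divide_left_mono) auto
      finally show ?case using elim by blast
    qed
  qed
  moreover have "limsup (\<lambda>n. ennreal (real n powr p * s n) * max_risk P W n (fh n) \<alpha> M x0 (c n)) < \<infinity>"
  proof (rule limsup_max_risk_finiteI[where K="K2 * b + 4 * T * (b + b + b / \<delta>)" and U=U])
    show "eventually (\<lambda>n. real n powr p * s n \<ge> 0 \<and> max_risk P W n (fh n) \<alpha> M x0 (c n) \<le> ennreal (U n)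
        \<and> real n powr p * s n * U n \<le> K2 * b + 4 * T * (b + b + b / \<delta>)) sequentially"
      using ev s
    proof eventually_elim
      case (elim n)
      have X: "1 / real n > 0" using elim by simp
      have "h n powr (2 * \<alpha>) = (1 / real n) powr p" unfolding h_def by (rule powr_\<gamma>(1)[OF X])
      then have "real n powr p * h n powr (2 * \<alpha>) = 1" using elim by (simp add: powr_divide)
      then have "real n powr p * s n * U n = s n * (K2 + 4 * T * ((ln (B n) + d n + 1) / d n))"
        unfolding U_def K2_def by (simp add: mult.assoc mult.left_commute[of "real n powr p"] add.commute add.left_commute mult.commute[of _ "h n powr (2 * \<alpha>)"])
      also have "(ln (B n) + d n + 1) / d n = ln (B n) / d n + 1 + 1 / d n"
        using elim d by (simp add: add_divide_distrib)
      also have "s n * (K2 + 4 * T * (ln (B n) / d n + 1 + 1 / d n)) = K2 * s n + 4 * T * (s n * (ln (B n) / d n) + s n + s n / d n)"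
        by (simp add: algebra_simps)
      also have "\<dots> \<le> K2 * b + 4 * T * (b + b + b / \<delta>)"
        using elim d K2 T0 by (intro add_mono mult_left_mono frac_le) auto
      finally have le: "real n powr p * s n * U n \<le> K2 * b + 4 * T * (b + b + b / \<delta>)" .
      have "real n powr p * s n \<ge> 0" using elim by simp
      then show ?case using elim le by (intro conjI) blast+
    qed
  qed
  ultimately show ?thesis by blast
qed

lemma intermediate_upper_bound:
  assumes lo: "liminf (\<lambda>n. ereal (d n * ln (B n) powr (- 1 / (1 + 2 * \<alpha>)))) > 0"
    and hi: "limsup (\<lambda>n. ereal (d n / ln (B n))) = 0"
  shows "\<exists>fh \<in> superefficient P W \<alpha> x0 c B f0.
     limsup (\<lambda>n. ennreal (real n powr p * (d n / ln (B n))) * max_risk P W n (fh n) \<alpha> M x0 (c n)) < \<infinity>"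
proof -
  obtain e where e: "0 < ereal e" "ereal e < liminf (\<lambda>n. ereal (d n * ln (B n) powr (- 1 / (1 + 2 * \<alpha>))))"
    using ereal_dense2[OF lo] by auto
  have e2: "eventually (\<lambda>n. ereal e < ereal (d n * ln (B n) powr (- 1 / (1 + 2 * \<alpha>)))) sequentially"
    by (rule less_LiminfD[OF e(2)])
  have de: "eventually (\<lambda>n. d n \<ge> e) sequentially"
    using e2 ev_ln_B[of 1]
  proof eventually_elim
    case (elim n)
    have "ln (B n) powr (- 1 / (1 + 2 * \<alpha>)) \<le> ln (B n) powr 0"
      using elim \<alpha> by (intro powr_mono) auto
    also have "\<dots> = 1" using elim by simp
    finally have "d n * ln (B n) powr (- 1 / (1 + 2 * \<alpha>)) \<le> d n * 1"
      using d_nonneg by (intro mult_left_mono) auto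
    then show ?case using elim by simp
  qed
  have "eventually (\<lambda>n. ereal (d n / ln (B n)) < ereal 1) sequentially"
    using hi by (intro Limsup_lessD) (simp add: one_ereal_def[symmetric])
  then have "eventually (\<lambda>n. d n / ln (B n) \<ge> 0 \<and> d n / ln (B n) \<le> 1 \<and> d n / ln (B n) * (ln (B n) / d n) \<le> 1) sequentially"
    using de ev_ln_B[of 1]
  proof eventually_elim
    case (elim n)
    then show ?case using e(1) by simp
  qed
  from wide_upper_bound[OF _ de this] e(1) show ?thesis by simp
qed

lemma wide_window_upper_bound:
  assumes "liminf (\<lambda>n. ereal (d n / ln (B n))) > 0"
  shows "\<exists>fh \<in> superefficient P W \<alpha> x0 c B f0.
     limsup (\<lambda>n. ennreal (real n powr p) * max_risk P W n (fh n) \<alpha> M x0 (c n)) < \<infinity>"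
proof -
  obtain e where e: "0 < ereal e" "ereal e < liminf (\<lambda>n. ereal (d n / ln (B n)))"
    using ereal_dense2[OF assms] by auto
  have e2: "eventually (\<lambda>n. ereal e < ereal (d n / ln (B n))) sequentially"
    by (rule less_LiminfD[OF e(2)])
  have ev: "eventually (\<lambda>n. d n \<ge> e \<and> ln (B n) / d n \<le> 1 / e) sequentially"
    using e2 ev_ln_B[of 1]
  proof eventually_elim
    case (elim n)
    have 1: "e * ln (B n) \<le> d n" using elim by (simp add: less_divide_eq)
    have 2: "e * 1 \<le> e * ln (B n)" using elim e(1) by (intro mult_left_mono) auto
    have "e > 0" using e(1) by simp
    then have "d n > 0" using 1 2 by linarith
    have "ln (B n) \<le> d n / e" using 1 \<open>e > 0\<close> by (simp add: le_divide_eq mult.commute)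
    then have "ln (B n) / d n \<le> d n / e / d n" using \<open>d n > 0\<close> by (intro divide_right_mono) auto
    then show ?case using 1 2 \<open>d n > 0\<close> by simp
  qed
  have "eventually (\<lambda>n. (1::real) \<ge> 0 \<and> 1 \<le> max 1 (1 / e) \<and> 1 * (ln (B n) / d n) \<le> max 1 (1 / e)) sequentially"
    using ev by eventually_elim auto
  moreover have "eventually (\<lambda>n. d n \<ge> e) sequentially" using ev by (rule eventually_mono) simp
  moreover have "e > 0" using e(1) by simp
  ultimately show ?thesis using wide_upper_bound[of e "\<lambda>_. 1" "max 1 (1 / e)"] by simp
qed

end

theorem theorem1:
  fixes P :: "'w measure" and W :: "real \<Rightarrow> 'w \<Rightarrow> real"
    and \<alpha> x0 M M' :: real
    and B c d :: "nat \<Rightarrow> real"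
    and f0 :: "real \<Rightarrow> real"
  assumes "std_brownian_motion P W"
    and "\<alpha> > 0" and "0 < x0" and "x0 < 1" and "0 < M'" and "M' < M"
    and "\<And>n. d n \<ge> 0"
    and "\<And>n. c n = d n * real n powr (- 1 / (1 + 2 * \<alpha>))"
    and "\<And>n. {x0 - c n .. x0 + c n} \<subseteq> {0..1}"
    and "filterlim B at_top sequentially"
    and "filterlim (\<lambda>n. real n / ln (B n)) at_top sequentially"
    and "f0 \<in> holder_class \<alpha> M'"
  shows
    "(limsup (\<lambda>n. ereal (d n * ln (B n) powr (- 1 / (1 + 2 * \<alpha>)))) = 0 \<longrightarrow>
        (\<forall>fh \<in> superefficient P W \<alpha> x0 c B f0.
           liminf (\<lambda>n. ennreal ((real n / ln (B n)) powr (2 * \<alpha> / (1 + 2 * \<alpha>))) *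
                       max_risk P W n (fh n) \<alpha> M x0 (c n)) > 0) \<and>
        (\<exists>fh \<in> superefficient P W \<alpha> x0 c B f0.
           limsup (\<lambda>n. ennreal ((real n / ln (B n)) powr (2 * \<alpha> / (1 + 2 * \<alpha>))) *
                       max_risk P W n (fh n) \<alpha> M x0 (c n)) < \<infinity>)) \<and>
     (liminf (\<lambda>n. ereal (d n * ln (B n) powr (- 1 / (1 + 2 * \<alpha>)))) > 0 \<and>
      limsup (\<lambda>n. ereal (d n / ln (B n))) = 0 \<longrightarrow>
        (\<forall>fh \<in> superefficient P W \<alpha> x0 c B f0.
           liminf (\<lambda>n. ennreal (real n powr (2 * \<alpha> / (1 + 2 * \<alpha>)) * (d n / ln (B n))) *
                       max_risk P W n (fh n) \<alpha> M x0 (c n)) > 0) \<and>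
        (\<exists>fh \<in> superefficient P W \<alpha> x0 c B f0.
           limsup (\<lambda>n. ennreal (real n powr (2 * \<alpha> / (1 + 2 * \<alpha>)) * (d n / ln (B n))) *
                       max_risk P W n (fh n) \<alpha> M x0 (c n)) < \<infinity>)) \<and>
     (liminf (\<lambda>n. ereal (d n / ln (B n))) > 0 \<longrightarrow>
        (\<exists>fh \<in> superefficient P W \<alpha> x0 c B f0.
           limsup (\<lambda>n. ennreal (real n powr (2 * \<alpha> / (1 + 2 * \<alpha>))) *
                       max_risk P W n (fh n) \<alpha> M x0 (c n)) < \<infinity>))"
proof -
  interpret superefficiency P W \<alpha> x0 M M' B c d f0
    by (intro superefficiency.intro superefficiency_axioms.intro) (fact assms)+
  show ?thesis
    using narrow_lower_bound narrow_upper_bound intermediate_lower_bound intermediate_upper_bound wide_window_upper_bound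
    unfolding p_def by blast
qed

end
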